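(* All groups $G$, $K$ below are assumed to be countably infinite. The following hold: (1) If $G$ is LERF or $G$ is amenable, then $G$ is A-separable. (2) The class of A-separable groups is closed under free products: if $G$ and $K$ are A-separable, then so is the free product $G*K$. (3) There exist A-separable groups which are neither LERF nor amenable. (4) If $G$ has Kazhdan's property (T), then $G$ is A-separable if and only if $G$ is LERF.
   Context: A group $G$ is LERF (locally extended residually finite) if for every finitely generated subgroup $K\le G$ and every $g\in G\setminus K$ there is a finite index subgroup of $G$ that contains $K$ but does not contain $g$. $\mathrm{Sub}(G)$ is the space of all subgroups of $G$ with the Chabauty topology; for countable discrete $G$ a basis is given by the sets $\{K\in \mathrm{Sub}(G) : K\cap\Omega = H\cap\Omega\}$, with $H\in\mathrm{Sub}(G)$ and $\Omega\subseteq G$ finite. An action of a countable discrete group $G$ on a set $Y$ is amenable if it satisfies either of the following equivalent conditions: (i) for every $\varepsilon>0$ and every finite $\Omega\subseteq G$ there is a finite nonempty set $F\subseteq Y$ with $|gF\,\Delta\,F|/|F|<\varepsilon$ for all $g\in\Omega$; (ii) there is a finitely additive $G$-invariant probability measure on $Y$ (defined on all subsets of $Y$). A subgroup $K\le G$ is co-amenable if the action of $G$ on $G/K$ by left translation is amenable. The group $G$ is A-separable (amenably separable) if the set of co-amenable subgroups of $G$ is dense in $\mathrm{Sub}(G)$. Groups are considered as discrete groups. *)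

theory Defs
  imports
    "HOL-Analysis.Analysis"
    "HOL-Algebra.Generated_Groups"
    "HOL-Algebra.Left_Coset"
    "HOL-Library.Function_Algebras"
begin

definition countably_infinite_group :: "('a, 'm) monoid_scheme \<Rightarrow> bool" where
  "countably_infinite_group G \<longleftrightarrow> group G \<and> countable (carrier G) \<and> infinite (carrier G)"


section \<open>LERF groups\<close>

definition finitely_generated_subgroup :: "('a, 'm) monoid_scheme \<Rightarrow> 'a set \<Rightarrow> bool" where
  "finitely_generated_subgroup G K \<longleftrightarrow>
     (\<exists>S. finite S \<and> S \<subseteq> carrier G \<and> K = generate G S)"

definition finite_index_subgroup :: "('a, 'm) monoid_scheme \<Rightarrow> 'a set \<Rightarrow> bool" where
  "finite_index_subgroup G L \<longleftrightarrow> subgroup L G \<and> finite (lcosets\<^bsub>G\<^esub> L)"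

definition LERF :: "('a, 'm) monoid_scheme \<Rightarrow> bool" where
  "LERF G \<longleftrightarrow>
     (\<forall>K g. finitely_generated_subgroup G K \<and> g \<in> carrier G - K \<longrightarrow>
        (\<exists>L. finite_index_subgroup G L \<and> K \<subseteq> L \<and> g \<notin> L))"


section \<open>The Chabauty space of subgroups\<close>

definition chabauty :: "('a, 'm) monoid_scheme \<Rightarrow> 'a set topology" where
  "chabauty G = topology_generated_by
     {{K. subgroup K G \<and> K \<inter> \<Omega> = H \<inter> \<Omega>} |H \<Omega>. subgroup H G \<and> finite \<Omega> \<and> \<Omega> \<subseteq> carrier G}"

lemma topspace_chabauty: "topspace (chabauty G) = {H. subgroup H G}"
  unfolding chabauty_def topology_generated_by_topspace by blast


section \<open>Amenability\<close>

text \<open>The Foelner condition, for \<open>\<phi>\<close> an action of \<open>G\<close> on the set \<open>Y\<close>; only the values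
  \<open>\<phi> g y\<close> with \<open>g \<in> carrier G\<close> and \<open>y \<in> Y\<close> matter.\<close>

definition amenable_action ::
    "('a, 'm) monoid_scheme \<Rightarrow> 'y set \<Rightarrow> ('a \<Rightarrow> 'y \<Rightarrow> 'y) \<Rightarrow> bool" where
  "amenable_action G Y \<phi> \<longleftrightarrow>
     (\<forall>\<epsilon>::real. \<forall>\<Omega>. \<epsilon> > 0 \<and> finite \<Omega> \<and> \<Omega> \<subseteq> carrier G \<longrightarrow>
        (\<exists>F. finite F \<and> F \<noteq> {} \<and> F \<subseteq> Y \<and>
             (\<forall>g\<in>\<Omega>. real (card ((\<phi> g ` F - F) \<union> (F - \<phi> g ` F))) / real (card F) < \<epsilon>)))"

definition amenable_group :: "('a, 'm) monoid_scheme \<Rightarrow> bool" where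
  "amenable_group G \<longleftrightarrow> amenable_action G (carrier G) (\<lambda>g x. g \<otimes>\<^bsub>G\<^esub> x)"

definition co_amenable :: "('a, 'm) monoid_scheme \<Rightarrow> 'a set \<Rightarrow> bool" where
  "co_amenable G K \<longleftrightarrow>
     subgroup K G \<and> amenable_action G (lcosets\<^bsub>G\<^esub> K) (\<lambda>g C. g <#\<^bsub>G\<^esub> C)"

definition A_separable :: "('a, 'm) monoid_scheme \<Rightarrow> bool" where
  "A_separable G \<longleftrightarrow> chabauty G closure_of {K. co_amenable G K} = topspace (chabauty G)"


section \<open>Free products\<close>

text \<open>Words in the disjoint union of the two carriers, modulo the congruence generated by
  the multiplication tables and by deleting identity letters.\<close>

definition fp_words ::
    "('a, 'm) monoid_scheme \<Rightarrow> ('b, 'n) monoid_scheme \<Rightarrow> ('a + 'b) list set" where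
  "fp_words G K = lists (carrier G <+> carrier K)"

inductive fp_eq ::
    "('a, 'm) monoid_scheme \<Rightarrow> ('b, 'n) monoid_scheme \<Rightarrow> ('a + 'b) list \<Rightarrow> ('a + 'b) list \<Rightarrow> bool"
  for G K where
  fp_refl: "w \<in> fp_words G K \<Longrightarrow> fp_eq G K w w"
| fp_sym: "fp_eq G K u v \<Longrightarrow> fp_eq G K v u"
| fp_trans: "fp_eq G K u v \<Longrightarrow> fp_eq G K v w \<Longrightarrow> fp_eq G K u w"
| fp_append: "fp_eq G K u u' \<Longrightarrow> fp_eq G K v v' \<Longrightarrow> fp_eq G K (u @ v) (u' @ v')"
| fp_one_left: "fp_eq G K [Inl \<one>\<^bsub>G\<^esub>] []"
| fp_one_right: "fp_eq G K [Inr \<one>\<^bsub>K\<^esub>] []"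
| fp_mult_left: "x \<in> carrier G \<Longrightarrow> y \<in> carrier G \<Longrightarrow>
    fp_eq G K [Inl x, Inl y] [Inl (x \<otimes>\<^bsub>G\<^esub> y)]"
| fp_mult_right: "x \<in> carrier K \<Longrightarrow> y \<in> carrier K \<Longrightarrow>
    fp_eq G K [Inr x, Inr y] [Inr (x \<otimes>\<^bsub>K\<^esub> y)]"

definition fp_class ::
    "('a, 'm) monoid_scheme \<Rightarrow> ('b, 'n) monoid_scheme \<Rightarrow> ('a + 'b) list \<Rightarrow> ('a + 'b) list set" where
  "fp_class G K w = {v. fp_eq G K w v}"

definition free_product ::
    "('a, 'm) monoid_scheme \<Rightarrow> ('b, 'n) monoid_scheme \<Rightarrow> ('a + 'b) list set monoid" where
  "free_product G K =
     \<lparr>carrier = fp_class G K ` fp_words G K,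
      mult = (\<lambda>A B. {w. \<exists>u\<in>A. \<exists>v\<in>B. fp_eq G K (u @ v) w}),
      one = fp_class G K []\<rparr>"

lemma fp_words_simps [simp]:
  "[] \<in> fp_words G K"
  "Inl x # w \<in> fp_words G K \<longleftrightarrow> x \<in> carrier G \<and> w \<in> fp_words G K"
  "Inr y # w \<in> fp_words G K \<longleftrightarrow> y \<in> carrier K \<and> w \<in> fp_words G K"
  "u @ v \<in> fp_words G K \<longleftrightarrow> u \<in> fp_words G K \<and> v \<in> fp_words G K"
  by (auto simp: fp_words_def)

lemma fp_eq_words:
  assumes "group G" "group K" "fp_eq G K u v"
  shows "u \<in> fp_words G K \<and> v \<in> fp_words G K"
proof -
  interpret G: group G by fact
  interpret K: group K by fact
  show ?thesis
    using assms(3) by induction auto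
qed

lemma fp_class_eq_iff:
  assumes "group G" "group K" "u \<in> fp_words G K"
  shows "fp_class G K u = fp_class G K v \<longleftrightarrow> fp_eq G K u v"
  using assms unfolding fp_class_def
  by (metis (mono_tags, lifting) Collect_cong fp_refl fp_sym fp_trans mem_Collect_eq)

lemma fp_class_mult:
  assumes "u \<in> fp_words G K" "v \<in> fp_words G K"
  shows "fp_class G K u \<otimes>\<^bsub>free_product G K\<^esub> fp_class G K v = fp_class G K (u @ v)"
  using assms unfolding free_product_def fp_class_def
  by (auto intro: fp_refl) (meson fp_append fp_trans)

lemma fp_left_inverse:
  assumes "group G" "group K" "w \<in> fp_words G K"
  shows "\<exists>v \<in> fp_words G K. fp_eq G K (v @ w) []"
  using assms(3)
proof (induction w)
  case Nil
  then show ?case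
    by (intro bexI[of _ "[]"]) (auto intro: fp_refl)
next
  case (Cons a w)
  interpret G: group G by fact
  interpret K: group K by fact
  have w: "w \<in> fp_words G K"
    using Cons.prems by (cases a) auto
  then obtain v where v: "v \<in> fp_words G K" "fp_eq G K (v @ w) []"
    using Cons.IH by blast
  obtain b where b: "[b] \<in> fp_words G K" "fp_eq G K [b, a] []"
  proof (cases a)
    case (Inl x)
    with Cons.prems have x: "x \<in> carrier G" by simp
    have "fp_eq G K [Inl (inv\<^bsub>G\<^esub> x), Inl x] [Inl (inv\<^bsub>G\<^esub> x \<otimes>\<^bsub>G\<^esub> x)]"
      using x by (intro fp_mult_left) auto
    then have "fp_eq G K [Inl (inv\<^bsub>G\<^esub> x), Inl x] []"
      using x by (metis G.l_inv fp_one_left fp_trans)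
    then show ?thesis
      using that[of "Inl (inv\<^bsub>G\<^esub> x)"] x Inl by simp
  next
    case (Inr x)
    with Cons.prems have x: "x \<in> carrier K" by simp
    have "fp_eq G K [Inr (inv\<^bsub>K\<^esub> x), Inr x] [Inr (inv\<^bsub>K\<^esub> x \<otimes>\<^bsub>K\<^esub> x)]"
      using x by (intro fp_mult_right) auto
    then have "fp_eq G K [Inr (inv\<^bsub>K\<^esub> x), Inr x] []"
      using x by (metis K.l_inv fp_one_right fp_trans)
    then show ?thesis
      using that[of "Inr (inv\<^bsub>K\<^esub> x)"] x Inr by simp
  qed
  have "fp_eq G K (v @ ([b, a] @ w)) (v @ ([] @ w))"
    using v w b by (intro fp_append fp_refl) auto
  then have "fp_eq G K ((v @ [b]) @ (a # w)) []"
    using v(2) by (auto intro: fp_trans)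
  with v b show ?case
    by (intro bexI[of _ "v @ [b]"]) auto
qed

lemma group_free_product:
  assumes "group G" "group K"
  shows "group (free_product G K)"
proof (rule groupI)
  let ?P = "free_product G K"
  have carr: "carrier ?P = fp_class G K ` fp_words G K" and one: "\<one>\<^bsub>?P\<^esub> = fp_class G K []"
    by (simp_all add: free_product_def)
  show "\<one>\<^bsub>?P\<^esub> \<in> carrier ?P"
    by (simp add: carr one)
  show "x \<otimes>\<^bsub>?P\<^esub> y \<in> carrier ?P" if "x \<in> carrier ?P" "y \<in> carrier ?P" for x y
    using that by (auto simp: carr fp_class_mult)
  show "x \<otimes>\<^bsub>?P\<^esub> y \<otimes>\<^bsub>?P\<^esub> z = x \<otimes>\<^bsub>?P\<^esub> (y \<otimes>\<^bsub>?P\<^esub> z)"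
    if "x \<in> carrier ?P" "y \<in> carrier ?P" "z \<in> carrier ?P" for x y z
    using that by (auto simp: carr fp_class_mult)
  show "\<one>\<^bsub>?P\<^esub> \<otimes>\<^bsub>?P\<^esub> x = x" if "x \<in> carrier ?P" for x
    using that by (auto simp: carr one fp_class_mult)
  show "\<exists>y\<in>carrier ?P. y \<otimes>\<^bsub>?P\<^esub> x = \<one>\<^bsub>?P\<^esub>" if x: "x \<in> carrier ?P" for x
  proof -
    obtain w where w: "w \<in> fp_words G K" "x = fp_class G K w"
      using x carr by auto
    obtain v where v: "v \<in> fp_words G K" "fp_eq G K (v @ w) []"
      using fp_left_inverse[OF assms w(1)] by blast
    have "fp_class G K v \<otimes>\<^bsub>?P\<^esub> x = \<one>\<^bsub>?P\<^esub>"
      using v w by (simp add: fp_class_mult one fp_class_eq_iff[OF assms])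
    then show ?thesis
      using v carr by blast
  qed
qed


section \<open>Kazhdan's property (T)\<close>

definition ip_norm :: "('v \<Rightarrow> 'v \<Rightarrow> complex) \<Rightarrow> 'v \<Rightarrow> real" where
  "ip_norm ip v = sqrt (Re (ip v v))"

text \<open>A Hilbert space is a linear subspace \<open>V\<close> of an ambient complex vector space together with
  its own inner product \<open>ip\<close> (linear in the first argument) for which \<open>V\<close> is complete. The ambient
  space carries no inner product or topology, and \<open>ip\<close> is only relevant on \<open>V\<close>.\<close>

locale complex_hilbert_space = vector_space smul
  for smul :: "complex \<Rightarrow> 'v::ab_group_add \<Rightarrow> 'v" +
  fixes V :: "'v set" and ip :: "'v \<Rightarrow> 'v \<Rightarrow> complex"
  assumes subspace_V: "subspace V"
    and ip_add: "\<lbrakk>x \<in> V; y \<in> V; z \<in> V\<rbrakk> \<Longrightarrow> ip (x + y) z = ip x z + ip y z"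
    and ip_smul: "\<lbrakk>x \<in> V; y \<in> V\<rbrakk> \<Longrightarrow> ip (smul c x) y = c * ip x y"
    and ip_cnj: "\<lbrakk>x \<in> V; y \<in> V\<rbrakk> \<Longrightarrow> ip y x = cnj (ip x y)"
    and ip_pos: "\<lbrakk>x \<in> V; x \<noteq> 0\<rbrakk> \<Longrightarrow> Re (ip x x) > 0"
    and complete_V: "\<lbrakk>\<And>n. X n \<in> V;
        \<And>e. e > 0 \<Longrightarrow> \<exists>N. \<forall>m\<ge>N. \<forall>n\<ge>N. ip_norm ip (X m - X n) < e\<rbrakk>
      \<Longrightarrow> \<exists>l\<in>V. (\<lambda>n::nat. ip_norm ip (X n - l)) \<longlonglongrightarrow> 0"

definition unitary_operator ::
    "(complex \<Rightarrow> 'v::ab_group_add \<Rightarrow> 'v) \<Rightarrow> 'v set \<Rightarrow> ('v \<Rightarrow> 'v \<Rightarrow> complex) \<Rightarrow> ('v \<Rightarrow> 'v) \<Rightarrow> bool" where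
  "unitary_operator smul V ip U \<longleftrightarrow>
     bij_betw U V V \<and>
     (\<forall>x\<in>V. \<forall>y\<in>V. U (x + y) = U x + U y) \<and>
     (\<forall>c. \<forall>x\<in>V. U (smul c x) = smul c (U x)) \<and>
     (\<forall>x\<in>V. \<forall>y\<in>V. ip (U x) (U y) = ip x y)"

definition unitary_representation ::
    "('a, 'm) monoid_scheme \<Rightarrow> (complex \<Rightarrow> 'v::ab_group_add \<Rightarrow> 'v) \<Rightarrow> 'v set \<Rightarrow>
     ('v \<Rightarrow> 'v \<Rightarrow> complex) \<Rightarrow> ('a \<Rightarrow> 'v \<Rightarrow> 'v) \<Rightarrow> bool" where
  "unitary_representation G smul V ip \<pi> \<longleftrightarrow>
     complex_hilbert_space smul V ip \<and>
     (\<forall>g\<in>carrier G. unitary_operator smul V ip (\<pi> g)) \<and>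
     (\<forall>g\<in>carrier G. \<forall>h\<in>carrier G. \<forall>v\<in>V. \<pi> (g \<otimes>\<^bsub>G\<^esub> h) v = \<pi> g (\<pi> h v))"

text \<open>Property (T) of a discrete group: there is a Kazhdan pair \<open>(Q, \<epsilon>)\<close>, i.e. every unitary
  representation with a \<open>(Q, \<epsilon>)\<close>-invariant vector has a nonzero invariant vector. HOL cannot
  quantify over types inside a formula, so the Hilbert spaces range over those realised on
  linear subspaces of \<open>'a \<Rightarrow> complex\<close>, with pointwise operations and arbitrary inner product.
  This loses nothing: for any unitary representation with a \<open>(Q, \<epsilon>)\<close>-invariant vector \<open>v\<close>, the
  closed span of the orbit of \<open>v\<close> is a subrepresentation whose Hilbert dimension is at most the
  cardinality of \<open>carrier G\<close>, hence isometric to the square-summable functions on a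
  subset of \<open>carrier G\<close>.\<close>

definition property_T :: "('a, 'm) monoid_scheme \<Rightarrow> bool" where
  "property_T G \<longleftrightarrow>
     (\<exists>Q \<epsilon>::real. finite Q \<and> Q \<subseteq> carrier G \<and> \<epsilon> > 0 \<and>
       (\<forall>(V :: ('a \<Rightarrow> complex) set) ip \<pi>.
          unitary_representation G (\<lambda>c f x. c * f x) V ip \<pi> \<and>
          (\<exists>v\<in>V. v \<noteq> 0 \<and> (\<forall>g\<in>Q. ip_norm ip (\<pi> g v - v) < \<epsilon> * ip_norm ip v)) \<longrightarrow>
          (\<exists>v\<in>V. v \<noteq> 0 \<and> (\<forall>g\<in>carrier G. \<pi> g v = v))))"

end

theory Submission
  imports Defs "HOL-Algebra.Group_Action"
begin

text \<open>
  Unfolding the Chabauty topology, A-separability says: for every subgroup \<open>H\<close> and every finite set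
  \<open>\<Omega>\<close> there is a co-amenable subgroup which agrees with \<open>H\<close> on \<open>\<Omega>\<close> (\<open>A_separable_iff\<close>).

  Amenable groups are A-separable because Foelner sets can be pushed forward along equivariant maps
  (\<open>amenable_action_pushforward\<close>), so that all subgroups of an amenable group are co-amenable. For LERF groups,
  \<open>H\<close> may be replaced by the finitely generated subgroup \<open>generate G (H \<inter> \<Omega>)\<close>, which agrees on \<open>\<Omega>\<close>
  with a subgroup of finite index, and such subgroups are co-amenable.

  For free products (\<open>A_separable_free_product\<close>), consider the action of \<open>G * K\<close> on the cosets of \<open>H\<close>.
  Membership of the elements of \<open>\<Omega>\<close> in \<open>H\<close> depends on the partial action on a finite set \<open>Y\<close> of cosets
  only. A-separability of \<open>G\<close> allows to complete the partial \<open>G\<close>-action on \<open>Y\<close>, by adding points, to an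
  action whose stabilizers are co-amenable (\<open>co_amenable_completion\<close>), and likewise for \<open>K\<close>. If each
  factor fixes the points that were added for the other one, the result is an action of \<open>G * K\<close>. An infinite
  \<open>G\<close>-orbit has Foelner sets that avoid the finite set \<open>Y\<close> (\<open>foelner_set_avoiding\<close>); these are
  fixed pointwise by \<open>K\<close>, hence they are Foelner sets for \<open>G * K\<close>. If all orbits of both factors are
  finite, then so is the orbit of the base point. Either way the action on this orbit is amenable, and
  so the stabilizer of the base point is co-amenable (\<open>co_amenable_stabilizer\<close>).

  The free product of two copies of the additive group of rationals is therefore A-separable. It is
  not LERF, because a divisible element lies in all subgroups of finite index
  (\<open>LERF_hom_rat_group_trivial\<close>), and it is not amenable, because it has an action of ping-pong
  type (\<open>free_product_rat_nonamenable_action\<close>).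

  In a group with property (T), a co-amenable subgroup has finite index
  (\<open>property_T_co_amenable_finite_index\<close>): Foelner sets in the coset space provide almost invariant vectors
  in its \<open>\<ell>\<^sup>2\<close>-space, property (T) provides a nonzero invariant vector, and that is a constant
  function. Hence A-separability allows to separate elements from finitely generated subgroups by
  subgroups of finite index.
\<close>

section \<open>Group actions\<close>

text \<open>An action by total functions whose values off \<open>Y\<close> are arbitrary, which is the kind of action that
  \<open>amenable_action\<close> speaks about. (The library locale \<open>group_action\<close> asks for bijections
  of \<open>Y\<close> that are undefined elsewhere; an action on \<open>Y\<close> would then have to be redefined before it
  is an action on an invariant subset.)\<close>

definition acts :: "('a, 'm) monoid_scheme \<Rightarrow> 'y set \<Rightarrow> ('a \<Rightarrow> 'y \<Rightarrow> 'y) \<Rightarrow> bool" where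
  "acts G Y \<phi> \<longleftrightarrow>
     (\<forall>g\<in>carrier G. \<forall>y\<in>Y. \<phi> g y \<in> Y) \<and> (\<forall>y\<in>Y. \<phi> \<one>\<^bsub>G\<^esub> y = y) \<and>
     (\<forall>g\<in>carrier G. \<forall>h\<in>carrier G. \<forall>y\<in>Y. \<phi> (g \<otimes>\<^bsub>G\<^esub> h) y = \<phi> g (\<phi> h y))"

lemma acts_closed: "acts G Y \<phi> \<Longrightarrow> g \<in> carrier G \<Longrightarrow> y \<in> Y \<Longrightarrow> \<phi> g y \<in> Y"
  by (simp add: acts_def)

lemma acts_one: "acts G Y \<phi> \<Longrightarrow> y \<in> Y \<Longrightarrow> \<phi> \<one>\<^bsub>G\<^esub> y = y"
  by (simp add: acts_def)

lemma acts_mult: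
  "acts G Y \<phi> \<Longrightarrow> g \<in> carrier G \<Longrightarrow> h \<in> carrier G \<Longrightarrow> y \<in> Y \<Longrightarrow>
     \<phi> (g \<otimes>\<^bsub>G\<^esub> h) y = \<phi> g (\<phi> h y)"
  by (simp add: acts_def)

lemma acts_inv:
  assumes "group G" "acts G Y \<phi>" "g \<in> carrier G" "y \<in> Y"
  shows "\<phi> (inv\<^bsub>G\<^esub> g) (\<phi> g y) = y" "\<phi> g (\<phi> (inv\<^bsub>G\<^esub> g) y) = y"
proof -
  interpret group G by fact
  show "\<phi> (inv\<^bsub>G\<^esub> g) (\<phi> g y) = y" "\<phi> g (\<phi> (inv\<^bsub>G\<^esub> g) y) = y"
    using assms acts_mult[OF assms(2), of "inv\<^bsub>G\<^esub> g" g y] acts_mult[OF assms(2), of g "inv\<^bsub>G\<^esub> g" y]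
    by (simp_all add: acts_one)
qed

lemma acts_inj:
  assumes "group G" "acts G Y \<phi>" "g \<in> carrier G"
  shows "inj_on (\<phi> g) Y"
  by (rule inj_on_inverseI[where g = "\<phi> (inv\<^bsub>G\<^esub> g)"]) (rule acts_inv(1)[OF assms])

lemma orbit_memI: "g \<in> carrier G \<Longrightarrow> \<phi> g x \<in> orbit G \<phi> x"
  by (auto simp: orbit_def)

lemma orbit_refl: "group G \<Longrightarrow> acts G Y \<phi> \<Longrightarrow> x \<in> Y \<Longrightarrow> x \<in> orbit G \<phi> x"
  using orbit_memI[of "\<one>\<^bsub>G\<^esub>" G \<phi> x] by (simp add: acts_one group.is_monoid)

lemma orbit_subset: "acts G Y \<phi> \<Longrightarrow> x \<in> Y \<Longrightarrow> orbit G \<phi> x \<subseteq> Y"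
  by (auto simp: orbit_def acts_closed)

lemma orbit_eq:
  assumes "group G" "acts G Y \<phi>" "x \<in> Y" "y \<in> orbit G \<phi> x"
  shows "orbit G \<phi> y = orbit G \<phi> x"
proof -
  interpret group G by fact
  obtain g where g: "g \<in> carrier G" "y = \<phi> g x"
    using assms(4) by (auto simp: orbit_def)
  show ?thesis
  proof
    show "orbit G \<phi> y \<subseteq> orbit G \<phi> x"
    proof
      fix z assume "z \<in> orbit G \<phi> y"
      then obtain h where h: "h \<in> carrier G" "z = \<phi> h y" by (auto simp: orbit_def)
      then have "z = \<phi> (h \<otimes>\<^bsub>G\<^esub> g) x" using g assms by (simp add: acts_mult)
      then show "z \<in> orbit G \<phi> x" using g h by (auto simp: orbit_def)
    qed
    show "orbit G \<phi> x \<subseteq> orbit G \<phi> y"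
    proof
      fix z assume "z \<in> orbit G \<phi> x"
      then obtain h where h: "h \<in> carrier G" "z = \<phi> h x" by (auto simp: orbit_def)
      then have "z = \<phi> (h \<otimes>\<^bsub>G\<^esub> inv\<^bsub>G\<^esub> g) y"
        using g assms by (simp add: acts_mult acts_inv acts_closed)
      then show "z \<in> orbit G \<phi> y" using g h by (auto simp: orbit_def)
    qed
  qed
qed

lemma acts_subset:
  assumes "acts G Y \<phi>" "T \<subseteq> Y" "\<And>g x. g \<in> carrier G \<Longrightarrow> x \<in> T \<Longrightarrow> \<phi> g x \<in> T"
  shows "acts G T \<phi>"
  using assms unfolding acts_def by blast

lemma acts_orbit:
  assumes "group G" "acts G Y \<phi>" "x \<in> Y"
  shows "acts G (orbit G \<phi> x) \<phi>"
proof (rule acts_subset[OF assms(2)])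
  show "orbit G \<phi> x \<subseteq> Y" using assms by (simp add: orbit_subset)
  show "\<phi> g y \<in> orbit G \<phi> x" if "g \<in> carrier G" "y \<in> orbit G \<phi> x" for g y
    using orbit_eq[OF assms that(2)] orbit_memI[OF that(1), of \<phi> y] by simp
qed

lemma subgroup_stabilizer:
  assumes "group G" "acts G Y \<phi>" "x \<in> Y"
  shows "subgroup (stabilizer G \<phi> x) G"
proof -
  interpret group G by fact
  show ?thesis
  proof
    fix g assume "g \<in> stabilizer G \<phi> x"
    then show "inv\<^bsub>G\<^esub> g \<in> stabilizer G \<phi> x"
      using acts_inv(1)[OF assms(1,2) _ assms(3), of g] by (simp add: stabilizer_def)
  qed (use assms in \<open>auto simp: stabilizer_def acts_mult acts_one\<close>)
qed

section \<open>Foelner sets\<close>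

text \<open>An injective map pushes exactly as many points out of a finite set \<open>F\<close> as it leaves points of \<open>F\<close>
  uncovered, so this number is half of the symmetric difference in the Foelner condition. Working
  with it reduces all estimates to counting points of \<open>F\<close>.\<close>

definition escape :: "('y \<Rightarrow> 'y) \<Rightarrow> 'y set \<Rightarrow> nat" where
  "escape f F = card {x \<in> F. f x \<notin> F}"

lemma card_sym_diff_image:
  assumes "finite F" "inj_on f F"
  shows "card ((f ` F - F) \<union> (F - f ` F)) = 2 * escape f F"
proof -
  have 1: "card (f ` F - F) = escape f F"
  proof -
    have "f ` F - F = f ` {x \<in> F. f x \<notin> F}" by auto
    moreover have "inj_on f {x \<in> F. f x \<notin> F}" using assms(2) by (rule inj_on_subset) auto
    ultimately show ?thesis by (simp add: escape_def card_image)
  qed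
  have "card (F - f ` F) = card F - card (F \<inter> f ` F)"
    using assms(1) by (simp add: card_Diff_subset_Int)
  moreover have "card (f ` F - F) = card F - card (F \<inter> f ` F)"
    using assms by (simp add: card_Diff_subset_Int card_image Int_commute)
  moreover have "card ((f ` F - F) \<union> (F - f ` F)) = card (f ` F - F) + card (F - f ` F)"
    by (rule card_Un_disjoint) (use assms(1) in auto)
  ultimately show ?thesis
    using 1 by linarith
qed


text \<open>Since \<open>escape\<close> is half of a symmetric difference, a Foelner set for \<open>\<epsilon>\<close> is one for \<open>2 * \<epsilon>\<close> in the
  sense of \<open>amenable_action\<close>.\<close>

definition foelner_set :: "('a \<Rightarrow> 'y \<Rightarrow> 'y) \<Rightarrow> 'a set \<Rightarrow> real \<Rightarrow> 'y set \<Rightarrow> bool" where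
  "foelner_set \<phi> \<Omega> \<epsilon> F \<longleftrightarrow>
     finite F \<and> F \<noteq> {} \<and> (\<forall>g\<in>\<Omega>. real (escape (\<phi> g) F) < \<epsilon> * real (card F))"

lemma foelner_setD:
  assumes "foelner_set \<phi> \<Omega> \<epsilon> F"
  shows "finite F" "F \<noteq> {}" "card F > 0" "g \<in> \<Omega> \<Longrightarrow> real (escape (\<phi> g) F) < \<epsilon> * real (card F)"
  using assms by (auto simp: foelner_set_def card_gt_0_iff)

lemma foelner_set_iff:
  assumes "\<And>g. g \<in> \<Omega> \<Longrightarrow> inj_on (\<phi> g) F"
  shows "foelner_set \<phi> \<Omega> \<epsilon> F \<longleftrightarrow> finite F \<and> F \<noteq> {} \<and>
     (\<forall>g\<in>\<Omega>. real (card ((\<phi> g ` F - F) \<union> (F - \<phi> g ` F))) / real (card F) < 2 * \<epsilon>)"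
proof (cases "finite F \<and> F \<noteq> {}")
  case True
  then have "card F > 0" by (simp add: card_gt_0_iff)
  have "real (card ((\<phi> g ` F - F) \<union> (F - \<phi> g ` F))) / real (card F) < 2 * \<epsilon> \<longleftrightarrow>
        real (escape (\<phi> g) F) < \<epsilon> * real (card F)" if "g \<in> \<Omega>" for g
    using card_sym_diff_image[OF _ assms[OF that]] True \<open>card F > 0\<close>
    by (simp add: divide_less_eq)
  with True show ?thesis unfolding foelner_set_def by blast
qed (auto simp: foelner_set_def)

lemma amenable_action_iff:
  assumes "group G" "acts G Y \<phi>"
  shows "amenable_action G Y \<phi> \<longleftrightarrow>
     (\<forall>\<epsilon>>0. \<forall>\<Omega>. finite \<Omega> \<and> \<Omega> \<subseteq> carrier G \<longrightarrow> (\<exists>F\<subseteq>Y. foelner_set \<phi> \<Omega> \<epsilon> F))" (is "?L \<longleftrightarrow> ?R")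
proof -
  have inj: "inj_on (\<phi> g) F" if "g \<in> \<Omega>" "\<Omega> \<subseteq> carrier G" "F \<subseteq> Y" for g \<Omega> F
    using acts_inj[OF assms, of g] that by (meson inj_on_subset subsetD)
  show ?thesis
  proof
    assume L: ?L
    show ?R
    proof (intro allI impI, elim conjE)
      fix \<epsilon> :: real and \<Omega> assume *: "\<epsilon> > 0" "finite \<Omega>" "\<Omega> \<subseteq> carrier G"
      then have "2 * \<epsilon> > 0 \<and> finite \<Omega> \<and> \<Omega> \<subseteq> carrier G" by simp
      from L[unfolded amenable_action_def, THEN spec, THEN spec, THEN mp, OF this]
      obtain F where F: "finite F" "F \<noteq> {}" "F \<subseteq> Y"
          "\<forall>g\<in>\<Omega>. real (card ((\<phi> g ` F - F) \<union> (F - \<phi> g ` F))) / real (card F) < 2 * \<epsilon>"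
        by (elim exE conjE)
      have "foelner_set \<phi> \<Omega> \<epsilon> F"
        using foelner_set_iff[of \<Omega> \<phi> F \<epsilon>, OF inj[OF _ *(3) F(3)]] F(1,2,4) by simp
      with F(3) show "\<exists>F\<subseteq>Y. foelner_set \<phi> \<Omega> \<epsilon> F" by blast
    qed
  next
    assume R: ?R
    show ?L unfolding amenable_action_def
    proof (intro allI impI, elim conjE)
      fix \<epsilon> :: real and \<Omega> assume *: "\<epsilon> > 0" "finite \<Omega>" "\<Omega> \<subseteq> carrier G"
      then have "\<epsilon> / 2 > 0" by simp
      with R * obtain F where F: "F \<subseteq> Y" "foelner_set \<phi> \<Omega> (\<epsilon> / 2) F" by blast
      have "2 * (\<epsilon> / 2) = \<epsilon>" by simp
      then have "finite F \<and> F \<noteq> {} \<and>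
          (\<forall>g\<in>\<Omega>. real (card ((\<phi> g ` F - F) \<union> (F - \<phi> g ` F))) / real (card F) < \<epsilon>)"
        using foelner_set_iff[of \<Omega> \<phi> F "\<epsilon> / 2", OF inj[OF _ *(3) F(1)]] F(2) by simp
      with F(1) show "\<exists>F. finite F \<and> F \<noteq> {} \<and> F \<subseteq> Y \<and>
          (\<forall>g\<in>\<Omega>. real (card ((\<phi> g ` F - F) \<union> (F - \<phi> g ` F))) / real (card F) < \<epsilon>)"
        by (intro exI[of _ F]) simp
    qed
  qed
qed

lemma amenable_actionI:
  assumes "group G" "acts G Y \<phi>"
    and "\<And>(\<epsilon>::real) \<Omega>. \<epsilon> > 0 \<Longrightarrow> finite \<Omega> \<Longrightarrow> \<Omega> \<subseteq> carrier G \<Longrightarrow> \<exists>F\<subseteq>Y. foelner_set \<phi> \<Omega> \<epsilon> F"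
  shows "amenable_action G Y \<phi>"
  unfolding amenable_action_iff[OF assms(1,2)] by (intro allI impI, elim conjE) (rule assms(3))

lemma amenable_actionE:
  fixes \<epsilon> :: real
  assumes "amenable_action G Y \<phi>" "group G" "acts G Y \<phi>" "\<epsilon> > 0" "finite \<Omega>" "\<Omega> \<subseteq> carrier G"
  obtains F where "F \<subseteq> Y" "foelner_set \<phi> \<Omega> \<epsilon> F"
proof -
  have "\<exists>F\<subseteq>Y. foelner_set \<phi> \<Omega> \<epsilon> F"
    using assms(1,4-6) by (simp add: amenable_action_iff[OF assms(2,3)])
  then obtain F where "F \<subseteq> Y" "foelner_set \<phi> \<Omega> \<epsilon> F" by (elim exE conjE)
  then show thesis by (rule that)
qed

lemma amenable_action_finite:
  assumes "group G" "acts G Y \<phi>" "finite Y" "Y \<noteq> {}"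
  shows "amenable_action G Y \<phi>"
proof (rule amenable_actionI[OF assms(1,2)])
  fix \<epsilon> :: real and \<Omega> assume *: "\<epsilon> > 0" "\<Omega> \<subseteq> carrier G"
  have "escape (\<phi> g) Y = 0" if "g \<in> \<Omega>" for g
  proof -
    have "{x \<in> Y. \<phi> g x \<notin> Y} = {}" using acts_closed[OF assms(2)] * that by blast
    then show ?thesis by (metis escape_def card.empty)
  qed
  then have "foelner_set \<phi> \<Omega> \<epsilon> Y"
    using * assms(3,4) by (simp add: foelner_set_def card_gt_0_iff)
  then show "\<exists>F\<subseteq>Y. foelner_set \<phi> \<Omega> \<epsilon> F" by blast
qed

text \<open>A point that leaves \<open>F\<close> under \<open>f \<circ> h\<close> either leaves already under \<open>h\<close>, or \<open>h\<close> moves it to a point of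
  \<open>F\<close> that leaves under \<open>f\<close>; in the latter case \<open>h\<close> is an injection into the points counted for
  \<open>f\<close>.\<close>

lemma escape_comp:
  assumes "finite F" "inj_on h F"
  shows "escape (\<lambda>x. f (h x)) F \<le> escape h F + escape f F"
proof -
  have "{x \<in> F. f (h x) \<notin> F} \<subseteq> {x \<in> F. h x \<notin> F} \<union> {x \<in> F. h x \<in> F \<and> f (h x) \<notin> F}" by auto
  then have "escape (\<lambda>x. f (h x)) F \<le> card ({x \<in> F. h x \<notin> F} \<union> {x \<in> F. h x \<in> F \<and> f (h x) \<notin> F})"
    unfolding escape_def using assms(1) by (intro card_mono) auto
  also have "\<dots> \<le> escape h F + card {x \<in> F. h x \<in> F \<and> f (h x) \<notin> F}"
    unfolding escape_def by (rule card_Un_le)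
  also have "card {x \<in> F. h x \<in> F \<and> f (h x) \<notin> F} \<le> escape f F"
    unfolding escape_def
    by (rule card_inj_on_le[of h]) (use assms in \<open>auto intro: inj_on_subset\<close>)
  finally show ?thesis by simp
qed

lemma escape_Diff:
  assumes "finite F" "finite Y" "inj_on f F"
  shows "escape f (F - Y) \<le> escape f F + card Y"
proof -
  have "{x \<in> F - Y. f x \<notin> F - Y} \<subseteq> {x \<in> F. f x \<notin> F} \<union> {x \<in> F. f x \<in> Y}" by auto
  then have "escape f (F - Y) \<le> card ({x \<in> F. f x \<notin> F} \<union> {x \<in> F. f x \<in> Y})"
    unfolding escape_def using assms(1) by (intro card_mono) auto
  also have "\<dots> \<le> escape f F + card {x \<in> F. f x \<in> Y}"
    unfolding escape_def by (rule card_Un_le)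
  also have "card {x \<in> F. f x \<in> Y} \<le> card Y"
    by (rule card_inj_on_le[of f]) (use assms in \<open>auto intro: inj_on_subset\<close>)
  finally show ?thesis by simp
qed


section \<open>Pushing Foelner sets forward\<close>

lemma sum_card_swap:
  assumes "finite A" "finite B"
  shows "(\<Sum>a\<in>A. card {b\<in>B. P a b}) = (\<Sum>b\<in>B. card {a\<in>A. P a b})"
proof -
  have "(\<Sum>a\<in>A. card {b\<in>B. P a b}) = (\<Sum>a\<in>A. \<Sum>b\<in>B. if P a b then 1 else 0)"
    using assms by (simp add: sum.If_cases Int_def)
  also have "\<dots> = (\<Sum>b\<in>B. \<Sum>a\<in>A. if P a b then 1 else 0)" by (rule sum.swap)
  also have "\<dots> = (\<Sum>b\<in>B. card {a\<in>A. P a b})"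
    using assms by (simp add: sum.If_cases Int_def)
  finally show ?thesis .
qed

lemma card_fibres:
  assumes "finite F"
  shows "(\<Sum>z\<in>f ` F. card {y \<in> F. f y = z \<and> P y}) = card {y \<in> F. P y}"
proof -
  have "card {y \<in> F. P y} = (\<Sum>y\<in>F. card {z \<in> f ` F. f y = z \<and> P y})"
  proof -
    have "card {z \<in> f ` F. f y = z \<and> P y} = (if P y then 1 else 0)" if "y \<in> F" for y
    proof -
      have "{z \<in> f ` F. f y = z \<and> P y} = (if P y then {f y} else {})" using that by auto
      then show ?thesis by simp
    qed
    then have "(\<Sum>y\<in>F. card {z \<in> f ` F. f y = z \<and> P y}) = (\<Sum>y\<in>F. if P y then 1 else 0)"
      by (intro sum.cong) auto
    then show ?thesis using assms by (simp add: sum.If_cases Int_def)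
  qed
  then show ?thesis using assms by (subst sum_card_swap) auto
qed

text \<open>The counting function \<open>c F\<close> is the image of the indicator function of \<open>F\<close> under \<open>f\<close>, and the sets on
  the left are its superlevel sets. A point \<open>z\<close> contributes to the sum once for every level \<open>t\<close>
  with \<open>c F (b z) < t \<le> c F z\<close>, hence \<open>c F z - c F (b z)\<close> times. As \<open>a\<close> embeds the part of the
  fibre over \<open>z\<close> that stays in \<open>F\<close> into the fibre over \<open>b z\<close>, at least that many points of the
  fibre over \<open>z\<close> leave \<open>F\<close>.\<close>

lemma escape_level_sets:
  fixes f :: "'y \<Rightarrow> 'z"
  defines "c \<equiv> \<lambda>F z. card {y \<in> F. f y = z}"
  assumes fin: "finite F" and inj: "inj_on a F" and eq: "\<And>y. y \<in> F \<Longrightarrow> f (a y) = b (f y)"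
  shows "(\<Sum>t=1..card F. escape b {z \<in> f ` F. t \<le> c F z}) \<le> escape a F"
proof -
  have *: "{z \<in> {z \<in> f ` F. t \<le> c F z}. b z \<notin> {z \<in> f ` F. t \<le> c F z}} =
        {z \<in> f ` F. c F (b z) < t \<and> t \<le> c F z}" if "t \<in> {1..card F}" for t
  proof -
    \<comment> \<open>Levels start at 1, so a point outside of the image of \<open>F\<close> lies below every level.\<close>
    have "c F (b z) < t" if "b z \<notin> f ` F" for z
    proof -
      have "{y \<in> F. f y = b z} = {}"
      proof (rule ccontr)
        assume "{y \<in> F. f y = b z} \<noteq> {}"
        then obtain y where "y \<in> F" "f y = b z" by blast
        then have "b z \<in> f ` F" by (metis imageI)
        with that show False by contradiction
      qed
      then have "c F (b z) = 0" unfolding c_def by (simp only: card.empty)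
      then show ?thesis using \<open>t \<in> {1..card F}\<close> by simp
    qed
    then show ?thesis by (auto simp: not_le)
  qed
  have "(\<Sum>t=1..card F. escape b {z \<in> f ` F. t \<le> c F z}) =
        (\<Sum>t=1..card F. card {z \<in> f ` F. c F (b z) < t \<and> t \<le> c F z})"
    unfolding escape_def by (intro sum.cong refl arg_cong[where f = card]) (rule *)
  also have "\<dots> = (\<Sum>z\<in>f ` F. card {t \<in> {1..card F}. c F (b z) < t \<and> t \<le> c F z})"
    using fin by (intro sum_card_swap) auto
  also have "\<dots> \<le> (\<Sum>z\<in>f ` F. card {y \<in> F. f y = z \<and> a y \<notin> F})"
  proof (rule sum_mono)
    fix z assume "z \<in> f ` F"
    have "card {t \<in> {1..card F}. c F (b z) < t \<and> t \<le> c F z} \<le> card {c F (b z)<..c F z}"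
      by (intro card_mono) auto
    then have 1: "card {t \<in> {1..card F}. c F (b z) < t \<and> t \<le> c F z} \<le> c F z - c F (b z)" by simp
    have "c F z = card ({y \<in> F. f y = z \<and> a y \<notin> F} \<union> {y \<in> F. f y = z \<and> a y \<in> F})"
      unfolding c_def by (rule arg_cong[where f = card]) blast
    also have "\<dots> \<le> card {y \<in> F. f y = z \<and> a y \<notin> F} + card {y \<in> F. f y = z \<and> a y \<in> F}"
      by (rule card_Un_le)
    finally have 2: "c F z \<le> card {y \<in> F. f y = z \<and> a y \<notin> F} + card {y \<in> F. f y = z \<and> a y \<in> F}" .
    have 3: "card {y \<in> F. f y = z \<and> a y \<in> F} \<le> c F (b z)"
      unfolding c_def
    proof (rule card_inj_on_le[of a])
      show "inj_on a {y \<in> F. f y = z \<and> a y \<in> F}" using inj by (rule inj_on_subset) blast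
      show "a ` {y \<in> F. f y = z \<and> a y \<in> F} \<subseteq> {y \<in> F. f y = b z}" by (auto simp: eq)
    qed (use fin in simp)
    from 1 2 3 show "card {t \<in> {1..card F}. c F (b z) < t \<and> t \<le> c F z} \<le>
        card {y \<in> F. f y = z \<and> a y \<notin> F}" by linarith
  qed
  also have "\<dots> = escape a F" unfolding escape_def using fin by (rule card_fibres)
  finally show ?thesis .
qed

lemma card_level_sets:
  assumes "finite F"
  shows "(\<Sum>t=1..card F. card {z \<in> f ` F. t \<le> card {y \<in> F. f y = z}}) = card F"
proof -
  have "(\<Sum>t=1..card F. card {z \<in> f ` F. t \<le> card {y \<in> F. f y = z}}) =
        (\<Sum>z\<in>f ` F. card {t \<in> {1..card F}. t \<le> card {y \<in> F. f y = z}})"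
    using assms by (intro sum_card_swap) auto
  also have "\<dots> = (\<Sum>z\<in>f ` F. card {y \<in> F. f y = z \<and> True})"
  proof (rule sum.cong[OF refl])
    fix z
    have "card {y \<in> F. f y = z} \<le> card F" using assms by (intro card_mono) auto
    then have "{t \<in> {1..card F}. t \<le> card {y \<in> F. f y = z}} = {1..card {y \<in> F. f y = z}}" by auto
    then show "card {t \<in> {1..card F}. t \<le> card {y \<in> F. f y = z}} = card {y \<in> F. f y = z \<and> True}"
      by simp
  qed
  also have "\<dots> = card F" using card_fibres[OF assms, of f "\<lambda>_. True"] by simp
  finally show ?thesis .
qed

text \<open>The image of a Foelner set \<open>F\<close> need not be Foelner, because \<open>f\<close> may have fibres of very different
  sizes. The image of the indicator function of \<open>F\<close> is almost invariant in the \<open>\<ell>\<^sup>1\<close> sense, however,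
  and both its norm and its displacement are sums over its superlevel sets (\<open>card_level_sets\<close>, \<open>escape_level_sets\<close>). The displacements,
  summed over all levels and over \<open>\<Omega>\<close>, are less than \<open>\<epsilon>\<close> times the sum of the sizes of the
  superlevel sets, so one of these sets is Foelner for all of \<open>\<Omega>\<close> at once.\<close>

lemma amenable_action_pushforward:
  fixes f :: "'y \<Rightarrow> 'z"
  assumes G: "group G" "acts G Y \<phi>" and G': "group G'" "acts G' Z \<psi>"
    and f: "f ` Y \<subseteq> Z"
    and lift: "\<And>g'. g' \<in> carrier G' \<Longrightarrow> \<exists>g\<in>carrier G. \<forall>y\<in>Y. f (\<phi> g y) = \<psi> g' (f y)"
    and am: "amenable_action G Y \<phi>"
  shows "amenable_action G' Z \<psi>"
proof (rule amenable_actionI[OF G'])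
  fix \<epsilon> :: real and \<Omega> assume \<epsilon>: "\<epsilon> > 0" and \<Omega>: "finite \<Omega>" "\<Omega> \<subseteq> carrier G'"
  obtain l where l: "\<And>g'. g' \<in> carrier G' \<Longrightarrow> l g' \<in> carrier G"
      "\<And>g' y. g' \<in> carrier G' \<Longrightarrow> y \<in> Y \<Longrightarrow> f (\<phi> (l g') y) = \<psi> g' (f y)"
    using lift bchoice[of "carrier G'" "\<lambda>g' g. g \<in> carrier G \<and> (\<forall>y\<in>Y. f (\<phi> g y) = \<psi> g' (f y))"]
    by blast
  define \<delta> where "\<delta> = \<epsilon> / (card \<Omega> + 1)"
  have \<delta>: "\<delta> > 0" using \<epsilon> by (simp add: \<delta>_def)
  obtain F where F: "F \<subseteq> Y" "foelner_set \<phi> (l ` \<Omega>) \<delta> F"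
    by (rule amenable_actionE[OF am G \<delta>, of "l ` \<Omega>"]) (use \<Omega> l(1) in auto)
  note FD = foelner_setD[OF F(2)]
  define L where "L t = {z \<in> f ` F. t \<le> card {y \<in> F. f y = z}}" for t :: nat
  have Lesc: "(\<Sum>t=1..card F. escape (\<psi> g') (L t)) \<le> escape (\<phi> (l g')) F" if "g' \<in> \<Omega>" for g'
  proof -
    have g': "g' \<in> carrier G'" using that \<Omega> by blast
    show ?thesis unfolding L_def
    proof (rule escape_level_sets[OF FD(1)])
      show "inj_on (\<phi> (l g')) F" using acts_inj[OF G l(1)[OF g']] F(1) by (rule inj_on_subset)
    qed (use F(1) l(2)[OF g'] in blast)
  qed
  have "(\<Sum>t=1..card F. \<Sum>g'\<in>\<Omega>. real (escape (\<psi> g') (L t))) =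
        (\<Sum>g'\<in>\<Omega>. real (\<Sum>t=1..card F. escape (\<psi> g') (L t)))"
    by (subst sum.swap) simp
  also have "\<dots> \<le> (\<Sum>g'\<in>\<Omega>. \<delta> * card F)"
  proof (rule sum_mono)
    fix g' assume g': "g' \<in> \<Omega>"
    have "real (\<Sum>t=1..card F. escape (\<psi> g') (L t)) \<le> real (escape (\<phi> (l g')) F)"
      using Lesc[OF g'] by (simp only: of_nat_le_iff)
    also have "\<dots> \<le> \<delta> * card F" using FD(4)[of "l g'"] g' by simp
    finally show "real (\<Sum>t=1..card F. escape (\<psi> g') (L t)) \<le> \<delta> * card F" .
  qed
  also have "\<dots> = \<epsilon> * (card \<Omega> / (card \<Omega> + 1)) * card F" by (simp add: \<delta>_def)
  also have "\<dots> < \<epsilon> * 1 * card F"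
    using \<epsilon> FD(3) by (intro mult_strict_right_mono mult_strict_left_mono) auto
  also have "\<dots> = (\<Sum>t=1..card F. \<epsilon> * card (L t))"
    using card_level_sets[OF FD(1), of f] unfolding L_def
    by (simp flip: sum_distrib_left of_nat_sum)
  finally have "\<not> (\<forall>t\<in>{1..card F}. (\<Sum>g'\<in>\<Omega>. real (escape (\<psi> g') (L t))) \<ge> \<epsilon> * card (L t))"
    using sum_mono[of "{1..card F}" "\<lambda>t. \<epsilon> * card (L t)" "\<lambda>t. \<Sum>g'\<in>\<Omega>. real (escape (\<psi> g') (L t))"]
    by (meson not_le)
  then obtain t where t: "(\<Sum>g'\<in>\<Omega>. real (escape (\<psi> g') (L t))) < \<epsilon> * card (L t)"
    by (meson not_le)
  have "real (escape (\<psi> g') (L t)) < \<epsilon> * card (L t)" if "g' \<in> \<Omega>" for g'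
    using member_le_sum[OF that, of "\<lambda>g'. real (escape (\<psi> g') (L t))"] \<Omega>(1) t by simp
  moreover have "L t \<noteq> {}"
  proof
    assume "L t = {}"
    moreover have "(\<Sum>g'\<in>\<Omega>. real (escape (\<psi> g') (L t))) \<ge> 0" by (intro sum_nonneg) simp
    ultimately show False using t by simp
  qed
  moreover have "finite (L t)" using FD(1) by (simp add: L_def)
  ultimately have "foelner_set \<psi> \<Omega> \<epsilon> (L t)" by (simp add: foelner_set_def)
  moreover have "L t \<subseteq> Z" using f F(1) by (auto simp: L_def)
  ultimately show "\<exists>F\<subseteq>Z. foelner_set \<psi> \<Omega> \<epsilon> F" by blast
qed

section \<open>Coset spaces and stabilizers\<close>

lemma acts_lcosets:
  assumes "group G" "subgroup H G"
  shows "acts G (lcosets\<^bsub>G\<^esub> H) (\<lambda>g C. g <#\<^bsub>G\<^esub> C)"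
proof -
  interpret group G by fact
  have H: "H \<subseteq> carrier G" using assms(2) by (rule subgroup.subset)
  have 1: "g <#\<^bsub>G\<^esub> (a <#\<^bsub>G\<^esub> H) = (g \<otimes>\<^bsub>G\<^esub> a) <#\<^bsub>G\<^esub> H" if "g \<in> carrier G" "a \<in> carrier G" for g a
    using lcos_m_assoc[OF H that] .
  show ?thesis
    unfolding acts_def LCOSETS_def by (auto simp: 1 m_assoc)
qed

lemma l_coset_eq_iff:
  assumes "group G" "subgroup H G" "g \<in> carrier G" "h \<in> carrier G"
  shows "g <#\<^bsub>G\<^esub> H = h <#\<^bsub>G\<^esub> H \<longleftrightarrow> inv\<^bsub>G\<^esub> g \<otimes>\<^bsub>G\<^esub> h \<in> H"
proof -
  interpret group G by fact
  interpret subgroup H G by fact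
  show ?thesis
  proof
    assume "g <#\<^bsub>G\<^esub> H = h <#\<^bsub>G\<^esub> H"
    then have "h \<in> g <#\<^bsub>G\<^esub> H" using lcos_self[OF assms(4,2)] by simp
    then show "inv\<^bsub>G\<^esub> g \<otimes>\<^bsub>G\<^esub> h \<in> H" by (rule lcos_module_imp[OF assms(1,3)])
  next
    assume *: "inv\<^bsub>G\<^esub> g \<otimes>\<^bsub>G\<^esub> h \<in> H"
    have "h = g \<otimes>\<^bsub>G\<^esub> (inv\<^bsub>G\<^esub> g \<otimes>\<^bsub>G\<^esub> h)"
      using assms(3,4) by (simp flip: m_assoc)
    then have "h \<in> g <#\<^bsub>G\<^esub> H" using * unfolding l_coset_def by blast
    then show "g <#\<^bsub>G\<^esub> H = h <#\<^bsub>G\<^esub> H" by (rule l_repr_independence[OF _ assms(3,2)])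
  qed
qed

text \<open>The orbit of \<open>x\<close> is the space of cosets of its stabilizer: the elements that carry \<open>x\<close> to a given
  point form a left coset. So co-amenable subgroups are found by constructing actions.\<close>

lemma co_amenable_stabilizer:
  assumes G: "group G" "acts G Y \<phi>" and x: "x \<in> Y"
    and am: "amenable_action G (orbit G \<phi> x) \<phi>"
  shows "co_amenable G (stabilizer G \<phi> x)"
proof -
  interpret group G by fact
  let ?S = "stabilizer G \<phi> x"
  have S: "subgroup ?S G" by (rule subgroup_stabilizer[OF G x])
  define f where "f y = {g \<in> carrier G. \<phi> g x = y}" for y
  have f: "f (\<phi> h x) = h <#\<^bsub>G\<^esub> ?S" if h: "h \<in> carrier G" for h
  proof (intro equalityI subsetI)
    fix g assume "g \<in> f (\<phi> h x)"
    then have g: "g \<in> carrier G" "\<phi> g x = \<phi> h x" by (auto simp: f_def)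
    then have "inv\<^bsub>G\<^esub> h \<otimes>\<^bsub>G\<^esub> g \<in> ?S"
      using h acts_mult[OF G(2) _ g(1) x, of "inv\<^bsub>G\<^esub> h"] acts_inv(1)[OF G h x]
      by (simp add: stabilizer_def)
    moreover have "g = h \<otimes>\<^bsub>G\<^esub> (inv\<^bsub>G\<^esub> h \<otimes>\<^bsub>G\<^esub> g)" using g h by (simp flip: m_assoc)
    ultimately show "g \<in> h <#\<^bsub>G\<^esub> ?S" unfolding l_coset_def by blast
  next
    fix g assume "g \<in> h <#\<^bsub>G\<^esub> ?S"
    then show "g \<in> f (\<phi> h x)"
      using h acts_mult[OF G(2) h _ x] by (auto simp: l_coset_def f_def stabilizer_def)
  qed
  have "amenable_action G (lcosets\<^bsub>G\<^esub> ?S) (\<lambda>g C. g <#\<^bsub>G\<^esub> C)"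
  proof (rule amenable_action_pushforward[where f = f, OF G(1) acts_orbit[OF G x] G(1) acts_lcosets[OF G(1) S] _ _ am])
    show "f ` orbit G \<phi> x \<subseteq> lcosets\<^bsub>G\<^esub> ?S"
      using f by (auto simp: orbit_def LCOSETS_def)
    fix g assume g: "g \<in> carrier G"
    have "f (\<phi> g y) = g <#\<^bsub>G\<^esub> f y" if y: "y \<in> orbit G \<phi> x" for y
    proof -
      obtain h where h: "h \<in> carrier G" "y = \<phi> h x" using y by (auto simp: orbit_def)
      have "\<phi> g y = \<phi> (g \<otimes>\<^bsub>G\<^esub> h) x" using acts_mult[OF G(2) g h(1) x] h by simp
      then show ?thesis
        using f[of "g \<otimes>\<^bsub>G\<^esub> h"] f[OF h(1)] g h lcos_m_assoc[OF subgroup.subset[OF S] g h(1)] by simp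
    qed
    then show "\<exists>g'\<in>carrier G. \<forall>y\<in>orbit G \<phi> x. f (\<phi> g' y) = g <#\<^bsub>G\<^esub> f y"
      using g by blast
  qed
  with S show ?thesis by (simp add: co_amenable_def)
qed

text \<open>An orbit map \<open>g \<mapsto> \<phi> g y0\<close> pushes the Foelner sets of the group into \<open>Y\<close>.\<close>

lemma amenable_group_amenable_action:
  assumes "group G" "amenable_group G" "acts G Y \<phi>" "Y \<noteq> {}"
  shows "amenable_action G Y \<phi>"
proof -
  interpret group G by fact
  obtain y0 where y0: "y0 \<in> Y" using assms(4) by blast
  have "acts G (carrier G) (\<lambda>g x. g \<otimes>\<^bsub>G\<^esub> x)" by (auto simp: acts_def m_assoc)
  then show ?thesis
  proof (rule amenable_action_pushforward[where f = "\<lambda>g. \<phi> g y0", OF assms(1) _ assms(1,3)])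
    show "(\<lambda>g. \<phi> g y0) ` carrier G \<subseteq> Y" using acts_closed[OF assms(3) _ y0] by blast
    show "\<exists>g'\<in>carrier G. \<forall>h\<in>carrier G. \<phi> (g' \<otimes>\<^bsub>G\<^esub> h) y0 = \<phi> g (\<phi> h y0)" if "g \<in> carrier G" for g
      using acts_mult[OF assms(3) that _ y0] that by blast
    show "amenable_action G (carrier G) (\<lambda>g x. g \<otimes>\<^bsub>G\<^esub> x)"
      using assms(2) by (simp add: amenable_group_def)
  qed
qed

lemma lcosets_nonempty: "group G \<Longrightarrow> lcosets\<^bsub>G\<^esub> H \<noteq> {}"
  using monoid.one_closed[of G] group.is_monoid[of G] by (auto simp: LCOSETS_def)

section \<open>Approximation in the Chabauty space\<close>

text \<open>The generating sets form a base and not only a subbase: if \<open>H\<close> lies in the basic sets given by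
  two finite windows, then agreement with \<open>H\<close> on the union of the windows implies membership in both.\<close>

lemma chabauty_nhds:
  assumes "openin (chabauty G) T" "H \<in> T"
  obtains \<Omega> where "finite \<Omega>" "\<Omega> \<subseteq> carrier G" "\<And>K. subgroup K G \<Longrightarrow> K \<inter> \<Omega> = H \<inter> \<Omega> \<Longrightarrow> K \<in> T"
proof -
  let ?B = "{{K. subgroup K G \<and> K \<inter> \<Omega> = H \<inter> \<Omega>} |H \<Omega>. subgroup H G \<and> finite \<Omega> \<and> \<Omega> \<subseteq> carrier G}"
  have "generate_topology_on ?B T"
    using assms(1) by (simp add: chabauty_def openin_topology_generated_by_iff)
  then have "H \<in> T \<Longrightarrow> \<exists>\<Omega>. finite \<Omega> \<and> \<Omega> \<subseteq> carrier G \<and> (\<forall>K. subgroup K G \<and> K \<inter> \<Omega> = H \<inter> \<Omega> \<longrightarrow> K \<in> T)"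
  proof induction
    case (Int a b)
    then obtain A B where A: "finite A" "A \<subseteq> carrier G" "\<forall>K. subgroup K G \<and> K \<inter> A = H \<inter> A \<longrightarrow> K \<in> a"
      and B: "finite B" "B \<subseteq> carrier G" "\<forall>K. subgroup K G \<and> K \<inter> B = H \<inter> B \<longrightarrow> K \<in> b" by auto
    have "K \<in> a \<inter> b" if "subgroup K G" "K \<inter> (A \<union> B) = H \<inter> (A \<union> B)" for K
    proof -
      have "K \<inter> A = H \<inter> A" "K \<inter> B = H \<inter> B" using that(2) by blast+
      with that(1) A(3) B(3) show ?thesis by blast
    qed
    then show ?case using A(1,2) B(1,2) by (intro exI[of _ "A \<union> B"]) auto
  next
    case (UN \<K>)
    then obtain k where k: "k \<in> \<K>" "H \<in> k" by blast
    from UN.IH[OF this] obtain \<Omega> where \<Omega>: "finite \<Omega>" "\<Omega> \<subseteq> carrier G"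
      "\<forall>K. subgroup K G \<and> K \<inter> \<Omega> = H \<inter> \<Omega> \<longrightarrow> K \<in> k" by (elim exE conjE)
    have "K \<in> \<Union>\<K>" if "subgroup K G" "K \<inter> \<Omega> = H \<inter> \<Omega>" for K
      by (rule UnionI[OF k(1) mp[OF spec[OF \<Omega>(3)] conjI[OF that]]])
    then show ?case using \<Omega>(1,2) by (intro exI[of _ \<Omega>]) simp
  next
    case (Basis s)
    then obtain H' \<Omega> where *: "s = {K. subgroup K G \<and> K \<inter> \<Omega> = H' \<inter> \<Omega>}" "finite \<Omega>" "\<Omega> \<subseteq> carrier G"
      by auto
    then show ?case using Basis.prems by (intro exI[of _ \<Omega>]) simp
  qed simp
  from this[OF assms(2)] obtain \<Omega> where "finite \<Omega>" "\<Omega> \<subseteq> carrier G"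
    "\<forall>K. subgroup K G \<and> K \<inter> \<Omega> = H \<inter> \<Omega> \<longrightarrow> K \<in> T" by (elim exE conjE)
  then show thesis by (intro that[of \<Omega>]) simp_all
qed

text \<open>The form in which A-separability is used and proved from here on: every subgroup can be imitated on
  every finite window by a co-amenable one.\<close>

lemma A_separable_iff:
  "A_separable G \<longleftrightarrow>
     (\<forall>H \<Omega>. subgroup H G \<and> finite \<Omega> \<and> \<Omega> \<subseteq> carrier G \<longrightarrow>
        (\<exists>K. co_amenable G K \<and> K \<inter> \<Omega> = H \<inter> \<Omega>))" (is "_ \<longleftrightarrow> ?R")
proof
  assume A: "A_separable G"
  show ?R
  proof (intro allI impI, elim conjE)
    fix H \<Omega> assume *: "subgroup H G" "finite \<Omega>" "\<Omega> \<subseteq> carrier G"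
    let ?T = "{K. subgroup K G \<and> K \<inter> \<Omega> = H \<inter> \<Omega>}"
    have "openin (chabauty G) ?T"
      unfolding chabauty_def by (rule topology_generated_by_Basis) (use * in blast)
    then have T: "H \<in> ?T \<and> openin (chabauty G) ?T" using *(1) by simp
    have "H \<in> chabauty G closure_of {K. co_amenable G K}"
      using A *(1) by (simp add: A_separable_def topspace_chabauty)
    then have "\<forall>T. H \<in> T \<and> openin (chabauty G) T \<longrightarrow> (\<exists>K. K \<in> {K. co_amenable G K} \<and> K \<in> T)"
      unfolding in_closure_of by (rule conjunct2)
    from mp[OF spec[OF this] T] show "\<exists>K. co_amenable G K \<and> K \<inter> \<Omega> = H \<inter> \<Omega>"
      by auto
  qed
next
  assume R: ?R
  have "H \<in> chabauty G closure_of {K. co_amenable G K}" if H: "subgroup H G" for H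
    unfolding in_closure_of
  proof (intro conjI allI impI)
    show "H \<in> topspace (chabauty G)" using H by (simp add: topspace_chabauty)
    fix T assume "H \<in> T \<and> openin (chabauty G) T"
    then obtain \<Omega> where \<Omega>: "finite \<Omega>" "\<Omega> \<subseteq> carrier G"
      "\<And>K. subgroup K G \<Longrightarrow> K \<inter> \<Omega> = H \<inter> \<Omega> \<Longrightarrow> K \<in> T"
      using chabauty_nhds[of G T H] by (metis (no_types, lifting))
    have "\<exists>K. co_amenable G K \<and> K \<inter> \<Omega> = H \<inter> \<Omega>" using R H \<Omega>(1,2) by simp
    then obtain K where "co_amenable G K" "K \<inter> \<Omega> = H \<inter> \<Omega>" by blast
    moreover from this have "K \<in> T" using \<Omega>(3) by (simp add: co_amenable_def)
    ultimately show "\<exists>y. y \<in> {K. co_amenable G K} \<and> y \<in> T" by blast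
  qed
  then show "A_separable G"
    unfolding A_separable_def topspace_chabauty
    using closure_of_subset_topspace[of "chabauty G" "{K. co_amenable G K}"]
    by (auto simp: topspace_chabauty)
qed

section \<open>Amenable groups and LERF groups are A-separable\<close>

lemma amenable_group_A_separable:
  assumes "group G" "amenable_group G"
  shows "A_separable G"
  unfolding A_separable_iff co_amenable_def
  using amenable_group_amenable_action[OF assms acts_lcosets lcosets_nonempty] assms(1) by blast

lemma finite_index_co_amenable:
  assumes "group G" "finite_index_subgroup G L"
  shows "co_amenable G L"
  using assms amenable_action_finite[OF assms(1) acts_lcosets[OF assms(1)] _ lcosets_nonempty[OF assms(1)]]
  by (simp add: finite_index_subgroup_def co_amenable_def)

lemma finite_index_subgroup_carrier:
  assumes "group G"
  shows "finite_index_subgroup G (carrier G)"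
proof -
  interpret group G by fact
  have "lcosets\<^bsub>G\<^esub> (carrier G) \<subseteq> {carrier G}"
    using coset_join3[OF _ subgroup_self] by (auto simp: LCOSETS_def)
  then show ?thesis
    by (auto simp: finite_index_subgroup_def subgroup_self intro: finite_subset)
qed

lemma finite_index_subgroup_Int:
  assumes "group G" "finite_index_subgroup G L" "finite_index_subgroup G M"
  shows "finite_index_subgroup G (L \<inter> M)"
proof -
  interpret group G by fact
  have sub: "subgroup L G" "subgroup M G" using assms by (auto simp: finite_index_subgroup_def)
  note S = sub[THEN subgroup.subset]
  have "a <#\<^bsub>G\<^esub> (L \<inter> M) = (a <#\<^bsub>G\<^esub> L) \<inter> (a <#\<^bsub>G\<^esub> M)" if a: "a \<in> carrier G" for a
  proof
    show "(a <#\<^bsub>G\<^esub> L) \<inter> (a <#\<^bsub>G\<^esub> M) \<subseteq> a <#\<^bsub>G\<^esub> (L \<inter> M)"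
    proof
      fix x assume "x \<in> (a <#\<^bsub>G\<^esub> L) \<inter> (a <#\<^bsub>G\<^esub> M)"
      then obtain l m where *: "l \<in> L" "m \<in> M" "x = a \<otimes>\<^bsub>G\<^esub> l" "x = a \<otimes>\<^bsub>G\<^esub> m"
        by (auto simp: l_coset_def)
      have "l \<in> carrier G" "m \<in> carrier G" using *(1,2) S by auto
      moreover have "a \<otimes>\<^bsub>G\<^esub> l = a \<otimes>\<^bsub>G\<^esub> m" using *(3,4) by simp
      ultimately have "l = m" using a by simp
      with * show "x \<in> a <#\<^bsub>G\<^esub> (L \<inter> M)" unfolding l_coset_def by blast
    qed
  qed (auto simp: l_coset_def)
  then have "lcosets\<^bsub>G\<^esub> (L \<inter> M) \<subseteq> (\<lambda>(A, B). A \<inter> B) ` ((lcosets\<^bsub>G\<^esub> L) \<times> (lcosets\<^bsub>G\<^esub> M))"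
    unfolding LCOSETS_def by fastforce
  moreover have "finite ((lcosets\<^bsub>G\<^esub> L) \<times> (lcosets\<^bsub>G\<^esub> M))"
    using assms by (simp add: finite_index_subgroup_def)
  ultimately have "finite (lcosets\<^bsub>G\<^esub> (L \<inter> M))" by (meson finite_imageI finite_subset)
  then show ?thesis
    using subgroups_Inter_pair[OF sub] by (simp add: finite_index_subgroup_def)
qed

lemma LERF_separate_finite:
  assumes "group G" "LERF G" "finitely_generated_subgroup G K" "finite \<Delta>" "\<Delta> \<subseteq> carrier G - K"
  shows "\<exists>L. finite_index_subgroup G L \<and> K \<subseteq> L \<and> L \<inter> \<Delta> = {}"
  using assms(4,5)
proof (induction \<Delta>)
  case empty
  have "K \<subseteq> carrier G"
    using assms(3) group.generate_incl[OF assms(1)] by (auto simp: finitely_generated_subgroup_def)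
  then show ?case using finite_index_subgroup_carrier[OF assms(1)] by blast
next
  case (insert g \<Delta>)
  then obtain L where L: "finite_index_subgroup G L" "K \<subseteq> L" "L \<inter> \<Delta> = {}" by auto
  obtain M where M: "finite_index_subgroup G M" "K \<subseteq> M" "g \<notin> M"
    using assms(2,3) insert.prems unfolding LERF_def by blast
  show ?case
    using finite_index_subgroup_Int[OF assms(1) L(1) M(1)] L M by blast
qed

text \<open>To imitate \<open>H\<close> on \<open>\<Omega>\<close> it suffices to imitate the finitely generated subgroup \<open>generate G (H \<inter> \<Omega>)\<close>
  of \<open>H\<close>, and a finite index subgroup that contains it and avoids \<open>\<Omega> - H\<close> does so.\<close>

lemma LERF_A_separable:
  assumes "group G" "LERF G"
  shows "A_separable G"
  unfolding A_separable_iff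
proof (intro allI impI, elim conjE)
  fix H \<Omega> assume *: "subgroup H G" "finite \<Omega>" "\<Omega> \<subseteq> carrier G"
  let ?K = "generate G (H \<inter> \<Omega>)"
  have K: "finitely_generated_subgroup G ?K"
    using * unfolding finitely_generated_subgroup_def by blast
  have KH: "?K \<subseteq> H"
    using group.generate_subgroup_incl[OF assms(1) _ *(1)] by blast
  then have "\<Omega> - H \<subseteq> carrier G - ?K" using *(3) by blast
  then obtain L where L: "finite_index_subgroup G L" "?K \<subseteq> L" "L \<inter> (\<Omega> - H) = {}"
    using LERF_separate_finite[OF assms K, of "\<Omega> - H"] *(2) by blast
  have "H \<inter> \<Omega> \<subseteq> ?K" by (auto intro: generate.incl)
  with L have "L \<inter> \<Omega> = H \<inter> \<Omega>" by blast
  with finite_index_co_amenable[OF assms(1) L(1)]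
  show "\<exists>K. co_amenable G K \<and> K \<inter> \<Omega> = H \<inter> \<Omega>" by blast
qed

section \<open>Foelner sets of infinite orbits avoid finite sets\<close>

text \<open>If a Foelner set \<open>F\<close> for a sufficiently large finite set and a sufficiently small constant contains
  a point \<open>y\<close> of \<open>Y\<close>, then it contains \<open>n\<close> points of the infinite orbit of \<open>y\<close> or is large anyway;
  so removing the finite set \<open>Y\<close> from \<open>F\<close> hardly matters. If \<open>F\<close> does not meet \<open>Y\<close>, it can be used
  as it is.\<close>

lemma foelner_set_avoiding:
  fixes \<epsilon> :: real
  assumes G: "group G" "acts G T \<phi>" and am: "amenable_action G T \<phi>"
    and inf: "\<And>y. y \<in> T \<Longrightarrow> infinite (orbit G \<phi> y)"
    and Y: "finite Y" and \<epsilon>: "\<epsilon> > 0" and \<Omega>: "finite \<Omega>" "\<Omega> \<subseteq> carrier G"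
  shows "\<exists>F\<subseteq>T - Y. foelner_set \<phi> \<Omega> \<epsilon> F"
proof -
  \<comment> \<open>A set of at least \<open>n\<close> points keeps half of its points when \<open>Y\<close> is removed, and \<open>card Y\<close> is at
    most \<open>\<epsilon> / 4\<close> of its size.\<close>
  obtain n :: nat where n: "real n > 2 * card Y + 4 * card Y / \<epsilon> + 1"
    using reals_Archimedean2 by blast
  have npos: "n > 0" and nY: "n \<ge> 2 * card Y" and n\<epsilon>: "4 * card Y \<le> \<epsilon> * n"
  proof -
    have "4 * card Y / \<epsilon> \<ge> 0" using \<epsilon> by simp
    then have "real n > 2 * card Y" "real n > 0" "4 * card Y / \<epsilon> \<le> n" using n by linarith+
    then show "n > 0" "n \<ge> 2 * card Y" "4 * card Y \<le> \<epsilon> * n"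
      using \<epsilon> by (auto simp: divide_le_eq mult.commute)
  qed
  have "\<exists>H. finite H \<and> H \<subseteq> carrier G \<and> card ((\<lambda>h. \<phi> h y) ` H) = n" if y: "y \<in> T" for y
  proof -
    obtain B where B: "finite B" "card B = n" "B \<subseteq> orbit G \<phi> y"
      using infinite_arbitrarily_large[OF inf[OF y]] by blast
    then have "B \<subseteq> (\<lambda>h. \<phi> h y) ` carrier G" by (auto simp: orbit_def)
    then obtain H where "H \<subseteq> carrier G" "finite H" "B = (\<lambda>h. \<phi> h y) ` H"
      using finite_subset_image[OF B(1)] by metis
    with B show ?thesis by blast
  qed
  then obtain H where H: "\<And>y. y \<in> T \<Longrightarrow> finite (H y) \<and> H y \<subseteq> carrier G \<and> card ((\<lambda>h. \<phi> h y) ` H y) = n"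
    using bchoice[of T "\<lambda>y H. finite H \<and> H \<subseteq> carrier G \<and> card ((\<lambda>h. \<phi> h y) ` H) = n"] by blast
  define \<Omega>' where "\<Omega>' = \<Omega> \<union> (\<Union>y\<in>Y \<inter> T. H y)"
  \<comment> \<open>The bound \<open>1 / n\<close> ensures that a Foelner set with fewer than \<open>n\<close> points is mapped to itself.\<close>
  define \<delta> where "\<delta> = min (\<epsilon> / 4) (1 / n)"
  have \<delta>: "\<delta> > 0" "\<delta> \<le> \<epsilon> / 4" "\<delta> \<le> 1 / n" using \<epsilon> npos by (auto simp: \<delta>_def)
  have "finite \<Omega>'" "\<Omega>' \<subseteq> carrier G" using \<Omega> Y H by (auto simp: \<Omega>'_def)
  then obtain F where F: "F \<subseteq> T" "foelner_set \<phi> \<Omega>' \<delta> F"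
    by (rule amenable_actionE[OF am G \<delta>(1)])
  note FD = foelner_setD[OF F(2)]
  have small: "real (escape (\<phi> g) F) < \<epsilon> / 4 * card F" if "g \<in> \<Omega>" for g
  proof -
    have "real (escape (\<phi> g) F) < \<delta> * card F" using FD(4)[of g] that by (simp add: \<Omega>'_def)
    also have "\<dots> \<le> \<epsilon> / 4 * card F" using \<delta>(2) by (intro mult_right_mono) auto
    finally show ?thesis .
  qed
  show ?thesis
  proof (cases "F \<inter> Y = {}")
    case True
    have "foelner_set \<phi> \<Omega> \<epsilon> F"
      unfolding foelner_set_def
    proof (intro conjI ballI)
      fix g assume "g \<in> \<Omega>"
      have "\<epsilon> / 4 * card F \<le> \<epsilon> * card F" using \<epsilon> by (intro mult_right_mono) auto
      with small[OF \<open>g \<in> \<Omega>\<close>] show "real (escape (\<phi> g) F) < \<epsilon> * card F" by linarith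
    qed (use FD in auto)
    then show ?thesis using True F(1) by blast
  next
    case False
    then obtain y where y: "y \<in> F" "y \<in> Y" by blast
    then have yT: "y \<in> T" using F(1) by blast
    have nF: "n \<le> card F"
    proof (rule ccontr)
      assume "\<not> n \<le> card F"
      then have lt: "\<delta> * card F < 1"
      proof -
        have "\<delta> * card F \<le> 1 / n * card F" using \<delta>(3) by (intro mult_right_mono) auto
        also have "\<dots> < 1" using \<open>\<not> n \<le> card F\<close> npos by (simp add: divide_less_eq)
        finally show ?thesis .
      qed
      have "\<phi> h y \<in> F" if h: "h \<in> H y" for h
      proof -
        have "h \<in> \<Omega>'" using h y yT by (auto simp: \<Omega>'_def)
        then have "real (escape (\<phi> h) F) < 1" using FD(4)[of h] lt by simp
        then have "card {x \<in> F. \<phi> h x \<notin> F} = 0" by (simp add: escape_def)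
        then have "{x \<in> F. \<phi> h x \<notin> F} = {}" by (subst (asm) card_0_eq) (use FD(1) in auto)
        with y(1) show ?thesis by blast
      qed
      then have "(\<lambda>h. \<phi> h y) ` H y \<subseteq> F" by blast
      then have "n \<le> card F" using card_mono[OF FD(1)] H[OF yT] by metis
      with \<open>\<not> n \<le> card F\<close> show False by contradiction
    qed
    have cF: "real (card (F - Y)) \<ge> card F - card Y"
      using diff_card_le_card_Diff[OF Y, of F] by linarith
    have half: "real (card (F - Y)) \<ge> card F / 2"
      using cF nY nF by linarith
    have "foelner_set \<phi> \<Omega> \<epsilon> (F - Y)"
      unfolding foelner_set_def
    proof (intro conjI ballI)
      show "finite (F - Y)" using FD by simp
      show "F - Y \<noteq> {}"
      proof
        assume "F - Y = {}"
        then have "card (F - Y) = 0" by (simp only: card.empty)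
        then show False using half FD(3) by simp
      qed
      fix g assume g: "g \<in> \<Omega>"
      have "inj_on (\<phi> g) F"
        using acts_inj[OF G, of g] g \<Omega>(2) F(1) by (meson inj_on_subset subsetD)
      then have "real (escape (\<phi> g) (F - Y)) \<le> escape (\<phi> g) F + card Y"
        using escape_Diff[OF FD(1) Y, of "\<phi> g"] by linarith
      also have "\<dots> < \<epsilon> / 4 * card F + \<epsilon> / 4 * card F"
      proof -
        have "card Y \<le> \<epsilon> / 4 * n" using n\<epsilon> by simp
        also have "\<dots> \<le> \<epsilon> / 4 * card F" using nF \<epsilon> by (intro mult_left_mono) auto
        finally show ?thesis using small[OF g] by linarith
      qed
      also have "\<dots> = \<epsilon> * (card F / 2)" by simp
      also have "\<dots> \<le> \<epsilon> * card (F - Y)" using half \<epsilon> by (intro mult_left_mono) auto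
      finally show "real (escape (\<phi> g) (F - Y)) < \<epsilon> * card (F - Y)" .
    qed
    then show ?thesis using F(1) by blast
  qed
qed

section \<open>Actions of free products\<close>

definition letter_act :: "('a \<Rightarrow> 'z \<Rightarrow> 'z) \<Rightarrow> ('b \<Rightarrow> 'z \<Rightarrow> 'z) \<Rightarrow> 'a + 'b \<Rightarrow> 'z \<Rightarrow> 'z" where
  "letter_act \<alpha> \<beta> = case_sum \<alpha> \<beta>"

definition word_act :: "('a \<Rightarrow> 'z \<Rightarrow> 'z) \<Rightarrow> ('b \<Rightarrow> 'z \<Rightarrow> 'z) \<Rightarrow> ('a + 'b) list \<Rightarrow> 'z \<Rightarrow> 'z" where
  "word_act \<alpha> \<beta> = foldr (letter_act \<alpha> \<beta>)"

text \<open>The word is an arbitrary representative of the class; by \<open>fp_act_class\<close> below all of them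
  act in the same way.\<close>

definition fp_act :: "('a \<Rightarrow> 'z \<Rightarrow> 'z) \<Rightarrow> ('b \<Rightarrow> 'z \<Rightarrow> 'z) \<Rightarrow> ('a + 'b) list set \<Rightarrow> 'z \<Rightarrow> 'z" where
  "fp_act \<alpha> \<beta> A = word_act \<alpha> \<beta> (SOME w. w \<in> A)"

lemma letter_act_simps [simp]:
  "letter_act \<alpha> \<beta> (Inl g) = \<alpha> g" "letter_act \<alpha> \<beta> (Inr k) = \<beta> k"
  by (simp_all add: letter_act_def)

lemma word_act_simps [simp]:
  "word_act \<alpha> \<beta> [] z = z"
  "word_act \<alpha> \<beta> (l # w) z = letter_act \<alpha> \<beta> l (word_act \<alpha> \<beta> w z)"
  "word_act \<alpha> \<beta> (u @ v) z = word_act \<alpha> \<beta> u (word_act \<alpha> \<beta> v z)"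
  by (simp_all add: word_act_def)

lemma fp_words_Cons:
  "l # w \<in> fp_words G K \<longleftrightarrow> [l] \<in> fp_words G K \<and> w \<in> fp_words G K"
  by (cases l) simp_all

lemma fp_letters:
  assumes "finite W" "W \<subseteq> fp_words G K"
  shows "finite (\<Union>w\<in>W. {g. Inl g \<in> set w})" "(\<Union>w\<in>W. {g. Inl g \<in> set w}) \<subseteq> carrier G"
    and "finite (\<Union>w\<in>W. {k. Inr k \<in> set w})" "(\<Union>w\<in>W. {k. Inr k \<in> set w}) \<subseteq> carrier K"
  using assms unfolding fp_words_def
  by (auto intro!: finite_vimageI[of "set _" Inl, unfolded vimage_def]
      finite_vimageI[of "set _" Inr, unfolded vimage_def])

lemma fp_class_Inl_hom:
  assumes "group G" "group K"
  shows "(\<lambda>g. fp_class G K [Inl g]) \<in> hom G (free_product G K)"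
proof (rule homI)
  show "fp_class G K [Inl g] \<in> carrier (free_product G K)" if "g \<in> carrier G" for g
    using that by (simp add: free_product_def)
  show "fp_class G K [Inl (g \<otimes>\<^bsub>G\<^esub> h)] =
      fp_class G K [Inl g] \<otimes>\<^bsub>free_product G K\<^esub> fp_class G K [Inl h]"
    if "g \<in> carrier G" "h \<in> carrier G" for g h
    using that fp_mult_left[OF that, of K]
    by (simp add: fp_class_mult fp_class_eq_iff[OF assms] fp_sym monoid.m_closed[OF group.is_monoid[OF assms(1)]])
qed

lemma fp_class_Inr_hom:
  assumes "group G" "group K"
  shows "(\<lambda>k. fp_class G K [Inr k]) \<in> hom K (free_product G K)"
proof (rule homI)
  show "fp_class G K [Inr k] \<in> carrier (free_product G K)" if "k \<in> carrier K" for k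
    using that by (simp add: free_product_def)
  show "fp_class G K [Inr (g \<otimes>\<^bsub>K\<^esub> h)] =
      fp_class G K [Inr g] \<otimes>\<^bsub>free_product G K\<^esub> fp_class G K [Inr h]"
    if "g \<in> carrier K" "h \<in> carrier K" for g h
    using that fp_mult_right[OF that, of G]
    by (simp add: fp_class_mult fp_class_eq_iff[OF assms] fp_sym monoid.m_closed[OF group.is_monoid[OF assms(2)]])
qed

lemma acts_comp_hom:
  assumes "group G" "group P" "h \<in> hom G P" "acts P X \<phi>"
  shows "acts G X (\<lambda>g. \<phi> (h g))"
  using assms hom_one[OF assms(3,1,2)]
  by (auto simp: acts_def hom_mult hom_in_carrier)

text \<open>The universal property of the free product, in the form that is used here: two arbitrary actions
  on the same set, one of each factor, combine to an action of the free product.\<close>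

locale two_actions = G: group G + K: group K
  for G :: "('a, 'm) monoid_scheme" and K :: "('b, 'n) monoid_scheme" +
  fixes Z :: "'z set" and \<alpha> :: "'a \<Rightarrow> 'z \<Rightarrow> 'z" and \<beta> :: "'b \<Rightarrow> 'z \<Rightarrow> 'z"
  assumes acts_G: "acts G Z \<alpha>" and acts_K: "acts K Z \<beta>"
begin

lemma letter_act_closed: "[l] \<in> fp_words G K \<Longrightarrow> z \<in> Z \<Longrightarrow> letter_act \<alpha> \<beta> l z \<in> Z"
  using acts_closed[OF acts_G] acts_closed[OF acts_K] by (cases l) simp_all

lemma letter_act_inj: "[l] \<in> fp_words G K \<Longrightarrow> inj_on (letter_act \<alpha> \<beta> l) Z"
  using acts_inj[OF G.is_group acts_G] acts_inj[OF K.is_group acts_K] by (cases l) simp_all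

lemma word_act_closed:
  assumes "w \<in> fp_words G K" "z \<in> Z"
  shows "word_act \<alpha> \<beta> w z \<in> Z"
  using assms(1)
proof (induction w)
  case (Cons l w)
  then show ?case using letter_act_closed by (simp add: fp_words_Cons[of l w])
qed (simp add: assms(2))

lemma word_act_inj:
  assumes "w \<in> fp_words G K"
  shows "inj_on (word_act \<alpha> \<beta> w) Z"
  using assms
proof (induction w)
  case (Cons l w)
  then have l: "[l] \<in> fp_words G K" and w: "w \<in> fp_words G K"
    by (simp_all add: fp_words_Cons[of l w])
  have "inj_on (letter_act \<alpha> \<beta> l \<circ> word_act \<alpha> \<beta> w) Z"
  proof (rule comp_inj_on[OF Cons.IH[OF w]])
    show "inj_on (letter_act \<alpha> \<beta> l) (word_act \<alpha> \<beta> w ` Z)"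
      by (rule inj_on_subset[OF letter_act_inj[OF l]]) (use word_act_closed[OF w] in blast)
  qed
  then show ?case by (simp add: inj_on_def)
qed (simp add: inj_on_def)

lemma fp_eq_word_act:
  assumes "fp_eq G K u v" "z \<in> Z"
  shows "word_act \<alpha> \<beta> u z = word_act \<alpha> \<beta> v z"
  using assms
proof (induction arbitrary: z)
  case (fp_append u u' v v')
  have "word_act \<alpha> \<beta> v z \<in> Z"
    using fp_eq_words[OF G.is_group K.is_group fp_append.hyps(2)] fp_append.prems word_act_closed
    by blast
  with fp_append.IH(1)[OF this] fp_append.IH(2)[OF fp_append.prems] show ?case by simp
qed (simp_all add: acts_one[OF acts_G] acts_one[OF acts_K] acts_mult[OF acts_G] acts_mult[OF acts_K])

lemma fp_act_class:
  assumes "w \<in> fp_words G K" "z \<in> Z"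
  shows "fp_act \<alpha> \<beta> (fp_class G K w) z = word_act \<alpha> \<beta> w z"
proof -
  have "w \<in> fp_class G K w" using assms(1) by (simp add: fp_class_def fp_refl)
  then have "(SOME v. v \<in> fp_class G K w) \<in> fp_class G K w" by (rule someI)
  then have "fp_eq G K w (SOME v. v \<in> fp_class G K w)" by (simp add: fp_class_def)
  from fp_eq_word_act[OF this assms(2)] show ?thesis by (simp add: fp_act_def)
qed

lemma acts_free_product: "acts (free_product G K) Z (fp_act \<alpha> \<beta>)"
proof -
  have "carrier (free_product G K) = fp_class G K ` fp_words G K"
    and "\<one>\<^bsub>free_product G K\<^esub> = fp_class G K []"
    by (simp_all add: free_product_def)
  then show ?thesis
    unfolding acts_def by (auto simp: fp_class_mult fp_act_class word_act_closed)
qed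

lemma escape_word_act:
  assumes "finite F" "F \<subseteq> Z" "w \<in> fp_words G K"
  shows "escape (word_act \<alpha> \<beta> w) F \<le> (\<Sum>l\<leftarrow>w. escape (letter_act \<alpha> \<beta> l) F)"
  using assms(3)
proof (induction w)
  case Nil
  then show ?case by (simp add: escape_def)
next
  case (Cons l w)
  then have w: "w \<in> fp_words G K" by (simp add: fp_words_Cons[of l w])
  have "word_act \<alpha> \<beta> (l # w) = (\<lambda>z. letter_act \<alpha> \<beta> l (word_act \<alpha> \<beta> w z))"
    by (rule ext) simp
  then have "escape (word_act \<alpha> \<beta> (l # w)) F \<le> escape (word_act \<alpha> \<beta> w) F + escape (letter_act \<alpha> \<beta> l) F"
    using escape_comp[OF assms(1) inj_on_subset[OF word_act_inj[OF w] assms(2)]] by metis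
  then show ?case using Cons.IH[OF w] by (simp only: list.map sum_list.Cons)
qed

text \<open>A set that is almost invariant under finitely many elements of each factor is almost invariant under
  every word in these elements, since at most as many points escape under a word as escape under
  its letters together.\<close>

lemma amenable_action_free_productI:
  assumes F: "\<And>(\<epsilon>::real) A B. \<epsilon> > 0 \<Longrightarrow> finite A \<Longrightarrow> A \<subseteq> carrier G \<Longrightarrow> finite B \<Longrightarrow> B \<subseteq> carrier K \<Longrightarrow>
      \<exists>F\<subseteq>Z. foelner_set \<alpha> A \<epsilon> F \<and> foelner_set \<beta> B \<epsilon> F"
  shows "amenable_action (free_product G K) Z (fp_act \<alpha> \<beta>)"
proof (rule amenable_actionI[OF group_free_product[OF G.is_group K.is_group] acts_free_product])
  fix \<epsilon> :: real and \<Omega> assume \<epsilon>: "\<epsilon> > 0" and \<Omega>: "finite \<Omega>" "\<Omega> \<subseteq> carrier (free_product G K)"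
  have "\<Omega> \<subseteq> fp_class G K ` fp_words G K" using \<Omega>(2) by (simp add: free_product_def)
  then obtain W where W: "W \<subseteq> fp_words G K" "finite W" "\<Omega> = fp_class G K ` W"
    using finite_subset_image[OF \<Omega>(1)] by metis
  define N where "N = Suc (\<Sum>w\<in>W. length w)"
  define \<delta> where "\<delta> = \<epsilon> / N"
  have N: "N > 0" by (simp add: N_def)
  have \<delta>: "\<delta> > 0" using \<epsilon> N by (simp add: \<delta>_def)
  define A where "A = (\<Union>w\<in>W. {g. Inl g \<in> set w})"
  define B where "B = (\<Union>w\<in>W. {k. Inr k \<in> set w})"
  have "finite A" "finite B" "A \<subseteq> carrier G" "B \<subseteq> carrier K"
    using fp_letters[OF W(2,1)] by (simp_all add: A_def B_def)
  then obtain F where F: "F \<subseteq> Z" "foelner_set \<alpha> A \<delta> F" "foelner_set \<beta> B \<delta> F"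
    using assms[OF \<delta>, of A B] by blast
  note FD = foelner_setD[OF F(2)]
  have letter: "real (escape (letter_act \<alpha> \<beta> l) F) \<le> \<delta> * card F" if "w \<in> W" "l \<in> set w" for w l
  proof (cases l)
    case (Inl g)
    then have "g \<in> A" using that by (auto simp: A_def)
    with Inl show ?thesis using foelner_setD(4)[OF F(2)] by fastforce
  next
    case (Inr k)
    then have "k \<in> B" using that by (auto simp: B_def)
    with Inr show ?thesis using foelner_setD(4)[OF F(3)] by fastforce
  qed
  have "real (escape (fp_act \<alpha> \<beta> (fp_class G K w)) F) < \<epsilon> * card F" if w: "w \<in> W" for w
  proof -
    have wW: "w \<in> fp_words G K" using w W(1) by blast
    have "{x \<in> F. fp_act \<alpha> \<beta> (fp_class G K w) x \<notin> F} = {x \<in> F. word_act \<alpha> \<beta> w x \<notin> F}"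
      using fp_act_class[OF wW] F(1) by (intro Collect_cong) auto
    then have "real (escape (fp_act \<alpha> \<beta> (fp_class G K w)) F) = real (escape (word_act \<alpha> \<beta> w) F)"
      by (simp add: escape_def)
    also have "\<dots> \<le> real (\<Sum>l\<leftarrow>w. escape (letter_act \<alpha> \<beta> l) F)"
      using escape_word_act[OF FD(1) F(1) wW] by (simp only: of_nat_le_iff)
    also have "\<dots> = (\<Sum>l\<leftarrow>w. real (escape (letter_act \<alpha> \<beta> l) F))"
      by (induction w) simp_all
    also have "\<dots> \<le> (\<Sum>l\<leftarrow>w. \<delta> * card F)"
      using letter[OF w] by (intro sum_list_mono) blast
    also have "\<dots> = length w * (\<delta> * card F)" by (simp add: sum_list_triv)
    also have "\<dots> < N * (\<delta> * card F)"
    proof (rule mult_strict_right_mono)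
      show "\<delta> * card F > 0" using \<delta> FD(3) by simp
      show "real (length w) < real N"
        using member_le_sum[OF w, of length] W(2) by (simp only: of_nat_less_iff N_def less_Suc_eq_le)
    qed
    also have "\<dots> = \<epsilon> * card F" using N by (simp add: \<delta>_def)
    finally show ?thesis .
  qed
  then have "foelner_set (fp_act \<alpha> \<beta>) \<Omega> \<epsilon> F"
    unfolding foelner_set_def W(3) using FD(1,2) by blast
  with F(1) show "\<exists>F\<subseteq>Z. foelner_set (fp_act \<alpha> \<beta>) \<Omega> \<epsilon> F" by blast
qed

end

lemma foelner_set_fixed:
  assumes "finite F" "F \<noteq> {}" "\<epsilon> > 0" "\<And>g x. g \<in> \<Omega> \<Longrightarrow> x \<in> F \<Longrightarrow> \<phi> g x = x"
  shows "foelner_set \<phi> \<Omega> \<epsilon> F"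
proof -
  have "escape (\<phi> g) F = 0" if "g \<in> \<Omega>" for g
  proof -
    have "{x \<in> F. \<phi> g x \<notin> F} = {}" using assms(4)[OF that] by auto
    then show ?thesis by (simp only: escape_def card.empty)
  qed
  then show ?thesis using assms(1-3) by (simp add: foelner_set_def card_gt_0_iff)
qed

section \<open>Completing finite parts of an action\<close>

lemma orbit_lcoset_action:
  assumes "group G" "subgroup L G" "C \<in> lcosets\<^bsub>G\<^esub> L" "D \<in> lcosets\<^bsub>G\<^esub> L"
  shows "\<exists>g\<in>carrier G. g <#\<^bsub>G\<^esub> C = D"
proof -
  interpret group G by fact
  obtain a b where ab: "a \<in> carrier G" "C = a <#\<^bsub>G\<^esub> L" "b \<in> carrier G" "D = b <#\<^bsub>G\<^esub> L"
    using assms(3,4) by (auto simp: LCOSETS_def)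
  have "(b \<otimes>\<^bsub>G\<^esub> inv\<^bsub>G\<^esub> a) <#\<^bsub>G\<^esub> C = (b \<otimes>\<^bsub>G\<^esub> inv\<^bsub>G\<^esub> a \<otimes>\<^bsub>G\<^esub> a) <#\<^bsub>G\<^esub> L"
    using ab lcos_m_assoc[OF subgroup.subset[OF assms(2)], of "b \<otimes>\<^bsub>G\<^esub> inv\<^bsub>G\<^esub> a" a] by simp
  also have "b \<otimes>\<^bsub>G\<^esub> inv\<^bsub>G\<^esub> a \<otimes>\<^bsub>G\<^esub> a = b" using ab by (simp add: m_assoc)
  finally show ?thesis using ab by blast
qed

text \<open>Only finitely many facts \<open>\<alpha> s y = y'\<close> with \<open>y\<close> and \<open>y'\<close> in \<open>Y\<close> and \<open>s \<in> S\<close> have to survive, together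
  with the fact that the points of \<open>Y\<close> are distinct. Fix a representative \<open>r y \<in> Y\<close> of the orbit of
  each \<open>y \<in> Y\<close>, and \<open>c y\<close> with \<open>y = c y (r y)\<close>. Then all these facts say that certain
  elements \<open>inv (c y) \<otimes> (s \<otimes> c y')\<close> do, or do not, fix a representative. So the orbit of each
  representative may be replaced by the cosets of a co-amenable subgroup which agrees with the
  stabilizer on these finitely many elements.\<close>

lemma co_amenable_completion:
  fixes X :: "'x set" and G :: "('a, 'm) monoid_scheme"
  assumes G: "group G" and sep: "A_separable G" and \<alpha>: "acts G X \<alpha>"
    and Y: "finite Y" "Y \<subseteq> X" and S: "finite S" "S \<subseteq> carrier G"
  obtains E :: "('x \<times> 'a set) set" and \<eta> \<iota> where
    "acts G E \<eta>" "inj_on \<iota> Y" "\<iota> ` Y \<subseteq> E"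
    "\<forall>s\<in>S. \<forall>y\<in>Y. \<alpha> s y \<in> Y \<longrightarrow> \<iota> (\<alpha> s y) = \<eta> s (\<iota> y)"
    "\<forall>e\<in>E. amenable_action G (orbit G \<eta> e) \<eta>"
    "\<forall>e\<in>E. \<exists>y\<in>Y. e \<in> orbit G \<eta> (\<iota> y)"
proof -
  interpret group G by fact
  define r where "r y = (SOME x. x \<in> Y \<inter> orbit G \<alpha> y)" for y
  have r: "r y \<in> Y" "r y \<in> orbit G \<alpha> y" if "y \<in> Y" for y
  proof -
    have "y \<in> Y \<inter> orbit G \<alpha> y" using orbit_refl[OF G \<alpha>, of y] that Y(2) by blast
    then have "r y \<in> Y \<inter> orbit G \<alpha> y" unfolding r_def by (rule someI)
    then show "r y \<in> Y" "r y \<in> orbit G \<alpha> y" by blast+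
  qed
  have r_eq: "r y = r y'" if "y' \<in> Y" "y \<in> orbit G \<alpha> y'" for y y'
    using orbit_eq[OF G \<alpha> _ that(2)] that(1) Y(2) by (auto simp: r_def)
  have ex_c: "\<exists>c\<in>carrier G. \<alpha> c (r y) = y" if y: "y \<in> Y" for y
  proof -
    have "y \<in> orbit G \<alpha> (r y)"
      using orbit_eq[OF G \<alpha> _ r(2)[OF y]] orbit_refl[OF G \<alpha>, of y] y Y(2) by auto
    then obtain g where "g \<in> carrier G" "y = \<alpha> g (r y)" unfolding orbit_def by blast
    then show ?thesis by (intro bexI[of _ g]) simp_all
  qed
  then obtain c where c: "\<And>y. y \<in> Y \<Longrightarrow> c y \<in> carrier G" "\<And>y. y \<in> Y \<Longrightarrow> \<alpha> (c y) (r y) = y"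
    using bchoice[of Y "\<lambda>y c. c \<in> carrier G \<and> \<alpha> c (r y) = y"] by blast
  \<comment> \<open>The identity is among the middle factors in order to keep distinct points of \<open>Y\<close> distinct.\<close>
  define \<Omega> where "\<Omega> = (\<lambda>(y, s, y'). inv\<^bsub>G\<^esub> (c y) \<otimes>\<^bsub>G\<^esub> (s \<otimes>\<^bsub>G\<^esub> c y')) ` (Y \<times> insert \<one>\<^bsub>G\<^esub> S \<times> Y)"
  have \<Omega>: "finite \<Omega>" "\<Omega> \<subseteq> carrier G" using Y S c(1) by (auto simp: \<Omega>_def)
  have "\<exists>L. co_amenable G L \<and> L \<inter> \<Omega> = stabilizer G \<alpha> x \<inter> \<Omega>" if "x \<in> Y" for x
    using sep[unfolded A_separable_iff] subgroup_stabilizer[OF G \<alpha>, of x] \<Omega> that Y(2) by blast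
  then obtain L where L: "\<And>x. x \<in> Y \<Longrightarrow> co_amenable G (L x)"
      "\<And>x. x \<in> Y \<Longrightarrow> L x \<inter> \<Omega> = stabilizer G \<alpha> x \<inter> \<Omega>"
    using bchoice[of Y "\<lambda>x L. co_amenable G L \<and> L \<inter> \<Omega> = stabilizer G \<alpha> x \<inter> \<Omega>"] by blast
  have subL: "subgroup (L x) G" if "x \<in> Y" for x using L(1)[OF that] by (simp add: co_amenable_def)
  define E where "E = Sigma (r ` Y) (\<lambda>x. lcosets\<^bsub>G\<^esub> (L x))"
  define \<eta> where "\<eta> g e = (fst e, g <#\<^bsub>G\<^esub> snd e)" for g and e :: "'x \<times> 'a set"
  define \<iota> where "\<iota> y = (r y, c y <#\<^bsub>G\<^esub> L (r y))" for y
  have E: "x \<in> Y \<and> C \<in> lcosets\<^bsub>G\<^esub> (L x)" if "(x, C) \<in> E" for x C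
    using that r(1) by (auto simp: E_def)
  have \<eta>: "acts G E \<eta>"
    unfolding acts_def
  proof (intro conjI ballI)
    fix g e assume g: "g \<in> carrier G" and e: "e \<in> E"
    obtain x C where xC: "e = (x, C)" by (cases e)
    note act = acts_lcosets[OF G subL[of x]]
    show "\<eta> g e \<in> E" using acts_closed[OF act g, of C] e r(1) by (auto simp: E_def \<eta>_def xC)
    fix h assume h: "h \<in> carrier G"
    show "\<eta> (g \<otimes>\<^bsub>G\<^esub> h) e = \<eta> g (\<eta> h e)"
      using acts_mult[OF act g h, of C] E e by (auto simp: \<eta>_def xC)
  next
    fix e assume e: "e \<in> E"
    obtain x C where xC: "e = (x, C)" by (cases e)
    show "\<eta> \<one>\<^bsub>G\<^esub> e = e"
      using acts_one[OF acts_lcosets[OF G subL[of x]], of C] E e by (auto simp: \<eta>_def xC)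
  qed
  have \<iota>E: "\<iota> ` Y \<subseteq> E" using c(1) by (auto simp: E_def \<iota>_def LCOSETS_def)
  have key: "\<eta> s (\<iota> y') = \<iota> y \<longleftrightarrow> \<alpha> s y' = y"
    if y: "y \<in> Y" "y' \<in> Y" and s: "s \<in> insert \<one>\<^bsub>G\<^esub> S" and rr: "r y = r y'" for y y' s
  proof -
    let ?L = "L (r y)"
    have sG: "s \<in> carrier G" using s S(2) by auto
    have cG: "c y \<in> carrier G" "c y' \<in> carrier G" using c(1) y by auto
    have rX: "r y \<in> X" and y'X: "y' \<in> X" and yX: "y \<in> X" using r(1) y Y(2) by auto
    define t where "t = inv\<^bsub>G\<^esub> (c y) \<otimes>\<^bsub>G\<^esub> (s \<otimes>\<^bsub>G\<^esub> c y')"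
    have "t \<in> \<Omega>"
      unfolding \<Omega>_def t_def by (rule image_eqI[of _ _ "(y, s, y')"]) (use y s in auto)
    with \<Omega>(2) have t: "t \<in> \<Omega>" "t \<in> carrier G" by auto
    have "\<eta> s (\<iota> y') = \<iota> y \<longleftrightarrow> (s \<otimes>\<^bsub>G\<^esub> c y') <#\<^bsub>G\<^esub> ?L = c y <#\<^bsub>G\<^esub> ?L"
      using lcos_m_assoc[OF subgroup.subset[OF subL[OF r(1)[OF y(1)]]] sG cG(2)]
      by (simp add: \<eta>_def \<iota>_def rr)
    also have "\<dots> \<longleftrightarrow> t \<in> ?L"
      unfolding t_def
      using l_coset_eq_iff[OF G subL[OF r(1)[OF y(1)]] cG(1), of "s \<otimes>\<^bsub>G\<^esub> c y'"] sG cG by auto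
    also have "\<dots> \<longleftrightarrow> t \<in> stabilizer G \<alpha> (r y)"
      using L(2)[OF r(1)[OF y(1)]] t(1) by blast
    also have "\<dots> \<longleftrightarrow> \<alpha> t (r y) = r y" using t(2) by (simp add: stabilizer_def)
    also have "\<alpha> t (r y) = \<alpha> (inv\<^bsub>G\<^esub> (c y)) (\<alpha> s y')"
      using acts_mult[OF \<alpha> _ _ rX, of "inv\<^bsub>G\<^esub> (c y)" "s \<otimes>\<^bsub>G\<^esub> c y'"] acts_mult[OF \<alpha> sG cG(2) rX]
        c(2)[OF y(2)] sG cG by (simp add: t_def rr)
    also have "\<alpha> (inv\<^bsub>G\<^esub> (c y)) (\<alpha> s y') = r y \<longleftrightarrow> \<alpha> s y' = y"
    proof
      assume "\<alpha> (inv\<^bsub>G\<^esub> (c y)) (\<alpha> s y') = r y"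
      then have "\<alpha> (c y) (\<alpha> (inv\<^bsub>G\<^esub> (c y)) (\<alpha> s y')) = y" using c(2)[OF y(1)] by simp
      then show "\<alpha> s y' = y" using acts_inv(2)[OF G \<alpha> cG(1) acts_closed[OF \<alpha> sG y'X]] by simp
    next
      assume "\<alpha> s y' = y"
      then show "\<alpha> (inv\<^bsub>G\<^esub> (c y)) (\<alpha> s y') = r y"
        using acts_inv(1)[OF G \<alpha> cG(1) rX] c(2)[OF y(1)] by simp
    qed
    finally show ?thesis .
  qed
  have inj: "inj_on \<iota> Y"
  proof (rule inj_onI)
    fix y y' assume y: "y \<in> Y" "y' \<in> Y" "\<iota> y = \<iota> y'"
    then have "\<eta> \<one>\<^bsub>G\<^esub> (\<iota> y') = \<iota> y" using acts_one[OF \<eta>, of "\<iota> y'"] \<iota>E by auto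
    moreover have "r y = r y'" using y(3) by (simp add: \<iota>_def)
    ultimately have "\<alpha> \<one>\<^bsub>G\<^esub> y' = y" using key[OF y(1,2), of "\<one>\<^bsub>G\<^esub>"] by simp
    then show "y = y'" using acts_one[OF \<alpha>, of y'] y(2) Y(2) by auto
  qed
  have equi: "\<iota> (\<alpha> s y) = \<eta> s (\<iota> y)" if "s \<in> S" "y \<in> Y" "\<alpha> s y \<in> Y" for s y
  proof -
    have "\<alpha> s y \<in> orbit G \<alpha> y" using that(1) S(2) orbit_memI[of s G \<alpha> y] by blast
    then have "r (\<alpha> s y) = r y" using r_eq[OF that(2)] by blast
    then show ?thesis using key[OF that(3,2), of s] that(1) by simp
  qed
  have orb: "(x, D) \<in> orbit G \<eta> (x, C)"
    if CD: "x \<in> Y" "C \<in> lcosets\<^bsub>G\<^esub> (L x)" "D \<in> lcosets\<^bsub>G\<^esub> (L x)" for x C D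
  proof -
    obtain g where "g \<in> carrier G" "g <#\<^bsub>G\<^esub> C = D"
      using orbit_lcoset_action[OF G subL[OF CD(1)] CD(2,3)] by blast
    then show ?thesis using orbit_memI[of g G \<eta> "(x, C)"] by (simp add: \<eta>_def)
  qed
  have am: "amenable_action G (orbit G \<eta> e) \<eta> \<and> (\<exists>y\<in>Y. e \<in> orbit G \<eta> (\<iota> y))" if e: "e \<in> E" for e
  proof
    obtain x C where xC: "e = (x, C)" by (cases e)
    have x: "x \<in> Y" "C \<in> lcosets\<^bsub>G\<^esub> (L x)" using E e xC by auto
    show "amenable_action G (orbit G \<eta> e) \<eta>"
    proof (rule amenable_action_pushforward[where f = "Pair x" and Y = "lcosets\<^bsub>G\<^esub> (L x)",
          OF G acts_lcosets[OF G subL[OF x(1)]] G acts_orbit[OF G \<eta> e]])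
      show "Pair x ` (lcosets\<^bsub>G\<^esub> (L x)) \<subseteq> orbit G \<eta> e" using orb[OF x] by (auto simp: xC)
      show "amenable_action G (lcosets\<^bsub>G\<^esub> (L x)) (\<lambda>g C. g <#\<^bsub>G\<^esub> C)"
        using L(1)[OF x(1)] by (simp add: co_amenable_def)
      show "\<exists>g'\<in>carrier G. \<forall>C\<in>lcosets\<^bsub>G\<^esub> (L x). (x, g' <#\<^bsub>G\<^esub> C) = \<eta> g (x, C)" if "g \<in> carrier G" for g
        using that by (auto simp: \<eta>_def)
    qed
    have "r x = x"
    proof -
      obtain y where y: "y \<in> Y" "x = r y" using e by (auto simp: E_def xC)
      then show ?thesis using r_eq[OF y(1) r(2)[OF y(1)]] by simp
    qed
    then have "\<iota> x = (x, c x <#\<^bsub>G\<^esub> L x)" by (simp add: \<iota>_def)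
    moreover have "c x <#\<^bsub>G\<^esub> L x \<in> lcosets\<^bsub>G\<^esub> (L x)" using c(1)[OF x(1)] by (auto simp: LCOSETS_def)
    ultimately have "e \<in> orbit G \<eta> (\<iota> x)" using orb[OF x(1) _ x(2)] by (simp add: xC)
    with x(1) show "\<exists>y\<in>Y. e \<in> orbit G \<eta> (\<iota> y)" by blast
  qed
  show thesis
    by (rule that[OF \<eta> inj \<iota>E]; intro ballI impI; simp add: equi am)
qed


text \<open>The action is transported along \<open>j\<close> and extended by the trivial action on all other points.\<close>

lemma transported_action:
  fixes j :: "'e \<Rightarrow> 'z"
  assumes G: "group G" and \<eta>: "acts G E \<eta>" and j: "inj_on j E"
  defines "\<tau> \<equiv> \<lambda>g z. if z \<in> j ` E then j (\<eta> g (inv_into E j z)) else z"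
  shows "\<And>g e. e \<in> E \<Longrightarrow> \<tau> g (j e) = j (\<eta> g e)"
    and "\<And>g z. z \<notin> j ` E \<Longrightarrow> \<tau> g z = z"
    and "\<And>Z. j ` E \<subseteq> Z \<Longrightarrow> acts G Z \<tau>"
    and "\<And>e. e \<in> E \<Longrightarrow> orbit G \<tau> (j e) = j ` orbit G \<eta> e"
    and "\<And>e. e \<in> E \<Longrightarrow> amenable_action G (orbit G \<eta> e) \<eta> \<Longrightarrow> amenable_action G (orbit G \<tau> (j e)) \<tau>"
proof -
  interpret group G by fact
  show \<tau>j: "\<tau> g (j e) = j (\<eta> g e)" if "e \<in> E" for g e
    using that j by (simp add: \<tau>_def)
  show fixed: "\<tau> g z = z" if "z \<notin> j ` E" for g z using that by (simp add: \<tau>_def)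
  show acts: "acts G Z \<tau>" if Z: "j ` E \<subseteq> Z" for Z
    unfolding acts_def
  proof (intro conjI ballI)
    fix g z assume g: "g \<in> carrier G" and z: "z \<in> Z"
    show "\<tau> g z \<in> Z"
      using Z z fixed[of z g] \<tau>j[of _ g] acts_closed[OF \<eta> g] by (cases "z \<in> j ` E") auto
    fix h assume h: "h \<in> carrier G"
    show "\<tau> (g \<otimes>\<^bsub>G\<^esub> h) z = \<tau> g (\<tau> h z)"
    proof (cases "z \<in> j ` E")
      case True
      then obtain e where "e \<in> E" "z = j e" by blast
      then show ?thesis using acts_mult[OF \<eta> g h] acts_closed[OF \<eta> h] by (simp add: \<tau>j)
    qed (simp add: fixed)
  next
    fix z assume "z \<in> Z"
    show "\<tau> \<one>\<^bsub>G\<^esub> z = z"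
      using fixed[of z] \<tau>j acts_one[OF \<eta>] by (cases "z \<in> j ` E") auto
  qed
  show orb: "orbit G \<tau> (j e) = j ` orbit G \<eta> e" if "e \<in> E" for e
    using \<tau>j[OF that] by (auto simp: orbit_def)
  show "amenable_action G (orbit G \<tau> (j e)) \<tau>"
    if e: "e \<in> E" and am: "amenable_action G (orbit G \<eta> e) \<eta>" for e
  proof (rule amenable_action_pushforward[where f = j, OF G acts_orbit[OF G \<eta> e] G
        acts_orbit[OF G acts[OF subset_refl]] _ _ am])
    show "j e \<in> j ` E" using e by blast
    show "j ` orbit G \<eta> e \<subseteq> orbit G \<tau> (j e)" using orb[OF e] by simp
    show "\<exists>g'\<in>carrier G. \<forall>y\<in>orbit G \<eta> e. j (\<eta> g' y) = \<tau> g (j y)" if "g \<in> carrier G" for g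
      using that \<tau>j orbit_subset[OF \<eta> e] by (intro bexI[of _ g]) auto
  qed
qed

text \<open>The completed action of the previous lemma, on a set in which \<open>Y\<close> itself is one summand and the
  added points are the other; every point outside of the completed set is fixed. The labelling
  \<open>h\<close> allows the completions for two different groups to use disjoint sets of added points.\<close>

lemma co_amenable_completion_sum:
  fixes X :: "'x set" and G :: "('a, 'm) monoid_scheme" and h :: "'x \<times> 'a set \<Rightarrow> 'n"
  assumes G: "group G" and sep: "A_separable G" and \<alpha>: "acts G X \<alpha>"
    and Y: "finite Y" "Y \<subseteq> X" and S: "finite S" "S \<subseteq> carrier G" and h: "inj h"
  obtains N :: "'n set" and \<tau> where "N \<subseteq> range h"
    "\<forall>Z. Inl ` Y \<union> Inr ` N \<subseteq> Z \<longrightarrow> acts G Z \<tau>"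
    "\<forall>g z. z \<notin> Inl ` Y \<union> Inr ` N \<longrightarrow> \<tau> g z = z"
    "\<forall>s\<in>S. \<forall>y\<in>Y. \<alpha> s y \<in> Y \<longrightarrow> \<tau> s (Inl y) = Inl (\<alpha> s y)"
    "\<forall>z\<in>Inl ` Y \<union> Inr ` N. amenable_action G (orbit G \<tau> z) \<tau>"
    "\<forall>z\<in>Inl ` Y \<union> Inr ` N. \<exists>y\<in>Y. z \<in> orbit G \<tau> (Inl y)"
proof -
  obtain E :: "('x \<times> 'a set) set" and \<eta> \<iota> where
    E0: "acts G E \<eta>" "inj_on \<iota> Y" "\<iota> ` Y \<subseteq> E"
      "\<forall>s\<in>S. \<forall>y\<in>Y. \<alpha> s y \<in> Y \<longrightarrow> \<iota> (\<alpha> s y) = \<eta> s (\<iota> y)"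
      "\<forall>e\<in>E. amenable_action G (orbit G \<eta> e) \<eta>"
      "\<forall>e\<in>E. \<exists>y\<in>Y. e \<in> orbit G \<eta> (\<iota> y)"
    by (rule co_amenable_completion[OF G sep \<alpha> Y S])
  note E = E0[rule_format]
  define j :: "'x \<times> 'a set \<Rightarrow> 'x + 'n"
    where "j e = (if e \<in> \<iota> ` Y then Inl (inv_into Y \<iota> e) else Inr (h e))" for e
  define N where "N = h ` (E - \<iota> ` Y)"
  define \<tau> where "\<tau> = (\<lambda>g z. if z \<in> j ` E then j (\<eta> g (inv_into E j z)) else z)"
  have j\<iota>: "j (\<iota> y) = Inl y" if "y \<in> Y" for y using that E(2) by (simp add: j_def)
  have jE: "j ` E = Inl ` Y \<union> Inr ` N"
  proof -
    have "j ` \<iota> ` Y = Inl ` Y" using j\<iota> by (force simp: image_iff)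
    moreover have "j ` (E - \<iota> ` Y) = Inr ` N" by (auto simp: j_def N_def)
    moreover have "E = \<iota> ` Y \<union> (E - \<iota> ` Y)" using E(3) by blast
    ultimately show ?thesis by (metis image_Un)
  qed
  have j: "inj_on j E"
  proof (rule inj_onI)
    fix e e' assume e: "e \<in> E" "e' \<in> E" "j e = j e'"
    show "e = e'"
    proof (cases "e \<in> \<iota> ` Y")
      case True
      with e(3) have "e' \<in> \<iota> ` Y" "inv_into Y \<iota> e = inv_into Y \<iota> e'"
        by (auto simp: j_def split: if_splits)
      with True show ?thesis by (metis f_inv_into_f)
    next
      case False
      with e(3) have "h e = h e'" by (auto simp: j_def split: if_splits)
      with h show ?thesis by (rule injD)
    qed
  qed
  note tr = transported_action[OF G E(1) j]
  have \<tau>1: "\<tau> g (j e) = j (\<eta> g e)" if "e \<in> E" for g e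
    unfolding \<tau>_def by (rule tr(1)[OF that])
  have \<tau>2: "\<tau> g z = z" if "z \<notin> Inl ` Y \<union> Inr ` N" for g z
    using that unfolding jE[symmetric] \<tau>_def by (rule tr(2))
  have \<tau>3: "acts G Z \<tau>" if "Inl ` Y \<union> Inr ` N \<subseteq> Z" for Z
    using that unfolding jE[symmetric] \<tau>_def by (rule tr(3))
  have \<tau>4: "orbit G \<tau> (j e) = j ` orbit G \<eta> e" if "e \<in> E" for e
    unfolding \<tau>_def by (rule tr(4)[OF that])
  have \<tau>5: "amenable_action G (orbit G \<tau> (j e)) \<tau>" if "e \<in> E" for e
    unfolding \<tau>_def by (rule tr(5)[OF that E(5)[OF that]])
  have pattern: "\<tau> s (Inl y) = Inl (\<alpha> s y)" if "s \<in> S" "y \<in> Y" "\<alpha> s y \<in> Y" for s y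
  proof -
    have "\<iota> y \<in> E" using that(2) E(3) by blast
    then show ?thesis using \<tau>1[of "\<iota> y" s] E(4)[OF that] j\<iota>[OF that(2)] j\<iota>[OF that(3)] by simp
  qed
  have am: "amenable_action G (orbit G \<tau> z) \<tau> \<and> (\<exists>y\<in>Y. z \<in> orbit G \<tau> (Inl y))"
    if "z \<in> Inl ` Y \<union> Inr ` N" for z
  proof -
    from that have "z \<in> j ` E" by (simp only: jE)
    then obtain e where e: "e \<in> E" "z = j e" by blast
    obtain y where y: "y \<in> Y" "e \<in> orbit G \<eta> (\<iota> y)" using E(6)[OF e(1)] by blast
    have "\<iota> y \<in> E" using y(1) E(3) by blast
    from \<tau>4[OF this] have "z \<in> orbit G \<tau> (Inl y)" using e(2) y j\<iota>[OF y(1)] by auto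
    with y(1) \<tau>5[OF e(1)] e(2) show ?thesis by blast
  qed
  have "N \<subseteq> range h" by (auto simp: N_def)
  then show thesis
    by (rule that[of N \<tau>]; intro allI ballI impI; simp add: \<tau>2 \<tau>3 pattern am)
qed

section \<open>Free products of A-separable groups\<close>

lemma lcosets_word_act:
  fixes G :: "('a, 'm) monoid_scheme" and K :: "('b, 'n) monoid_scheme"
  defines "P \<equiv> free_product G K"
  assumes G: "group G" and K: "group K" and H: "subgroup H P" and C: "C \<in> lcosets\<^bsub>P\<^esub> H"
    and w: "w \<in> fp_words G K"
  shows "word_act (\<lambda>g C. fp_class G K [Inl g] <#\<^bsub>P\<^esub> C) (\<lambda>k C. fp_class G K [Inr k] <#\<^bsub>P\<^esub> C) w C =
    fp_class G K w <#\<^bsub>P\<^esub> C"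
proof -
  have act: "acts P (lcosets\<^bsub>P\<^esub> H) (\<lambda>g C. g <#\<^bsub>P\<^esub> C)"
    using group_free_product[OF G K] H unfolding P_def by (rule acts_lcosets)
  show ?thesis
    using w
  proof (induction w)
    case Nil
    show ?case using acts_one[OF act C] by (simp add: P_def free_product_def)
  next
    case (Cons l w)
    then have l: "[l] \<in> fp_words G K" and w: "w \<in> fp_words G K"
      by (simp_all add: fp_words_Cons[of l w])
    have "fp_class G K (l # w) = fp_class G K [l] \<otimes>\<^bsub>P\<^esub> fp_class G K w"
      using fp_class_mult[OF l w] by (simp add: P_def)
    moreover have "fp_class G K [l] \<in> carrier P" "fp_class G K w \<in> carrier P"
      using l w by (auto simp: P_def free_product_def)
    ultimately show ?case
      using Cons.IH[OF w] acts_mult[OF act _ _ C] by (cases l) simp_all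
  qed
qed

text \<open>Let \<open>H\<close> be a subgroup and \<open>Y\<close> the finite set of cosets that are visited when the words representing
  \<open>\<Omega>\<close> are applied to the base point \<open>H\<close>, letter by letter. Complete the action on \<open>Y\<close> of either factor
  separately, and let each factor fix the points that were added for the other one. In the resulting action
  of the free product, the words visit the same points as before, so the stabilizer of the base
  point agrees with \<open>H\<close> on \<open>\<Omega>\<close>. It is co-amenable: if the orbit of the base point contains an
  infinite orbit of a factor, then this factor has Foelner sets there which avoid \<open>Y\<close>, and the other factor fixes
  these sets pointwise; otherwise the orbit of the base point is finite.\<close>

theorem A_separable_free_product:
  fixes G :: "('a, 'm) monoid_scheme" and K :: "('b, 'n) monoid_scheme"
  assumes G: "group G" "A_separable G" and K: "group K" "A_separable K"
  shows "A_separable (free_product G K)"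
  unfolding A_separable_iff
proof (intro allI impI, elim conjE)
  let ?P = "free_product G K"
  fix H \<Omega> assume H: "subgroup H ?P" and \<Omega>: "finite \<Omega>" "\<Omega> \<subseteq> carrier ?P"
  have P: "group ?P" by (rule group_free_product[OF G(1) K(1)])
  have carrP: "carrier ?P = fp_class G K ` fp_words G K" by (simp add: free_product_def)
  obtain W where W: "W \<subseteq> fp_words G K" "finite W" "\<Omega> = fp_class G K ` W"
    using finite_subset_image[OF \<Omega>(1) \<Omega>(2)[unfolded carrP]] by metis
  let ?X = "lcosets\<^bsub>?P\<^esub> H"
  define \<alpha> where "\<alpha> = (\<lambda>g C. fp_class G K [Inl g] <#\<^bsub>?P\<^esub> C)"
  define \<beta> where "\<beta> = (\<lambda>k C. fp_class G K [Inr k] <#\<^bsub>?P\<^esub> C)"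
  note actX = acts_lcosets[OF P H]
  have word_X: "word_act \<alpha> \<beta> w C = fp_class G K w <#\<^bsub>?P\<^esub> C" if "w \<in> fp_words G K" "C \<in> ?X" for w C
    using lcosets_word_act[OF G(1) K(1) H that(2,1)] by (simp add: \<alpha>_def \<beta>_def)
  have \<alpha>: "acts G ?X \<alpha>"
    unfolding \<alpha>_def by (rule acts_comp_hom[OF G(1) P fp_class_Inl_hom[OF G(1) K(1)] actX])
  have \<beta>: "acts K ?X \<beta>"
    unfolding \<beta>_def by (rule acts_comp_hom[OF K(1) P fp_class_Inr_hom[OF G(1) K(1)] actX])
  have H0: "H \<in> ?X"
  proof -
    have "\<one>\<^bsub>?P\<^esub> <#\<^bsub>?P\<^esub> H = H" by (rule group.lcos_mult_one[OF P subgroup.subset[OF H]])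
    then show ?thesis using monoid.one_closed[OF group.is_monoid[OF P]] by (auto simp: LCOSETS_def)
  qed
  \<comment> \<open>The last letter of a word acts first, so the suffixes of the words lead to the points visited.\<close>
  define V where "V = {v. \<exists>u. u @ v \<in> W}"
  have V: "V \<subseteq> fp_words G K" "W \<subseteq> V" using W(1) by (auto simp: V_def) (metis append_Nil)
  have "finite V"
  proof (rule finite_subset)
    show "V \<subseteq> (\<Union>w\<in>W. (\<lambda>n. drop n w) ` {..length w})"
    proof
      fix v assume "v \<in> V"
      then obtain u where u: "u @ v \<in> W" by (auto simp: V_def)
      show "v \<in> (\<Union>w\<in>W. (\<lambda>n. drop n w) ` {..length w})"
        by (rule UN_I[OF u], rule image_eqI[of _ _ "length u"]) simp_all
    qed
    show "finite (\<Union>w\<in>W. (\<lambda>n. drop n w) ` {..length w})" using W(2) by simp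
  qed
  define Y where "Y = insert H ((\<lambda>v. word_act \<alpha> \<beta> v H) ` V)"
  have Y: "finite Y" "Y \<subseteq> ?X" "H \<in> Y"
  proof -
    show "finite Y" using \<open>finite V\<close> by (simp add: Y_def)
    have "word_act \<alpha> \<beta> v H \<in> ?X" if "v \<in> V" for v
      using that V(1) word_X[OF _ H0, of v] acts_closed[OF actX _ H0, of "fp_class G K v"]
      by (auto simp: carrP)
    then show "Y \<subseteq> ?X" using H0 by (auto simp: Y_def)
  qed (simp add: Y_def)
  have YI: "word_act \<alpha> \<beta> v H \<in> Y" if "v \<in> V" for v using that unfolding Y_def by blast
  define A where "A = (\<Union>w\<in>W. {g. Inl g \<in> set w})"
  define B where "B = (\<Union>w\<in>W. {k. Inr k \<in> set w})"
  have AB: "finite A" "finite B" "A \<subseteq> carrier G" "B \<subseteq> carrier K"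
    using fp_letters[OF W(2,1)] by (simp_all add: A_def B_def)
  obtain M \<sigma> where \<sigma>0: "M \<subseteq> range (Inl :: _ \<Rightarrow> ('a + 'b) list set set \<times> 'a set + ('a + 'b) list set set \<times> 'b set)"
      "\<forall>Z. Inl ` Y \<union> Inr ` M \<subseteq> Z \<longrightarrow> acts G Z \<sigma>"
      "\<forall>g z. z \<notin> Inl ` Y \<union> Inr ` M \<longrightarrow> \<sigma> g z = z"
      "\<forall>s\<in>A. \<forall>y\<in>Y. \<alpha> s y \<in> Y \<longrightarrow> \<sigma> s (Inl y) = Inl (\<alpha> s y)"
      "\<forall>z\<in>Inl ` Y \<union> Inr ` M. amenable_action G (orbit G \<sigma> z) \<sigma>"
      "\<forall>z\<in>Inl ` Y \<union> Inr ` M. \<exists>y\<in>Y. z \<in> orbit G \<sigma> (Inl y)"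
    by (rule co_amenable_completion_sum[OF G \<alpha> Y(1,2) AB(1,3) inj_Inl])
  note \<sigma> = \<sigma>0[rule_format]
  obtain N \<tau> where \<tau>0: "N \<subseteq> range (Inr :: _ \<Rightarrow> ('a + 'b) list set set \<times> 'a set + ('a + 'b) list set set \<times> 'b set)"
      "\<forall>Z. Inl ` Y \<union> Inr ` N \<subseteq> Z \<longrightarrow> acts K Z \<tau>"
      "\<forall>g z. z \<notin> Inl ` Y \<union> Inr ` N \<longrightarrow> \<tau> g z = z"
      "\<forall>s\<in>B. \<forall>y\<in>Y. \<beta> s y \<in> Y \<longrightarrow> \<tau> s (Inl y) = Inl (\<beta> s y)"
      "\<forall>z\<in>Inl ` Y \<union> Inr ` N. amenable_action K (orbit K \<tau> z) \<tau>"
      "\<forall>z\<in>Inl ` Y \<union> Inr ` N. \<exists>y\<in>Y. z \<in> orbit K \<tau> (Inl y)"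
    by (rule co_amenable_completion_sum[OF K \<beta> Y(1,2) AB(2,4) inj_Inr])
  note \<tau> = \<tau>0[rule_format]
  have disj: "M \<inter> N = {}" using \<sigma>(1) \<tau>(1) by auto
  define Z where "Z = Inl ` Y \<union> Inr ` M \<union> Inr ` N"
  have actZ: "acts G Z \<sigma>" "acts K Z \<tau>" by (auto simp: Z_def intro!: \<sigma>(2) \<tau>(2))
  interpret Z: two_actions G K Z \<sigma> \<tau>
    using G K actZ by (simp add: two_actions_def two_actions_axioms_def)
  obtain z0 where z0_def: "z0 = Inl H" and z0: "z0 \<in> Z"
    using Y(3) by (auto simp: Z_def)
  have traj: "word_act \<sigma> \<tau> v z0 = Inl (word_act \<alpha> \<beta> v H)" if "v \<in> V" for v
    using that
  proof (induction v)
    case Nil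
    then show ?case by (simp add: z0_def)
  next
    case (Cons l v)
    then obtain u where u: "u @ l # v \<in> W" by (auto simp: V_def)
    then have v: "v \<in> V" unfolding V_def by (intro CollectI exI[of _ "u @ [l]"]) simp
    have vY: "word_act \<alpha> \<beta> v H \<in> Y" and lvY: "letter_act \<alpha> \<beta> l (word_act \<alpha> \<beta> v H) \<in> Y"
      using YI[OF v] YI[OF Cons.prems] by simp_all
    show ?case
    proof (cases l)
      case (Inl g)
      have "g \<in> A" unfolding A_def by (rule UN_I[OF u]) (simp add: Inl)
      from \<sigma>(4)[OF this vY] lvY Cons.IH[OF v] show ?thesis by (simp add: Inl)
    next
      case (Inr k)
      have "k \<in> B" unfolding B_def by (rule UN_I[OF u]) (simp add: Inr)
      from \<tau>(4)[OF this vY] lvY Cons.IH[OF v] show ?thesis by (simp add: Inr)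
    qed
  qed
  define act where "act = fp_act \<sigma> \<tau>"
  have act: "acts ?P Z act" unfolding act_def by (rule Z.acts_free_product)
  let ?O = "orbit ?P act z0"
  have "co_amenable ?P (stabilizer ?P act z0)"
  proof (rule co_amenable_stabilizer[OF P act z0])
    have OZ: "?O \<subseteq> Z" by (rule orbit_subset[OF act z0])
    have "\<sigma> g z \<in> ?O" if "g \<in> carrier G" "z \<in> ?O" for g z
      using acts_closed[OF acts_orbit[OF P act z0], of "fp_class G K [Inl g]" z]
        Z.fp_act_class[of "[Inl g]" z] that OZ by (auto simp: act_def carrP)
    then have \<sigma>O: "acts G ?O \<sigma>" by (rule acts_subset[OF actZ(1) OZ])
    have "\<tau> k z \<in> ?O" if "k \<in> carrier K" "z \<in> ?O" for k z
      using acts_closed[OF acts_orbit[OF P act z0], of "fp_class G K [Inr k]" z]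
        Z.fp_act_class[of "[Inr k]" z] that OZ by (auto simp: act_def carrP)
    then have \<tau>O: "acts K ?O \<tau>" by (rule acts_subset[OF actZ(2) OZ])
    interpret O: two_actions G K ?O \<sigma> \<tau>
      using G K \<sigma>O \<tau>O by (simp add: two_actions_def two_actions_axioms_def)
    consider (G) z where "z \<in> ?O" "infinite (orbit G \<sigma> z)"
      | (K) z where "z \<in> ?O" "infinite (orbit K \<tau> z)"
      | (finite) "\<And>z. z \<in> ?O \<Longrightarrow> finite (orbit G \<sigma> z) \<and> finite (orbit K \<tau> z)"
      by blast
    then show "amenable_action ?P ?O act"
    proof cases
      case G
      let ?D = "Inl ` Y \<union> Inr ` M"
      have "z \<in> ?D"
      proof (rule ccontr)
        assume "z \<notin> ?D"
        then have "orbit G \<sigma> z \<subseteq> {z}" using \<sigma>(3) by (auto simp: orbit_def)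
        then show False using G(2) finite_subset by blast
      qed
      note T = acts_orbit[OF \<open>group G\<close> \<sigma>O G(1)]
      have TD: "orbit G \<sigma> z \<subseteq> ?D" by (rule orbit_subset[OF \<sigma>(2)[OF subset_refl] \<open>z \<in> ?D\<close>])
      have TO: "orbit G \<sigma> z \<subseteq> ?O" by (rule orbit_subset[OF \<sigma>O G(1)])
      have inf: "infinite (orbit G \<sigma> y)" if "y \<in> orbit G \<sigma> z" for y
        using orbit_eq[OF \<open>group G\<close> \<sigma>O G(1) that] G(2) by simp
      have "amenable_action ?P ?O (fp_act \<sigma> \<tau>)"
      proof (rule O.amenable_action_free_productI)
        fix \<epsilon> :: real and A B
        assume \<epsilon>: "\<epsilon> > 0" and A: "finite A" "A \<subseteq> carrier G"
        obtain F where F: "F \<subseteq> orbit G \<sigma> z - Inl ` Y" "foelner_set \<sigma> A \<epsilon> F"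
          using foelner_set_avoiding[OF \<open>group G\<close> T \<sigma>(5)[OF \<open>z \<in> ?D\<close>] inf finite_imageI[OF Y(1)] \<epsilon> A] by blast
        have "x \<notin> Inl ` Y \<union> Inr ` N" if "x \<in> F" for x using that F(1) TD disj by blast
        then have "foelner_set \<tau> B \<epsilon> F"
          by (intro foelner_set_fixed foelner_setD(1,2)[OF F(2)] \<epsilon> \<tau>(3))
        with F TO show "\<exists>F\<subseteq>?O. foelner_set \<sigma> A \<epsilon> F \<and> foelner_set \<tau> B \<epsilon> F" by blast
      qed
      then show ?thesis by (simp only: act_def)
    next
      case K
      let ?D = "Inl ` Y \<union> Inr ` N"
      have "z \<in> ?D"
      proof (rule ccontr)
        assume "z \<notin> ?D"
        then have "orbit K \<tau> z \<subseteq> {z}" using \<tau>(3) by (auto simp: orbit_def)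
        then show False using K(2) finite_subset by blast
      qed
      note T = acts_orbit[OF \<open>group K\<close> \<tau>O K(1)]
      have TD: "orbit K \<tau> z \<subseteq> ?D" by (rule orbit_subset[OF \<tau>(2)[OF subset_refl] \<open>z \<in> ?D\<close>])
      have TO: "orbit K \<tau> z \<subseteq> ?O" by (rule orbit_subset[OF \<tau>O K(1)])
      have inf: "infinite (orbit K \<tau> y)" if "y \<in> orbit K \<tau> z" for y
        using orbit_eq[OF \<open>group K\<close> \<tau>O K(1) that] K(2) by simp
      have "amenable_action ?P ?O (fp_act \<sigma> \<tau>)"
      proof (rule O.amenable_action_free_productI)
        fix \<epsilon> :: real and A B
        assume \<epsilon>: "\<epsilon> > 0" and B: "finite B" "B \<subseteq> carrier K"
        obtain F where F: "F \<subseteq> orbit K \<tau> z - Inl ` Y" "foelner_set \<tau> B \<epsilon> F"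
          using foelner_set_avoiding[OF \<open>group K\<close> T \<tau>(5)[OF \<open>z \<in> ?D\<close>] inf finite_imageI[OF Y(1)] \<epsilon> B] by blast
        have "x \<notin> Inl ` Y \<union> Inr ` M" if "x \<in> F" for x using that F(1) TD disj by blast
        then have "foelner_set \<sigma> A \<epsilon> F"
          by (intro foelner_set_fixed foelner_setD(1,2)[OF F(2)] \<epsilon> \<sigma>(3))
        with F TO show "\<exists>F\<subseteq>?O. foelner_set \<sigma> A \<epsilon> F \<and> foelner_set \<tau> B \<epsilon> F" by blast
      qed
      then show ?thesis by (simp only: act_def)
    next
      case finite
      let ?U = "\<Union>y\<in>{y \<in> Y. Inl y \<in> ?O}. orbit G \<sigma> (Inl y) \<union> orbit K \<tau> (Inl y)"
      have "?O \<subseteq> ?U"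
      proof
        fix z assume z: "z \<in> ?O"
        then consider "z \<in> Inl ` Y \<union> Inr ` M" | "z \<in> Inl ` Y \<union> Inr ` N"
          using OZ by (auto simp: Z_def)
        then show "z \<in> ?U"
        proof cases
          case 1
          then obtain y where y: "y \<in> Y" "z \<in> orbit G \<sigma> (Inl y)" using \<sigma>(6) by blast
          have "Inl y \<in> Z" using y(1) by (simp add: Z_def)
          then have "Inl y \<in> orbit G \<sigma> z"
            using orbit_eq[OF \<open>group G\<close> actZ(1) _ y(2)] orbit_refl[OF \<open>group G\<close> actZ(1), of "Inl y"] by simp
          then have "Inl y \<in> ?O" using orbit_subset[OF \<sigma>O z] by blast
          with y show ?thesis by blast
        next
          case 2
          then obtain y where y: "y \<in> Y" "z \<in> orbit K \<tau> (Inl y)" using \<tau>(6) by blast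
          have "Inl y \<in> Z" using y(1) by (simp add: Z_def)
          then have "Inl y \<in> orbit K \<tau> z"
            using orbit_eq[OF \<open>group K\<close> actZ(2) _ y(2)] orbit_refl[OF \<open>group K\<close> actZ(2), of "Inl y"] by simp
          then have "Inl y \<in> ?O" using orbit_subset[OF \<tau>O z] by blast
          with y show ?thesis by blast
        qed
      qed
      moreover have "finite ?U" using Y(1) finite by simp
      ultimately have "finite ?O" by (rule finite_subset)
      moreover have "?O \<noteq> {}" using orbit_refl[OF P act z0] by blast
      ultimately show ?thesis by (rule amenable_action_finite[OF P acts_orbit[OF P act z0]])
    qed
  qed
  moreover have "stabilizer ?P act z0 \<inter> \<Omega> = H \<inter> \<Omega>"
  proof -
    have "act p z0 = z0 \<longleftrightarrow> p \<in> H" if p\<Omega>: "p \<in> \<Omega>" for p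
    proof -
      obtain w where w: "w \<in> W" "p = fp_class G K w" using p\<Omega> W(3) by blast
      have wW: "w \<in> fp_words G K" and wV: "w \<in> V" using w(1) W(1) V(2) by auto
      have "act p z0 = Inl (p <#\<^bsub>?P\<^esub> H)"
        using Z.fp_act_class[OF wW z0] traj[OF wV] word_X[OF wW H0] by (simp add: act_def w(2))
      then have "act p z0 = z0 \<longleftrightarrow> p <#\<^bsub>?P\<^esub> H = H" by (simp add: z0_def)
      also have "\<dots> \<longleftrightarrow> p \<in> H"
        using group.lcos_self[OF P _ H, of p] group.coset_join3[OF P _ H, of p] p\<Omega> \<Omega>(2) by auto
      finally show ?thesis .
    qed
    then show ?thesis using \<Omega>(2) unfolding stabilizer_def by blast
  qed
  ultimately show "\<exists>L. co_amenable ?P L \<and> L \<inter> \<Omega> = H \<inter> \<Omega>" by blast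
qed

section \<open>Square-summable functions\<close>

text \<open>The functions live on the whole type and vanish outside of \<open>T\<close>, so that they form a subspace of the
  function space over which \<open>property_T\<close> ranges.\<close>

definition l2 :: "'a set \<Rightarrow> ('a \<Rightarrow> complex) set" where
  "l2 T = {f. (\<forall>x. x \<notin> T \<longrightarrow> f x = 0) \<and> (\<lambda>x. (cmod (f x))\<^sup>2) summable_on T}"

definition l2_inner :: "'a set \<Rightarrow> ('a \<Rightarrow> complex) \<Rightarrow> ('a \<Rightarrow> complex) \<Rightarrow> complex" where
  "l2_inner T f h = (\<Sum>\<^sub>\<infinity>x\<in>T. f x * cnj (h x))"

lemma l2I: "(\<And>x. x \<notin> T \<Longrightarrow> f x = 0) \<Longrightarrow> (\<lambda>x. (cmod (f x))\<^sup>2) summable_on T \<Longrightarrow> f \<in> l2 T"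
  by (simp add: l2_def)

lemma l2_summable: "f \<in> l2 T \<Longrightarrow> (\<lambda>x. (cmod (f x))\<^sup>2) summable_on T"
  by (simp add: l2_def)

lemma l2_outside: "f \<in> l2 T \<Longrightarrow> x \<notin> T \<Longrightarrow> f x = 0"
  by (simp add: l2_def)

lemma l2_dominated:
  assumes "\<And>x. x \<notin> T \<Longrightarrow> f x = 0" "g summable_on T" "\<And>x. x \<in> T \<Longrightarrow> (cmod (f x))\<^sup>2 \<le> g x"
  shows "f \<in> l2 T"
proof (rule l2I[OF assms(1)])
  show "(\<lambda>x. (cmod (f x))\<^sup>2) summable_on T"
    by (rule summable_on_comparison_test[OF assms(2) assms(3)]) auto
qed

lemma l2_add:
  assumes "f \<in> l2 T" "h \<in> l2 T"
  shows "(f + h) \<in> l2 T"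
proof (rule l2_dominated[where g = "\<lambda>x. 2 * (cmod (f x))\<^sup>2 + 2 * (cmod (h x))\<^sup>2"])
  show "(\<lambda>x. 2 * (cmod (f x))\<^sup>2 + 2 * (cmod (h x))\<^sup>2) summable_on T"
    by (intro summable_on_add summable_on_cmult_right l2_summable assms)
  fix x
  have "(cmod (f x + h x))\<^sup>2 \<le> (cmod (f x) + cmod (h x))\<^sup>2"
    by (intro power_mono norm_triangle_ineq) simp
  also have "\<dots> \<le> 2 * (cmod (f x))\<^sup>2 + 2 * (cmod (h x))\<^sup>2"
    using sum_squares_bound[of "cmod (f x)" "cmod (h x)"] by (simp add: power2_sum)
  finally show "(cmod ((f + h) x))\<^sup>2 \<le> 2 * (cmod (f x))\<^sup>2 + 2 * (cmod (h x))\<^sup>2" by simp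
qed (simp add: assms[THEN l2_outside])

lemma l2_scale:
  assumes "f \<in> l2 T"
  shows "(\<lambda>x. c * f x) \<in> l2 T"
  by (rule l2_dominated[where g = "\<lambda>x. (cmod c)\<^sup>2 * (cmod (f x))\<^sup>2"])
    (simp_all add: summable_on_cmult_right[OF l2_summable[OF assms]] norm_mult power_mult_distrib l2_outside[OF assms])

lemma l2_zero: "0 \<in> l2 T"
  by (rule l2I) auto

lemma l2_diff:
  assumes "f \<in> l2 T" "h \<in> l2 T"
  shows "f - h \<in> l2 T"
proof -
  have eq: "f - h = f + (\<lambda>x. (-1) * h x)" by (rule ext) simp
  show ?thesis unfolding eq by (rule l2_add[OF assms(1) l2_scale[OF assms(2)]])
qed

lemma l2_inner_summable:
  assumes "f \<in> l2 T" "h \<in> l2 T"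
  shows "(\<lambda>x. f x * cnj (h x)) summable_on T"
proof (rule abs_summable_summable)
  show "(\<lambda>x. norm (f x * cnj (h x))) summable_on T"
  proof (rule summable_on_comparison_test)
    show "(\<lambda>x. (cmod (f x))\<^sup>2 + (cmod (h x))\<^sup>2) summable_on T"
      by (intro summable_on_add l2_summable assms)
    fix x
    have "0 \<le> cmod (f x) * cmod (h x)" by simp
    with sum_squares_bound[of "cmod (f x)" "cmod (h x)"]
    show "norm (f x * cnj (h x)) \<le> (cmod (f x))\<^sup>2 + (cmod (h x))\<^sup>2"
      by (simp only: norm_mult complex_mod_cnj mult.assoc)
  qed auto
qed

text \<open>If \<open>f\<close> is not square-summable, then both sums have the default value 0; hence \<open>ip_norm_l2\<close> and
  \<open>ip_norm_l2_nonneg\<close> hold for all functions.\<close>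

lemma l2_inner_self: "l2_inner T f f = of_real (\<Sum>\<^sub>\<infinity>x\<in>T. (cmod (f x))\<^sup>2)"
proof -
  have "f x * cnj (f x) = of_real ((cmod (f x))\<^sup>2)" for x
    by (rule complex_norm_square[symmetric])
  then have eq: "l2_inner T f f = (\<Sum>\<^sub>\<infinity>x\<in>T. of_real ((cmod (f x))\<^sup>2))"
    by (simp only: l2_inner_def)
  show ?thesis
  proof (cases "(\<lambda>x. (cmod (f x))\<^sup>2) summable_on T")
    case True
    then have "((\<lambda>x. (cmod (f x))\<^sup>2) has_sum (\<Sum>\<^sub>\<infinity>x\<in>T. (cmod (f x))\<^sup>2)) T"
      by (rule has_sum_infsum)
    then have "((\<lambda>x. complex_of_real ((cmod (f x))\<^sup>2)) has_sum of_real (\<Sum>\<^sub>\<infinity>x\<in>T. (cmod (f x))\<^sup>2)) T"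
      by (simp only: has_sum_of_real_iff)
    then show ?thesis unfolding eq by (rule infsumI)
  next
    case False
    have "\<not> (\<lambda>x. complex_of_real ((cmod (f x))\<^sup>2)) summable_on T"
    proof
      assume "(\<lambda>x. complex_of_real ((cmod (f x))\<^sup>2)) summable_on T"
      from summable_on_bounded_linear[OF bounded_linear_Re this] False show False
        by (simp only: Re_complex_of_real)
    qed
    from infsum_not_exists[OF this] infsum_not_exists[OF False] show ?thesis
      unfolding eq by (simp only: of_real_0)
  qed
qed

lemma ip_norm_l2: "(ip_norm (l2_inner T) f)\<^sup>2 = (\<Sum>\<^sub>\<infinity>x\<in>T. (cmod (f x))\<^sup>2)"
proof -
  have "(\<Sum>\<^sub>\<infinity>x\<in>T. (cmod (f x))\<^sup>2) \<ge> 0" by (intro infsum_nonneg) simp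
  then show ?thesis by (simp add: ip_norm_def l2_inner_self)
qed

lemma ip_norm_l2_nonneg: "ip_norm (l2_inner T) f \<ge> 0"
proof -
  have "(\<Sum>\<^sub>\<infinity>x\<in>T. (cmod (f x))\<^sup>2) \<ge> 0" by (intro infsum_nonneg) simp
  then show ?thesis by (simp add: ip_norm_def l2_inner_self)
qed

lemma l2_finite_sum_le:
  assumes "f \<in> l2 T" "finite A" "A \<subseteq> T"
  shows "(\<Sum>x\<in>A. (cmod (f x))\<^sup>2) \<le> (ip_norm (l2_inner T) f)\<^sup>2"
  unfolding ip_norm_l2
  by (rule finite_sum_le_infsum[OF l2_summable[OF assms(1)] assms(2,3)]) simp

lemma l2_bounded_sums:
  assumes "\<And>x. x \<notin> T \<Longrightarrow> f x = 0" and "\<And>A. finite A \<Longrightarrow> A \<subseteq> T \<Longrightarrow> (\<Sum>x\<in>A. (cmod (f x))\<^sup>2) \<le> e\<^sup>2"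
    and "e \<ge> 0"
  shows "f \<in> l2 T" "ip_norm (l2_inner T) f \<le> e"
proof -
  have s: "(\<lambda>x. (cmod (f x))\<^sup>2) summable_on T"
    by (rule nonneg_bdd_above_summable_on) (use assms(2) in \<open>auto intro!: bdd_aboveI[where M = "e\<^sup>2"]\<close>)
  then show "f \<in> l2 T" using assms(1) by (intro l2I)
  have "(ip_norm (l2_inner T) f)\<^sup>2 \<le> e\<^sup>2"
    unfolding ip_norm_l2 by (rule infsum_le_finite_sums[OF s assms(2)])
  then show "ip_norm (l2_inner T) f \<le> e" using assms(3) power2_le_imp_le by blast
qed

text \<open>A Cauchy sequence converges pointwise. For finite partial sums the Cauchy estimate passes to the
  limit, and bounds on all finite partial sums are bounds on the norm.\<close>

lemma l2_complete:
  assumes X: "\<And>n::nat. X n \<in> l2 T"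
    and cauchy: "\<And>e. e > 0 \<Longrightarrow> \<exists>N. \<forall>m\<ge>N. \<forall>n\<ge>N. ip_norm (l2_inner T) (X m - X n) < e"
  shows "\<exists>l\<in>l2 T. (\<lambda>n. ip_norm (l2_inner T) (X n - l)) \<longlonglongrightarrow> 0"
proof -
  have "Cauchy (\<lambda>n. X n x)" for x
  proof (cases "x \<in> T")
    case True
    show ?thesis
    proof (rule metric_CauchyI)
      fix e :: real assume "e > 0"
      then obtain N where N: "\<And>m n. m \<ge> N \<Longrightarrow> n \<ge> N \<Longrightarrow> ip_norm (l2_inner T) (X m - X n) < e"
        using cauchy by blast
      have "dist (X m x) (X n x) < e" if "m \<ge> N" "n \<ge> N" for m n
      proof -
        have "(dist (X m x) (X n x))\<^sup>2 \<le> (ip_norm (l2_inner T) (X m - X n))\<^sup>2"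
          using l2_finite_sum_le[OF l2_diff[OF X X], of "{x}" m n] True by (simp add: dist_norm)
        then have "dist (X m x) (X n x) \<le> ip_norm (l2_inner T) (X m - X n)"
          using ip_norm_l2_nonneg power2_le_imp_le by blast
        with N[OF that] show ?thesis by simp
      qed
      then show "\<exists>M. \<forall>m\<ge>M. \<forall>n\<ge>M. dist (X m x) (X n x) < e" by blast
    qed
  next
    case False
    then have "(\<lambda>n. X n x) = (\<lambda>n. 0)" using l2_outside[OF X] by blast
    then show ?thesis by (simp add: Cauchy_def)
  qed
  then have "\<exists>l. (\<lambda>n. X n x) \<longlonglongrightarrow> l" for x
    using Cauchy_convergent_iff convergent_def by blast
  then obtain l where l: "\<And>x. (\<lambda>n. X n x) \<longlonglongrightarrow> l x" by metis
  have l0: "l x = 0" if "x \<notin> T" for x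
  proof -
    have "(\<lambda>n. X n x) = (\<lambda>n. 0)" using l2_outside[OF X that] by blast
    with l[of x] show ?thesis by (simp add: LIMSEQ_const_iff)
  qed
  have near: "\<exists>N. \<forall>m\<ge>N. (X m - l) \<in> l2 T \<and> ip_norm (l2_inner T) (X m - l) \<le> e" if "e > 0" for e
  proof -
    obtain N where N: "\<And>m n. m \<ge> N \<Longrightarrow> n \<ge> N \<Longrightarrow> ip_norm (l2_inner T) (X m - X n) < e"
      using cauchy[OF \<open>e > 0\<close>] by blast
    have "(X m - l) \<in> l2 T \<and> ip_norm (l2_inner T) (X m - l) \<le> e" if m: "m \<ge> N" for m
    proof -
      have out: "(X m - l) x = 0" if "x \<notin> T" for x using l0 l2_outside[OF X] that by simp
      have sums: "(\<Sum>x\<in>A. (cmod ((X m - l) x))\<^sup>2) \<le> e\<^sup>2" if A: "finite A" "A \<subseteq> T" for A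
      proof (rule LIMSEQ_le_const2)
        show "(\<lambda>n. \<Sum>x\<in>A. (cmod (X m x - X n x))\<^sup>2) \<longlonglongrightarrow> (\<Sum>x\<in>A. (cmod ((X m - l) x))\<^sup>2)"
          unfolding minus_apply by (intro tendsto_intros l)
        have "(\<Sum>x\<in>A. (cmod (X m x - X n x))\<^sup>2) \<le> e\<^sup>2" if n: "n \<ge> N" for n
        proof -
          have "(\<Sum>x\<in>A. (cmod (X m x - X n x))\<^sup>2) \<le> (ip_norm (l2_inner T) (X m - X n))\<^sup>2"
            using l2_finite_sum_le[OF l2_diff[OF X X] A, of m n] by simp
          also have "\<dots> \<le> e\<^sup>2"
            using N[OF m n] ip_norm_l2_nonneg by (intro power_mono) auto
          finally show ?thesis .
        qed
        then show "\<exists>N. \<forall>n\<ge>N. (\<Sum>x\<in>A. (cmod (X m x - X n x))\<^sup>2) \<le> e\<^sup>2" by blast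
      qed
      show ?thesis using l2_bounded_sums[of T "X m - l" e, OF out sums] \<open>e > 0\<close> by simp
    qed
    then show ?thesis by blast
  qed
  obtain N where "(X N - l) \<in> l2 T" using near[of 1] by auto
  then have "X N - (X N - l) \<in> l2 T" by (rule l2_diff[OF X])
  moreover have "X N - (X N - l) = l" by (rule ext) simp
  ultimately have "l \<in> l2 T" by simp
  moreover have "(\<lambda>n. ip_norm (l2_inner T) (X n - l)) \<longlonglongrightarrow> 0"
  proof (rule LIMSEQ_I)
    fix r :: real assume "r > 0"
    then obtain N where "\<forall>m\<ge>N. ip_norm (l2_inner T) (X m - l) \<le> r / 2" using near[of "r / 2"] by auto
    then show "\<exists>N. \<forall>n\<ge>N. norm (ip_norm (l2_inner T) (X n - l) - 0) < r"
      using \<open>r > 0\<close> ip_norm_l2_nonneg[of T] by (intro exI[of _ N]) fastforce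
  qed
  ultimately show ?thesis by blast
qed

lemma l2_hilbert_space:
  "complex_hilbert_space (\<lambda>c f x. c * f x) (l2 (T :: 'a set)) (l2_inner T)"
proof -
  interpret vs: vector_space "\<lambda>c (f :: 'a \<Rightarrow> complex) x. c * f x"
    by unfold_locales (auto simp: algebra_simps fun_eq_iff)
  show ?thesis
  proof
    show "vs.subspace (l2 T)"
      unfolding vs.subspace_def using l2_zero l2_add l2_scale by blast
    fix x y :: "'a \<Rightarrow> complex" and c assume x: "x \<in> l2 T" and y: "y \<in> l2 T"
    show "l2_inner T (\<lambda>t. c * x t) y = c * l2_inner T x y"
      unfolding l2_inner_def by (simp add: mult.assoc infsum_cmult_right')
    show "l2_inner T y x = cnj (l2_inner T x y)"
      unfolding l2_inner_def by (simp flip: infsum_cnj add: mult.commute)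
    fix z assume z: "z \<in> l2 T"
    show "l2_inner T (x + y) z = l2_inner T x z + l2_inner T y z"
      unfolding l2_inner_def
      using infsum_add[OF l2_inner_summable[OF x z] l2_inner_summable[OF y z]] by (simp add: algebra_simps)
  next
    fix x :: "'a \<Rightarrow> complex" assume x: "x \<in> l2 T" and "x \<noteq> 0"
    then obtain t where "x t \<noteq> 0" by (auto simp: fun_eq_iff)
    then have "t \<in> T" using l2_outside[OF x] by blast
    then have "(cmod (x t))\<^sup>2 \<le> (ip_norm (l2_inner T) x)\<^sup>2"
      using l2_finite_sum_le[OF x, of "{t}"] by simp
    moreover have "(cmod (x t))\<^sup>2 > 0" using \<open>x t \<noteq> 0\<close> by simp
    ultimately have "(ip_norm (l2_inner T) x)\<^sup>2 > 0" by linarith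
    then show "Re (l2_inner T x x) > 0"
      by (simp only: ip_norm_l2 l2_inner_self Re_complex_of_real)
  qed (rule l2_complete)
qed

section \<open>Permutation representations\<close>

definition perm_rep :: "('a, 'm) monoid_scheme \<Rightarrow> 't set \<Rightarrow> ('a \<Rightarrow> 't \<Rightarrow> 't) \<Rightarrow> 'a \<Rightarrow> ('t \<Rightarrow> complex) \<Rightarrow> 't \<Rightarrow> complex" where
  "perm_rep G T \<tau> g f x = (if x \<in> T then f (\<tau> (inv\<^bsub>G\<^esub> g) x) else 0)"

lemma acts_bij:
  assumes "group G" "acts G T \<tau>" "g \<in> carrier G"
  shows "bij_betw (\<tau> g) T T"
proof -
  interpret group G by fact
  show ?thesis
    by (rule bij_betw_byWitness[where f' = "\<tau> (inv\<^bsub>G\<^esub> g)"])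
      (use acts_inv[OF assms] acts_closed[OF assms(2)] assms(3) in auto)
qed

lemma perm_rep_unitary:
  fixes T :: "'t set"
  assumes G: "group G" and \<tau>: "acts G T \<tau>"
  shows "unitary_representation G (\<lambda>c f x. c * f x) (l2 T) (l2_inner T) (perm_rep G T \<tau>)"
proof -
  interpret group G by fact
  let ?\<pi> = "perm_rep G T \<tau>"
  have mult: "?\<pi> (g \<otimes>\<^bsub>G\<^esub> h) f = ?\<pi> g (?\<pi> h f)" if "g \<in> carrier G" "h \<in> carrier G" for g h f
    using that acts_mult[OF \<tau>, of "inv\<^bsub>G\<^esub> h" "inv\<^bsub>G\<^esub> g"] acts_closed[OF \<tau>]
    by (auto simp: perm_rep_def inv_mult_group fun_eq_iff)
  have one: "?\<pi> \<one>\<^bsub>G\<^esub> f = f" if "f \<in> l2 T" for f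
    using acts_one[OF \<tau>] l2_outside[OF that] by (auto simp: perm_rep_def fun_eq_iff)
  have closed: "?\<pi> g f \<in> l2 T" if g: "g \<in> carrier G" and f: "f \<in> l2 T" for g f
  proof (rule l2I)
    have b: "bij_betw (\<tau> (inv\<^bsub>G\<^esub> g)) T T" by (rule acts_bij[OF G \<tau>]) (use g in simp)
    have "(\<lambda>x. (cmod (f (\<tau> (inv\<^bsub>G\<^esub> g) x)))\<^sup>2) summable_on T"
      using summable_on_reindex_bij_betw[OF b, of "\<lambda>x. (cmod (f x))\<^sup>2"] l2_summable[OF f] by simp
    then show "(\<lambda>x. (cmod (?\<pi> g f x))\<^sup>2) summable_on T"
      by (rule summable_on_cong[THEN iffD1, rotated]) (simp add: perm_rep_def)
  qed (simp add: perm_rep_def)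
  have "unitary_operator (\<lambda>c f x. c * f x) (l2 T) (l2_inner T) (?\<pi> g)" if g: "g \<in> carrier G" for g
    unfolding unitary_operator_def
  proof (intro conjI ballI allI)
    have "?\<pi> (inv\<^bsub>G\<^esub> g) (?\<pi> g f) = f" "?\<pi> g (?\<pi> (inv\<^bsub>G\<^esub> g) f) = f" if "f \<in> l2 T" for f
      using mult[of "inv\<^bsub>G\<^esub> g" g f] mult[of g "inv\<^bsub>G\<^esub> g" f] g one[OF that] by simp_all
    then show "bij_betw (?\<pi> g) (l2 T) (l2 T)"
      by (intro bij_betw_byWitness[where f' = "?\<pi> (inv\<^bsub>G\<^esub> g)"]) (use closed g in auto)
    fix f h :: "'t \<Rightarrow> complex"
    show "?\<pi> g (f + h) = ?\<pi> g f + ?\<pi> g h" by (simp add: perm_rep_def fun_eq_iff)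
    show "?\<pi> g (\<lambda>x. c * f x) = (\<lambda>x. c * ?\<pi> g f x)" for c by (simp add: perm_rep_def fun_eq_iff)
    have b: "bij_betw (\<tau> (inv\<^bsub>G\<^esub> g)) T T" by (rule acts_bij[OF G \<tau>]) (use g in simp)
    have "l2_inner T (?\<pi> g f) (?\<pi> g h) = (\<Sum>\<^sub>\<infinity>x\<in>T. f (\<tau> (inv\<^bsub>G\<^esub> g) x) * cnj (h (\<tau> (inv\<^bsub>G\<^esub> g) x)))"
      unfolding l2_inner_def by (rule infsum_cong) (simp add: perm_rep_def)
    also have "\<dots> = l2_inner T f h"
      unfolding l2_inner_def by (rule infsum_reindex_bij_betw[OF b])
    finally show "l2_inner T (?\<pi> g f) (?\<pi> g h) = l2_inner T f h" .
  qed
  then show ?thesis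
    unfolding unitary_representation_def using l2_hilbert_space mult by blast
qed

lemma ip_norm_l2_indicator:
  assumes "finite F" "F \<subseteq> T" "\<And>x. x \<in> F \<Longrightarrow> cmod (f x) = 1" "\<And>x. x \<notin> F \<Longrightarrow> f x = 0"
  shows "(ip_norm (l2_inner T) f)\<^sup>2 = card F"
proof -
  have "(\<Sum>\<^sub>\<infinity>x\<in>T. (cmod (f x))\<^sup>2) = (\<Sum>\<^sub>\<infinity>x\<in>F. (cmod (f x))\<^sup>2)"
    by (rule infsum_cong_neutral) (use assms in auto)
  also have "\<dots> = (\<Sum>x\<in>F. 1)" using assms by (simp)
  finally show ?thesis by (simp add: ip_norm_l2)
qed

text \<open>Indicator functions of Foelner sets are almost invariant vectors of the permutation representation
  on \<open>l2 T\<close>: the squared displacement is the size of a symmetric difference. Property (T) yields a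
  nonzero invariant vector, which is constant as the action is transitive; and a nonzero constant is
  square-summable only on a finite set.\<close>

lemma property_T_finite_orbit:
  fixes G :: "('a, 'm) monoid_scheme" and T :: "'a set"
  assumes G: "group G" and "property_T G" and \<tau>: "acts G T \<tau>" and am: "amenable_action G T \<tau>"
    and trans: "\<And>x y. x \<in> T \<Longrightarrow> y \<in> T \<Longrightarrow> y \<in> orbit G \<tau> x"
  shows "finite T"
proof -
  interpret group G by fact
  let ?\<pi> = "perm_rep G T \<tau>"
  obtain Q \<epsilon> where Q: "finite Q" "Q \<subseteq> carrier G" and \<epsilon>: "(\<epsilon>::real) > 0"
    and kazhdan: "\<And>(V :: ('a \<Rightarrow> complex) set) ip \<pi>.
          unitary_representation G (\<lambda>c f x. c * f x) V ip \<pi> \<Longrightarrow>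
          (\<exists>v\<in>V. v \<noteq> 0 \<and> (\<forall>g\<in>Q. ip_norm ip (\<pi> g v - v) < \<epsilon> * ip_norm ip v)) \<Longrightarrow>
          (\<exists>v\<in>V. v \<noteq> 0 \<and> (\<forall>g\<in>carrier G. \<pi> g v = v))"
    using assms(2) unfolding property_T_def by metis
  \<comment> \<open>Norms are squared and \<open>escape\<close> is half of the symmetric difference.\<close>
  have "\<epsilon>\<^sup>2 / 2 > 0" using \<epsilon> by simp
  then obtain F where F: "F \<subseteq> T" "foelner_set \<tau> Q (\<epsilon>\<^sup>2 / 2) F"
    using amenable_actionE[OF am G \<tau> _ Q] by blast
  note FD = foelner_setD[OF F(2)]
  define v :: "'a \<Rightarrow> complex" where "v x = (if x \<in> F then 1 else 0)" for x
  have norm_v: "(ip_norm (l2_inner T) v)\<^sup>2 = card F"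
    by (rule ip_norm_l2_indicator) (use FD F(1) in \<open>auto simp: v_def\<close>)
  have "ip_norm (l2_inner T) (?\<pi> g v - v) < \<epsilon> * ip_norm (l2_inner T) v" if "g \<in> Q" for g
  proof -
    have g: "g \<in> carrier G" using that Q by blast
    have inj: "inj_on (\<tau> g) F" using acts_inj[OF G \<tau> g] F(1) by (rule inj_on_subset)
    let ?D = "(\<tau> g ` F - F) \<union> (F - \<tau> g ` F)"
    have mem: "\<tau> (inv\<^bsub>G\<^esub> g) x \<in> F \<longleftrightarrow> x \<in> \<tau> g ` F" if "x \<in> T" for x
    proof
      assume "\<tau> (inv\<^bsub>G\<^esub> g) x \<in> F"
      then have "\<tau> g (\<tau> (inv\<^bsub>G\<^esub> g) x) \<in> \<tau> g ` F" by (rule imageI)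
      then show "x \<in> \<tau> g ` F" using acts_inv(2)[OF G \<tau> g that] by simp
    next
      assume "x \<in> \<tau> g ` F"
      then obtain y where y: "y \<in> F" "x = \<tau> g y" by blast
      then show "\<tau> (inv\<^bsub>G\<^esub> g) x \<in> F" using acts_inv(1)[OF G \<tau> g, of y] F(1) by auto
    qed
    have gFT: "\<tau> g ` F \<subseteq> T" using acts_closed[OF \<tau> g] F(1) by blast
    have val: "(?\<pi> g v - v) x = (if x \<in> \<tau> g ` F then 1 else 0) - (if x \<in> F then 1 else 0)" for x
      using mem[of x] gFT F(1) by (auto simp: perm_rep_def v_def)
    have "(ip_norm (l2_inner T) (?\<pi> g v - v))\<^sup>2 = card ?D"
    proof (rule ip_norm_l2_indicator)
      show "?D \<subseteq> T" using gFT F(1) by blast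
      show "cmod ((?\<pi> g v - v) x) = 1" if "x \<in> ?D" for x using that unfolding val by auto
      show "(?\<pi> g v - v) x = 0" if "x \<notin> ?D" for x using that unfolding val by auto
    qed (use FD(1) in simp)
    also have "\<dots> < \<epsilon>\<^sup>2 * card F"
      using FD(4)[OF that] card_sym_diff_image[OF FD(1) inj] by simp
    also have "\<dots> = (\<epsilon> * ip_norm (l2_inner T) v)\<^sup>2" by (simp add: power_mult_distrib norm_v)
    finally show ?thesis
      by (rule power_less_imp_less_base) (simp add: less_imp_le[OF \<epsilon>] ip_norm_l2_nonneg)
  qed
  moreover have "v \<in> l2 T"
  proof (rule l2I)
    show "(\<lambda>x. (cmod (v x))\<^sup>2) summable_on T"
      by (rule summable_on_cong_neutral[where S = F, THEN iffD1])
        (use FD(1) F(1) in \<open>auto simp: v_def\<close>)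
  qed (use F(1) in \<open>auto simp: v_def\<close>)
  moreover have "v \<noteq> 0"
    using FD(2) by (auto simp: v_def fun_eq_iff)
  ultimately obtain u where u: "u \<in> l2 T" "u \<noteq> 0" "\<And>g. g \<in> carrier G \<Longrightarrow> ?\<pi> g u = u"
    using kazhdan[OF perm_rep_unitary[OF G \<tau>]] by blast
  obtain x where "u x \<noteq> 0" using u(2) by (auto simp: fun_eq_iff)
  then have x: "x \<in> T" using l2_outside[OF u(1)] by blast
  have const: "u y = u x" if y: "y \<in> T" for y
  proof -
    obtain g where g: "g \<in> carrier G" "x = \<tau> g y" using trans[OF y x] by (auto simp: orbit_def)
    have "u x = ?\<pi> g u x" using u(3)[OF g(1)] by simp
    also have "\<dots> = u (\<tau> (inv\<^bsub>G\<^esub> g) x)" using x by (simp add: perm_rep_def)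
    also have "\<tau> (inv\<^bsub>G\<^esub> g) x = y" using acts_inv(1)[OF G \<tau> g(1) y] g(2) by simp
    finally show ?thesis by simp
  qed
  have "(\<lambda>_. (cmod (u x))\<^sup>2) summable_on T"
    using l2_summable[OF u(1)] by (rule summable_on_cong[THEN iffD1, rotated]) (simp add: const)
  then show "finite T" using \<open>u x \<noteq> 0\<close> infsum_diverge_constant[of T "(cmod (u x))\<^sup>2"] by auto
qed

text \<open>The action on cosets is moved to a set of coset representatives, because \<open>property_T\<close> ranges over
  representations on spaces of functions on the type of group elements.\<close>

lemma property_T_co_amenable_finite_index:
  assumes G: "group G" and "property_T G" and K: "co_amenable G K"
  shows "finite_index_subgroup G K"
proof -
  interpret group G by fact
  have sub: "subgroup K G" using K by (simp add: co_amenable_def)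
  let ?X = "lcosets\<^bsub>G\<^esub> K"
  let ?act = "\<lambda>g C. g <#\<^bsub>G\<^esub> C"
  define r :: "'a set \<Rightarrow> 'a" where "r C = (SOME x. x \<in> C)" for C
  have r: "r C \<in> C" if "C \<in> ?X" for C
  proof -
    have "C \<noteq> {}" using that lcos_self[OF _ sub] by (auto simp: LCOSETS_def)
    then show ?thesis unfolding r_def by (simp add: some_in_eq)
  qed
  have inj: "inj_on r ?X"
  proof (rule inj_onI)
    fix C D assume "C \<in> ?X" "D \<in> ?X" "r C = r D"
    then show "C = D" using lcos_disjoint[OF sub, of C D] r[of C] r[of D] by auto
  qed
  note act = acts_lcosets[OF G sub]
  define \<tau> where "\<tau> = (\<lambda>g z. if z \<in> r ` ?X then r (?act g (inv_into ?X r z)) else z)"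
  have \<tau>r: "\<tau> g (r C) = r (?act g C)" if "C \<in> ?X" for g C
    using that inj by (simp add: \<tau>_def)
  have \<tau>: "acts G (r ` ?X) \<tau>"
    unfolding acts_def
    using acts_closed[OF act] acts_one[OF act] acts_mult[OF act] by (auto simp: \<tau>r)
  have "finite (r ` ?X)"
  proof (rule property_T_finite_orbit[OF G assms(2) \<tau>])
    show "amenable_action G (r ` ?X) \<tau>"
    proof (rule amenable_action_pushforward[where f = r, OF G act G \<tau>])
      show "amenable_action G ?X ?act" using K by (simp add: co_amenable_def)
      show "\<exists>g'\<in>carrier G. \<forall>C\<in>?X. r (?act g' C) = \<tau> g (r C)" if "g \<in> carrier G" for g
        using that \<tau>r by auto
    qed simp
    fix x y assume "x \<in> r ` ?X" "y \<in> r ` ?X"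
    then obtain C D where C: "C \<in> ?X" "x = r C" and D: "D \<in> ?X" "y = r D" by blast
    obtain g where "g \<in> carrier G" "?act g C = D"
      using orbit_lcoset_action[OF G sub C(1) D(1)] by blast
    then show "y \<in> orbit G \<tau> x" using orbit_memI[of g G \<tau> x] \<tau>r[OF C(1), of g] C D by simp
  qed
  then have "finite ?X" using finite_imageD[OF _ inj] by blast
  with sub show ?thesis by (simp add: finite_index_subgroup_def)
qed

lemma property_T_A_separable_LERF:
  assumes "group G" "property_T G" "A_separable G"
  shows "LERF G"
  unfolding LERF_def
proof (intro allI impI, elim conjE)
  interpret group G by fact
  fix K g assume K: "finitely_generated_subgroup G K" and g: "g \<in> carrier G - K"
  obtain S where S: "finite S" "S \<subseteq> carrier G" "K = generate G S"
    using K unfolding finitely_generated_subgroup_def by blast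
  have "subgroup K G" using generate_is_subgroup[OF S(2)] S(3) by simp
  then have "\<exists>L. co_amenable G L \<and> L \<inter> insert g S = K \<inter> insert g S"
    using assms(3)[unfolded A_separable_iff, THEN spec, THEN spec, THEN mp, of K "insert g S"] S(1,2) g
    by simp
  then obtain L where L: "co_amenable G L" "L \<inter> insert g S = K \<inter> insert g S" by blast
  have "subgroup L G" using L(1) by (simp add: co_amenable_def)
  moreover have "S \<subseteq> K" using S(3) generate.incl[of _ S G] by blast
  ultimately have "K \<subseteq> L"
    using L(2) S(3) generate_subgroup_incl[of S L] by blast
  moreover have "g \<notin> L" using L(2) g by blast
  ultimately show "\<exists>L. finite_index_subgroup G L \<and> K \<subseteq> L \<and> g \<notin> L"
    using property_T_co_amenable_finite_index[OF assms(1,2) L(1)] by blast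
qed

section \<open>The additive group of the rationals\<close>

definition rat_group :: "rat monoid" where
  "rat_group = \<lparr>carrier = UNIV, mult = (+), one = 0\<rparr>"

lemma rat_group_simps [simp]:
  "carrier rat_group = UNIV" "x \<otimes>\<^bsub>rat_group\<^esub> y = x + y" "\<one>\<^bsub>rat_group\<^esub> = 0"
  by (simp_all add: rat_group_def)

lemma group_rat_group: "group rat_group"
  by (rule groupI) (auto intro: exI[of _ "- _"] left_minus)

lemma rat_group_pow: "x [^]\<^bsub>rat_group\<^esub> (n::nat) = of_nat n * x"
proof (induction n)
  case 0
  show ?case by (simp add: nat_pow_def)
next
  case (Suc n)
  then show ?case by (simp add: nat_pow_def algebra_simps)
qed

lemma common_denominator:
  assumes "finite (\<Omega> :: rat set)"
  shows "\<exists>d::nat. d > 0 \<and> (\<forall>g\<in>\<Omega>. \<exists>a::int. g = of_int a / of_nat d)"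
  using assms
proof (induction \<Omega>)
  case (insert x \<Omega>)
  then obtain d :: nat where d: "d > 0" "\<forall>g\<in>\<Omega>. \<exists>a::int. g = of_int a / of_nat d" by auto
  obtain p q :: int where pq: "x = of_int p / of_int q" "q > 0"
    using quotient_of_unique[of x] by (metis quotient_of_denom_pos quotient_of_div surj_pair)
  define m where "m = nat q"
  have m: "m > 0" "x = of_int p / of_nat m" using pq by (simp_all add: m_def)
  have "\<exists>a::int. g = of_int a / of_nat (d * m)" if "g \<in> insert x \<Omega>" for g
  proof (cases "g = x")
    case True
    then have "g = of_int (p * int d) / of_nat (d * m)" using m d(1) by (simp add: field_simps)
    then show ?thesis by blast
  next
    case False
    with that have "g \<in> \<Omega>" by blast
    with d(2) obtain a :: int where "g = of_int a / of_nat d" by blast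
    then have "g = of_int (a * int m) / of_nat (d * m)" using m d(1) by (simp add: field_simps)
    then show ?thesis by blast
  qed
  then show ?case using d(1) m(1) by (intro exI[of _ "d * m"]) auto
qed (auto intro: exI[of _ 1])

lemma escape_rat_interval:
  assumes "d > 0"
  shows "escape (\<lambda>x. of_int a / of_nat d + x) ((\<lambda>i::int. of_int i / of_nat d :: rat) ` {0..<int n}) \<le> nat \<bar>a\<bar>"
proof -
  define f where "f = (\<lambda>i::int. of_int i / of_nat d :: rat)"
  have "inj f" using assms by (auto simp: inj_def f_def)
  then have mem: "f i \<in> f ` {0..<int n} \<longleftrightarrow> i \<in> {0..<int n}" for i
    by (rule inj_image_mem_iff)
  have shift: "of_int a / of_nat d + f i = f (a + i)" for i by (simp add: f_def add_divide_distrib)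
  have "{x \<in> f ` {0..<int n}. of_int a / of_nat d + x \<notin> f ` {0..<int n}} =
      f ` {i \<in> {0..<int n}. a + i \<notin> {0..<int n}}"
  proof (intro equalityI subsetI)
    fix x assume "x \<in> {x \<in> f ` {0..<int n}. of_int a / of_nat d + x \<notin> f ` {0..<int n}}"
    then obtain i where "i \<in> {0..<int n}" "x = f i" "f (a + i) \<notin> f ` {0..<int n}"
      using shift by auto
    then show "x \<in> f ` {i \<in> {0..<int n}. a + i \<notin> {0..<int n}}" unfolding mem by blast
  next
    fix x assume "x \<in> f ` {i \<in> {0..<int n}. a + i \<notin> {0..<int n}}"
    then obtain i where "i \<in> {0..<int n}" "x = f i" "f (a + i) \<notin> f ` {0..<int n}"
      unfolding mem by blast
    then show "x \<in> {x \<in> f ` {0..<int n}. of_int a / of_nat d + x \<notin> f ` {0..<int n}}"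
      by (simp add: shift)
  qed
  then have "escape (\<lambda>x. of_int a / of_nat d + x) (f ` {0..<int n}) = card (f ` {i \<in> {0..<int n}. a + i \<notin> {0..<int n}})"
    by (simp only: escape_def)
  also have "\<dots> \<le> card {i \<in> {0..<int n}. a + i \<notin> {0..<int n}}" 
    by (rule card_image_le, rule finite_subset[of _ "{0..<int n}"]) auto
  also have "\<dots> \<le> nat \<bar>a\<bar>"
  proof (cases "a \<ge> 0")
    case True
    have "{i \<in> {0..<int n}. a + i \<notin> {0..<int n}} \<subseteq> {int n - a..<int n}" using True by auto
    from card_mono[OF _ this] True show ?thesis by simp
  next
    case False
    have "{i \<in> {0..<int n}. a + i \<notin> {0..<int n}} \<subseteq> {0..<- a}" using False by auto
    from card_mono[OF _ this] False show ?thesis by simp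
  qed
  finally show ?thesis by (simp only: f_def)
qed

text \<open>The finitely many translations are by multiples of \<open>1 / d\<close> for a common denominator \<open>d\<close>, and a long
  interval in the multiples of \<open>1 / d\<close> is moved by them only at its ends.\<close>

lemma amenable_rat_group: "amenable_group rat_group"
  unfolding amenable_group_def
proof (rule amenable_actionI[OF group_rat_group])
  show "acts rat_group (carrier rat_group) (\<lambda>g x. g \<otimes>\<^bsub>rat_group\<^esub> x)"
    by (simp add: acts_def)
  fix \<epsilon> :: real and \<Omega> :: "rat set" assume \<epsilon>: "\<epsilon> > 0" and \<Omega>: "finite \<Omega>"
  obtain d :: nat where d: "d > 0" "\<forall>g\<in>\<Omega>. \<exists>a::int. g = of_int a / of_nat d"
    using common_denominator[OF \<Omega>] by blast
  then obtain a where a: "\<And>g. g \<in> \<Omega> \<Longrightarrow> g = of_int (a g :: int) / of_nat d" by metis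
  define m where "m = (\<Sum>g\<in>\<Omega>. nat \<bar>a g\<bar>)"
  obtain n :: nat where n: "real n > real m / \<epsilon>" using reals_Archimedean2 by blast
  let ?F = "(\<lambda>i::int. of_int i / of_nat d :: rat) ` {0..<int n}"
  have "real m / \<epsilon> \<ge> 0" using \<epsilon> by simp
  then have "n > 0" using n by linarith
  have card: "card ?F = n"
    using d(1) by (subst card_image) (auto simp: inj_on_def)
  have "real (escape (\<lambda>x. g \<otimes>\<^bsub>rat_group\<^esub> x) ?F) < \<epsilon> * real (card ?F)" if "g \<in> \<Omega>" for g
  proof -
    have "escape (\<lambda>x. g \<otimes>\<^bsub>rat_group\<^esub> x) ?F \<le> nat \<bar>a g\<bar>"
      using escape_rat_interval[OF d(1), of "a g" n] a[OF that] by simp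
    also have "\<dots> \<le> m" unfolding m_def using that \<Omega> by (intro member_le_sum) auto
    finally have "real (escape (\<lambda>x. g \<otimes>\<^bsub>rat_group\<^esub> x) ?F) \<le> real m" by simp
    also have "\<dots> < \<epsilon> * n" using n \<epsilon> by (simp add: divide_less_eq mult.commute)
    finally show ?thesis by (simp only: card)
  qed
  moreover have "?F \<noteq> {}" using \<open>n > 0\<close> by simp
  ultimately have "foelner_set (\<lambda>g x. g \<otimes>\<^bsub>rat_group\<^esub> x) \<Omega> \<epsilon> ?F"
    unfolding foelner_set_def by blast
  then show "\<exists>F\<subseteq>carrier rat_group. foelner_set (\<lambda>g x. g \<otimes>\<^bsub>rat_group\<^esub> x) \<Omega> \<epsilon> F"
    by (intro exI[of _ ?F]) simp
qed

section \<open>Divisible elements and LERF\<close>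

text \<open>Among the cosets of the first powers of \<open>y\<close> two coincide, so some power with exponent at most the
  index lies in \<open>L\<close>; this exponent divides the factorial of the index.\<close>

lemma finite_index_subgroup_pow_fact:
  assumes "group G" "finite_index_subgroup G L" "y \<in> carrier G"
  shows "y [^]\<^bsub>G\<^esub> (fact (card (lcosets\<^bsub>G\<^esub> L)) :: nat) \<in> L"
proof -
  interpret group G by fact
  have L: "subgroup L G" "finite (lcosets\<^bsub>G\<^esub> L)" using assms(2) by (auto simp: finite_index_subgroup_def)
  interpret L: subgroup L G by fact
  let ?N = "card (lcosets\<^bsub>G\<^esub> L)"
  let ?c = "\<lambda>i::nat. y [^]\<^bsub>G\<^esub> i <#\<^bsub>G\<^esub> L"
  have "\<not> inj_on ?c {0..?N}"
  proof
    assume "inj_on ?c {0..?N}"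
    moreover have "?c ` {0..?N} \<subseteq> lcosets\<^bsub>G\<^esub> L" using assms(3) by (auto simp: LCOSETS_def)
    ultimately have "card {0..?N} \<le> ?N" using L(2) by (rule card_inj_on_le)
    then show False by simp
  qed
  then obtain i j where ij: "i < j" "j \<le> ?N" "?c i = ?c j"
    unfolding inj_on_def by (metis atLeastAtMost_iff linorder_neqE_nat)
  have "inv\<^bsub>G\<^esub> (y [^]\<^bsub>G\<^esub> i) \<otimes>\<^bsub>G\<^esub> y [^]\<^bsub>G\<^esub> j \<in> L"
    using ij(3) l_coset_eq_iff[OF assms(1) L(1), of "y [^]\<^bsub>G\<^esub> i" "y [^]\<^bsub>G\<^esub> j"] assms(3) by simp
  also have "y [^]\<^bsub>G\<^esub> j = y [^]\<^bsub>G\<^esub> i \<otimes>\<^bsub>G\<^esub> y [^]\<^bsub>G\<^esub> (j - i)"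
    using ij(1) assms(3) by (simp add: nat_pow_mult)
  also have "inv\<^bsub>G\<^esub> (y [^]\<^bsub>G\<^esub> i) \<otimes>\<^bsub>G\<^esub> (y [^]\<^bsub>G\<^esub> i \<otimes>\<^bsub>G\<^esub> y [^]\<^bsub>G\<^esub> (j - i)) = y [^]\<^bsub>G\<^esub> (j - i)"
    using assms(3) by (simp flip: m_assoc)
  finally have k: "y [^]\<^bsub>G\<^esub> (j - i) \<in> L" .
  have "(j - i) dvd fact ?N" using ij(1,2) by (intro dvd_fact) auto
  then obtain m where m: "fact ?N = (j - i) * m" by (rule dvdE)
  have "(y [^]\<^bsub>G\<^esub> (j - i)) [^]\<^bsub>G\<^esub> m \<in> L" using k by (induction m) simp_all
  then show ?thesis using assms(3) m by (simp add: nat_pow_pow)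
qed

text \<open>Every element of the image is an \<open>n\<close>-th power for every \<open>n\<close>, so it lies in every finite
  index subgroup. Yet in a LERF group the trivial subgroup is an intersection of finite index
  subgroups.\<close>

lemma LERF_hom_rat_group_trivial:
  assumes "group G" "LERF G" "h \<in> hom rat_group G"
  shows "h x = \<one>\<^bsub>G\<^esub>"
proof (rule ccontr)
  interpret group G by fact
  assume "h x \<noteq> \<one>\<^bsub>G\<^esub>"
  moreover have hG: "h y \<in> carrier G" for y using hom_in_carrier[OF assms(3)] by simp
  moreover have "generate G {} = {\<one>\<^bsub>G\<^esub>}" by (rule generate_empty)
  ultimately have "finitely_generated_subgroup G {\<one>\<^bsub>G\<^esub>}" "h x \<in> carrier G - {\<one>\<^bsub>G\<^esub>}"
    unfolding finitely_generated_subgroup_def by (auto intro!: exI[of _ "{}"])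
  then obtain L where L: "finite_index_subgroup G L" "h x \<notin> L"
    using assms(2) unfolding LERF_def by blast
  define N :: nat where "N = fact (card (lcosets\<^bsub>G\<^esub> L))"
  have "h (x / of_nat N) [^]\<^bsub>G\<^esub> N \<in> L"
    unfolding N_def by (rule finite_index_subgroup_pow_fact[OF assms(1) L(1) hG])
  also have "h (x / of_nat N) [^]\<^bsub>G\<^esub> N = h ((x / of_nat N) [^]\<^bsub>rat_group\<^esub> N)"
    by (rule hom_nat_pow[symmetric, OF assms(3) _ group_rat_group assms(1)]) simp
  also have "(x / of_nat N) [^]\<^bsub>rat_group\<^esub> N = x"
    by (simp add: rat_group_pow N_def)
  finally show False using L(2) by contradiction
qed

section \<open>A ping-pong action\<close>

text \<open>Three disjoint translates of \<open>B\<close>, which meet an almost invariant set \<open>F\<close> in about the same number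
  of points, can contain only about a third of \<open>F\<close> each.\<close>

lemma escape_disjoint_translates:
  assumes "finite F" "inj_on f F" "inj_on h F"
    and "B \<inter> f ` B = {}" "B \<inter> h ` B = {}" "f ` B \<inter> h ` B = {}"
  shows "3 * card (F \<inter> B) \<le> card F + escape f F + escape h F"
proof -
  have moved: "card (F \<inter> B) \<le> card (k ` {x \<in> F \<inter> B. k x \<in> F}) + escape k F" if "inj_on k F" for k
  proof -
    have "F \<inter> B = {x \<in> F \<inter> B. k x \<in> F} \<union> {x \<in> F \<inter> B. k x \<notin> F}" by blast
    then have "card (F \<inter> B) \<le> card {x \<in> F \<inter> B. k x \<in> F} + card {x \<in> F \<inter> B. k x \<notin> F}"
      by (metis (no_types, lifting) card_Un_le)
    moreover have "card {x \<in> F \<inter> B. k x \<notin> F} \<le> escape k F"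
      unfolding escape_def using assms(1) by (intro card_mono) auto
    moreover have "card (k ` {x \<in> F \<inter> B. k x \<in> F}) = card {x \<in> F \<inter> B. k x \<in> F}"
      by (rule card_image[OF inj_on_subset[OF that]]) blast
    ultimately show ?thesis by linarith
  qed
  let ?f = "f ` {x \<in> F \<inter> B. f x \<in> F}" and ?h = "h ` {x \<in> F \<inter> B. h x \<in> F}"
  have fin: "finite (F \<inter> B)" "finite ?f" "finite ?h" using assms(1) by auto
  have "card (F \<inter> B) + card ?f + card ?h = card (F \<inter> B \<union> ?f) + card ?h"
    using fin assms(4) by (subst card_Un_disjoint) auto
  also have "\<dots> = card (F \<inter> B \<union> ?f \<union> ?h)"
    using fin assms(5,6) by (subst card_Un_disjoint) auto
  also have "\<dots> \<le> card F" using assms(1) by (intro card_mono) auto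
  finally show ?thesis using moved[OF assms(2)] moved[OF assms(3)] by linarith
qed

lemma swap_unit_interval:
  obtains \<sigma> :: "rat \<Rightarrow> rat" where "\<forall>x. \<sigma> (\<sigma> x) = x" "\<forall>x. \<sigma> x \<in> {0..<1} \<longleftrightarrow> x \<notin> {0..<1}"
proof -
  let ?U = "{0..<1::rat}"
  have "infinite ?U" by (simp add: infinite_Ico)
  have "infinite (- ?U)"
  proof -
    have "{1..<2::rat} \<subseteq> - ?U" by auto
    moreover have "infinite {1..<2::rat}" by (simp add: infinite_Ico)
    ultimately show ?thesis using finite_subset by blast
  qed
  obtain f g where f: "bij_betw f (UNIV :: nat set) ?U" and g: "bij_betw g (UNIV :: nat set) (- ?U)"
    using countable_infiniteE'[of ?U] countable_infiniteE'[of "- ?U"] \<open>infinite ?U\<close> \<open>infinite (- ?U)\<close>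
    by (metis countableI_type)
  define h where "h = g \<circ> inv_into UNIV f"
  have h: "bij_betw h ?U (- ?U)"
    unfolding h_def using bij_betw_trans[OF bij_betw_inv_into[OF f] g] .
  define \<sigma> where "\<sigma> x = (if x \<in> ?U then h x else inv_into ?U h x)" for x
  have hU: "h x \<notin> ?U" "inv_into ?U h (h x) = x" if "x \<in> ?U" for x
    using bij_betw_apply[OF h that] bij_betw_inv_into_left[OF h that] by auto
  have hC: "inv_into ?U h x \<in> ?U" "h (inv_into ?U h x) = x" if "x \<notin> ?U" for x
    using bij_betw_apply[OF bij_betw_inv_into[OF h], of x] bij_betw_inv_into_right[OF h, of x] that by auto
  have \<sigma>U: "\<sigma> x = h x" if "x \<in> ?U" for x using that by (simp only: \<sigma>_def if_True)
  have \<sigma>C: "\<sigma> x = inv_into ?U h x" if "x \<notin> ?U" for x using that by (simp only: \<sigma>_def if_False)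
  show thesis
  proof (rule that; rule allI)
    fix x
    show "\<sigma> (\<sigma> x) = x"
    proof (cases "x \<in> ?U")
      case True
      show ?thesis unfolding \<sigma>U[OF True] \<sigma>C[OF hU(1)[OF True]] by (rule hU(2)[OF True])
    next
      case False
      show ?thesis unfolding \<sigma>C[OF False] \<sigma>U[OF hC(1)[OF False]] by (rule hC(2)[OF False])
    qed
    show "\<sigma> x \<in> ?U \<longleftrightarrow> x \<notin> ?U"
    proof (cases "x \<in> ?U")
      case True
      then show ?thesis unfolding \<sigma>U[OF True] using hU(1)[OF True] by blast
    next
      case False
      then show ?thesis unfolding \<sigma>C[OF False] using hC(1)[OF False] by blast
    qed
  qed
qed

text \<open>Let the first factor act by translations, and the second one by translations conjugated by an
  involution that exchanges the unit interval \<open>U\<close> with its complement. The first factor contains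
  elements for which \<open>U\<close> has three disjoint translates, the second one such elements for the
  complement of \<open>U\<close>. So an almost invariant set would have only about a third of its points in \<open>U\<close>,
  and only about a third outside.\<close>

lemma free_product_rat_nonamenable_action:
  obtains \<phi> :: "(rat + rat) list set \<Rightarrow> rat \<Rightarrow> rat" where
    "acts (free_product rat_group rat_group) UNIV \<phi>"
    "\<not> amenable_action (free_product rat_group rat_group) UNIV \<phi>"
    "\<forall>x y. \<phi> (fp_class rat_group rat_group [Inl x]) y = x + y"
proof -
  let ?P = "free_product rat_group rat_group"
  obtain \<sigma> :: "rat \<Rightarrow> rat" where "\<forall>x. \<sigma> (\<sigma> x) = x" "\<forall>x. \<sigma> x \<in> {0..<1} \<longleftrightarrow> x \<notin> {0..<1}"
    by (rule swap_unit_interval)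
  note \<sigma> = this[rule_format]
  define \<beta> where "\<beta> k x = \<sigma> (k + \<sigma> x)" for k x
  have inj_\<sigma>: "inj \<sigma>" using \<sigma>(1) by (rule inj_on_inverseI)
  interpret two_actions rat_group rat_group UNIV "(+)" \<beta>
    by (simp add: two_actions_def two_actions_axioms_def group_rat_group acts_def \<beta>_def \<sigma>(1) add.assoc)
  let ?\<phi> = "fp_act (+) \<beta>"
  have Inl: "?\<phi> (fp_class rat_group rat_group [Inl x]) y = x + y" for x y
    using fp_act_class[of "[Inl x]" y] by simp
  have Inr: "?\<phi> (fp_class rat_group rat_group [Inr x]) y = \<beta> x y" for x y
    using fp_act_class[of "[Inr x]" y] by simp
  have "\<not> amenable_action ?P UNIV ?\<phi>"
  proof
    assume am: "amenable_action ?P UNIV ?\<phi>"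
    let ?\<Omega> = "{fp_class rat_group rat_group [Inl 1], fp_class rat_group rat_group [Inl 2],
       fp_class rat_group rat_group [Inr 1], fp_class rat_group rat_group [Inr 2]}"
    have "?\<Omega> \<subseteq> carrier ?P" by (simp add: free_product_def)
    then obtain F where F: "foelner_set ?\<phi> ?\<Omega> (1/4) F"
      using amenable_actionE[OF am group_free_product[OF group_rat_group group_rat_group] acts_free_product, of "1/4" ?\<Omega>]
      by auto
    note FD = foelner_setD[OF F]
    have eqs: "?\<phi> (fp_class rat_group rat_group [Inl x]) = (+) x"
      "?\<phi> (fp_class rat_group rat_group [Inr x]) = \<beta> x" for x
      by (rule ext, rule Inl) (rule ext, rule Inr)
    have esc: "4 * real (escape ((+) 1) F) < card F" "4 * real (escape ((+) 2) F) < card F"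
      "4 * real (escape (\<beta> 1) F) < card F" "4 * real (escape (\<beta> 2) F) < card F"
      using FD(4)[of "fp_class rat_group rat_group [Inl 1]"] FD(4)[of "fp_class rat_group rat_group [Inl 2]"]
        FD(4)[of "fp_class rat_group rat_group [Inr 1]"] FD(4)[of "fp_class rat_group rat_group [Inr 2]"]
      by (simp_all add: eqs)
    let ?U = "{0..<1::rat}"
    have 1: "3 * card (F \<inter> ?U) \<le> card F + escape ((+) 1) F + escape ((+) 2) F"
      by (rule escape_disjoint_translates[OF FD(1)]) auto
    have img: "\<beta> k ` (- ?U) = \<sigma> ` ((+) k ` ?U)" for k
    proof -
      have "\<sigma> ` (- ?U) = ?U"
      proof
        show "\<sigma> ` (- ?U) \<subseteq> ?U" using \<sigma>(2) by blast
        show "?U \<subseteq> \<sigma> ` (- ?U)"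
        proof
          fix x assume "x \<in> ?U"
          then have "\<sigma> x \<in> - ?U" using \<sigma>(2)[of x] by blast
          then show "x \<in> \<sigma> ` (- ?U)" by (rule rev_image_eqI) (rule \<sigma>(1)[symmetric])
        qed
      qed
      then show ?thesis unfolding \<beta>_def by (metis image_image)
    qed
    have C: "- ?U = \<sigma> ` ((+) 0 ` ?U)"
      using img[of 0] \<sigma>(1) by (simp add: \<beta>_def)
    have disj: "\<sigma> ` A \<inter> \<sigma> ` B = {}" if "A \<inter> B = {}" for A B
      using that image_Int[OF inj_\<sigma>, of A B] by simp
    have inj_\<beta>: "inj_on (\<beta> k) F" for k
      using acts_inj[OF group_rat_group acts_K, of k] inj_on_subset by auto
    have 2: "3 * card (F \<inter> - ?U) \<le> card F + escape (\<beta> 1) F + escape (\<beta> 2) F"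
    proof (rule escape_disjoint_translates[OF FD(1) inj_\<beta> inj_\<beta>])
      show "- ?U \<inter> \<beta> 1 ` (- ?U) = {}" unfolding img by (subst C, rule disj) auto
      show "- ?U \<inter> \<beta> 2 ` (- ?U) = {}" unfolding img by (subst C, rule disj) auto
      show "\<beta> 1 ` (- ?U) \<inter> \<beta> 2 ` (- ?U) = {}" unfolding img by (rule disj) auto
    qed
    have "card F = card (F \<inter> ?U) + card (F \<inter> - ?U)"
      using FD(1) by (subst card_Un_disjoint[symmetric]) (auto intro!: arg_cong[where f = card])
    with 1 2 esc show False by linarith
  qed
  with acts_free_product Inl show thesis by (intro that[of ?\<phi>] allI)
qed

section \<open>Transport along isomorphisms\<close>

lemma A_separable_iso:
  assumes G: "group G" and P: "group P" "A_separable P" and \<psi>: "\<psi> \<in> iso G P"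
  shows "A_separable G"
  unfolding A_separable_iff
proof (intro allI impI, elim conjE)
  fix H \<Omega> assume H: "subgroup H G" and \<Omega>: "finite \<Omega>" "\<Omega> \<subseteq> carrier G"
  have hom: "\<psi> \<in> hom G P" and bij: "bij_betw \<psi> (carrier G) (carrier P)"
    using \<psi> by (auto simp: iso_def)
  interpret group_hom G P \<psi>
    using G P(1) hom by (simp add: group_hom_def group_hom_axioms_def)
  have "subgroup (\<psi> ` H) P" by (rule subgroup_img_is_subgroup[OF H])
  moreover have "\<psi> ` \<Omega> \<subseteq> carrier P" using \<Omega>(2) bij by (auto simp: bij_betw_def)
  ultimately have "\<exists>L. co_amenable P L \<and> L \<inter> \<psi> ` \<Omega> = \<psi> ` H \<inter> \<psi> ` \<Omega>"
    using P(2)[unfolded A_separable_iff, THEN spec, THEN spec, THEN mp, of "\<psi> ` H" "\<psi> ` \<Omega>"] \<Omega>(1) by simp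
  then obtain L where L: "co_amenable P L" "L \<inter> \<psi> ` \<Omega> = \<psi> ` H \<inter> \<psi> ` \<Omega>" by blast
  have sub: "subgroup L P" and am: "amenable_action P (lcosets\<^bsub>P\<^esub> L) (\<lambda>g C. g <#\<^bsub>P\<^esub> C)"
    using L(1) by (auto simp: co_amenable_def)
  let ?act = "\<lambda>g C. \<psi> g <#\<^bsub>P\<^esub> C"
  have act: "acts G (lcosets\<^bsub>P\<^esub> L) ?act"
    by (rule acts_comp_hom[OF G P(1) hom acts_lcosets[OF P(1) sub]])
  have L0: "L \<in> lcosets\<^bsub>P\<^esub> L"
    using group.lcos_mult_one[OF P(1) subgroup.subset[OF sub]] by (auto simp: LCOSETS_def)
  have "co_amenable G (stabilizer G ?act L)"
  proof (rule co_amenable_stabilizer[OF G act L0])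
    show "amenable_action G (orbit G ?act L) ?act"
    proof (rule amenable_action_pushforward[where f = id, OF P(1) acts_lcosets[OF P(1) sub] G acts_orbit[OF G act L0] _ _ am])
      have "C \<in> orbit G ?act L" if C: "C \<in> lcosets\<^bsub>P\<^esub> L" for C
      proof -
        obtain p where p: "p \<in> carrier P" "C = p <#\<^bsub>P\<^esub> L" using C by (auto simp: LCOSETS_def)
        then obtain g where "g \<in> carrier G" "p = \<psi> g" using bij by (auto simp: bij_betw_def)
        with p(2) show ?thesis by (auto simp: orbit_def)
      qed
      then show "id ` (lcosets\<^bsub>P\<^esub> L) \<subseteq> orbit G ?act L" by auto
      show "\<exists>p\<in>carrier P. \<forall>C\<in>lcosets\<^bsub>P\<^esub> L. id (p <#\<^bsub>P\<^esub> C) = \<psi> g <#\<^bsub>P\<^esub> id C" if "g \<in> carrier G" for g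
        using that by (intro bexI[of _ "\<psi> g"]) auto
    qed
  qed
  moreover have "stabilizer G ?act L \<inter> \<Omega> = H \<inter> \<Omega>"
  proof -
    have "\<psi> g <#\<^bsub>P\<^esub> L = L \<longleftrightarrow> g \<in> H" if g: "g \<in> \<Omega>" for g
    proof -
      have gG: "g \<in> carrier G" using g \<Omega>(2) by blast
      have "\<psi> g <#\<^bsub>P\<^esub> L = L \<longleftrightarrow> \<psi> g \<in> L"
        using group.lcos_self[OF P(1) _ sub, of "\<psi> g"] group.coset_join3[OF P(1) _ sub, of "\<psi> g"] gG by auto
      also have "\<dots> \<longleftrightarrow> \<psi> g \<in> \<psi> ` H" using L(2) g by blast
      also have "\<dots> \<longleftrightarrow> g \<in> H"
        using bij gG subgroup.subset[OF H] by (auto simp: bij_betw_def dest: inj_onD)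
      finally show ?thesis .
    qed
    then show ?thesis using \<Omega>(2) unfolding stabilizer_def by blast
  qed
  ultimately show "\<exists>K. co_amenable G K \<and> K \<inter> \<Omega> = H \<inter> \<Omega>" by blast
qed

lemma countably_infinite_group_nat_copy:
  assumes "countably_infinite_group P"
  obtains G :: "nat monoid" and \<psi> where "countably_infinite_group G" "\<psi> \<in> iso G P"
proof -
  interpret group P using assms by (simp add: countably_infinite_group_def)
  obtain \<psi> :: "nat \<Rightarrow> _" where \<psi>: "bij_betw \<psi> UNIV (carrier P)"
    using assms countable_infiniteE'[of "carrier P"] unfolding countably_infinite_group_def by blast
  define \<theta> where "\<theta> = inv_into UNIV \<psi>"
  define G :: "nat monoid" where "G = \<lparr>carrier = UNIV, mult = (\<lambda>m n. \<theta> (\<psi> m \<otimes>\<^bsub>P\<^esub> \<psi> n)), one = \<theta> \<one>\<^bsub>P\<^esub>\<rparr>"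
  have \<psi>P: "\<psi> n \<in> carrier P" for n using \<psi> by (auto simp: bij_betw_def)
  have \<psi>\<theta>: "\<psi> (\<theta> p) = p" if "p \<in> carrier P" for p
    using bij_betw_inv_into_right[OF \<psi> that] by (simp add: \<theta>_def)
  have \<theta>\<psi>: "\<theta> (\<psi> n) = n" for n
    using bij_betw_inv_into_left[OF \<psi>, of n] by (simp add: \<theta>_def)
  have "group G"
  proof (rule groupI)
    fix x assume "x \<in> carrier G"
    show "\<exists>y\<in>carrier G. y \<otimes>\<^bsub>G\<^esub> x = \<one>\<^bsub>G\<^esub>"
      by (rule bexI[of _ "\<theta> (inv\<^bsub>P\<^esub> (\<psi> x))"]) (simp_all add: G_def \<psi>\<theta> \<psi>P)
  qed (simp_all add: G_def \<psi>\<theta> \<theta>\<psi> \<psi>P m_assoc)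
  then have "countably_infinite_group G" by (simp add: countably_infinite_group_def G_def)
  moreover have "\<psi> \<in> iso G P"
    using \<psi> \<psi>P by (auto simp: iso_def hom_def G_def \<psi>\<theta>)
  ultimately show thesis by (rule that)
qed

text \<open>The example is a copy of the free product of two copies of the rationals. It is A-separable
  because the rationals are amenable, not LERF because it contains the divisible group of rationals,
  and not amenable because of the ping-pong action. This action also shows that the rationals
  embed, as translations by different numbers are different.\<close>

lemma A_separable_not_LERF_not_amenable:
  "\<exists>G :: nat monoid. countably_infinite_group G \<and> A_separable G \<and> \<not> LERF G \<and> \<not> amenable_group G"
proof -
  let ?P = "free_product rat_group rat_group"
  let ?i = "\<lambda>x. fp_class rat_group rat_group [Inl x]"
  note Q = group_rat_group
  have P: "group ?P" by (rule group_free_product[OF Q Q])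
  obtain \<phi> :: "(rat + rat) list set \<Rightarrow> rat \<Rightarrow> rat" where \<phi>: "acts ?P UNIV \<phi>"
      "\<not> amenable_action ?P UNIV \<phi>" and "\<forall>x y. \<phi> (?i x) y = x + y"
    by (rule free_product_rat_nonamenable_action)
  then have \<phi>i: "\<phi> (?i x) y = x + y" for x y by blast
  have inj: "inj ?i"
  proof (rule injI)
    fix x y assume "?i x = ?i y"
    then have "\<phi> (?i x) 0 = \<phi> (?i y) 0" by simp
    then show "x = y" by (simp add: \<phi>i)
  qed
  have i: "?i \<in> hom rat_group ?P" by (rule fp_class_Inl_hom[OF Q Q])
  have "infinite (carrier ?P)"
  proof
    assume "finite (carrier ?P)"
    moreover have "range ?i \<subseteq> carrier ?P" using hom_in_carrier[OF i] by auto
    ultimately have "finite (range ?i)" using finite_subset by blast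
    then show False using finite_imageD[OF _ inj] infinite_UNIV_char_0 by blast
  qed
  moreover have "countable (carrier ?P)" by (simp add: free_product_def)
  ultimately have "countably_infinite_group ?P" using P by (simp add: countably_infinite_group_def)
  then obtain G :: "nat monoid" and \<psi> where G: "countably_infinite_group G" and \<psi>: "\<psi> \<in> iso G ?P"
    by (rule countably_infinite_group_nat_copy)
  have grp: "group G" using G by (simp add: countably_infinite_group_def)
  have "A_separable ?P"
    using A_separable_free_product amenable_group_A_separable[OF Q amenable_rat_group] Q by blast
  then have "A_separable G" by (rule A_separable_iso[OF grp P _ \<psi>])
  moreover have "\<not> LERF G"
  proof
    assume "LERF G"
    let ?\<theta> = "inv_into (carrier G) \<psi>"
    have \<theta>: "?\<theta> \<in> iso ?P G" using group.iso_set_sym[OF grp \<psi>] .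
    then have "?\<theta> \<circ> ?i \<in> hom rat_group G" using hom_compose[OF i] by (auto simp: iso_def)
    from LERF_hom_rat_group_trivial[OF grp \<open>LERF G\<close> this, of 0]
      LERF_hom_rat_group_trivial[OF grp \<open>LERF G\<close> this, of 1]
    have "?\<theta> (?i 0) = ?\<theta> (?i 1)" by simp
    moreover have "inj_on ?\<theta> (carrier ?P)" using \<theta> by (auto simp: iso_def bij_betw_def)
    ultimately have "?i 0 = ?i 1" using hom_in_carrier[OF i] by (auto dest: inj_onD)
    then show False using injD[OF inj, of 0 1] by simp
  qed
  moreover have "\<not> amenable_group G"
  proof
    assume am: "amenable_group G"
    have hom: "\<psi> \<in> hom G ?P" and surj: "\<psi> ` carrier G = carrier ?P"
      using \<psi> by (auto simp: iso_def bij_betw_def)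
    note act = acts_comp_hom[OF grp P hom \<phi>(1)]
    have "amenable_action G UNIV (\<lambda>g. \<phi> (\<psi> g))"
      by (rule amenable_group_amenable_action[OF grp am act]) simp
    then have "amenable_action ?P UNIV \<phi>"
    proof (rule amenable_action_pushforward[where f = id, OF grp act P \<phi>(1), rotated 2])
      show "\<exists>g\<in>carrier G. \<forall>y\<in>UNIV. id (\<phi> (\<psi> g) y) = \<phi> p (id y)" if p: "p \<in> carrier ?P" for p
      proof -
        obtain g where "g \<in> carrier G" "p = \<psi> g" using p surj by blast
        then show ?thesis by auto
      qed
    qed simp
    with \<phi>(2) show False by contradiction
  qed
  ultimately show ?thesis using G by blast
qed

theorem theorem1p4:
  shows
    "(\<forall>G :: 'a monoid. countably_infinite_group G \<longrightarrow>
        LERF G \<or> amenable_group G \<longrightarrow> A_separable G) \<and>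
     (\<forall>(G :: 'a monoid) (K :: 'b monoid).
        countably_infinite_group G \<longrightarrow> countably_infinite_group K \<longrightarrow>
        A_separable G \<longrightarrow> A_separable K \<longrightarrow> A_separable (free_product G K)) \<and>
     (\<exists>G :: nat monoid. countably_infinite_group G \<and>
        A_separable G \<and> \<not> LERF G \<and> \<not> amenable_group G) \<and>
     (\<forall>G :: 'a monoid. countably_infinite_group G \<longrightarrow>
        property_T G \<longrightarrow> (A_separable G \<longleftrightarrow> LERF G))"
proof (intro conjI allI impI)
  fix G :: "'a monoid"
  assume "countably_infinite_group G"
  then have G: "group G" by (simp add: countably_infinite_group_def)
  show "A_separable G" if "LERF G \<or> amenable_group G"
    using that LERF_A_separable[OF G] amenable_group_A_separable[OF G] by (elim disjE)
  show "A_separable G \<longleftrightarrow> LERF G" if "property_T G"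
    using LERF_A_separable[OF G] property_T_A_separable_LERF[OF G that] by (rule iffI[rotated])
next
  fix G :: "'a monoid" and K :: "'b monoid"
  assume "countably_infinite_group G" "countably_infinite_group K" "A_separable G" "A_separable K"
  then show "A_separable (free_product G K)"
    by (simp add: countably_infinite_group_def A_separable_free_product)
next
  show "\<exists>G :: nat monoid. countably_infinite_group G \<and>
      A_separable G \<and> \<not> LERF G \<and> \<not> amenable_group G"
    by (rule A_separable_not_LERF_not_amenable)
qed

end
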